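(* Let $R$ be a non-degenerate nc rational expression in $x_1,\dots,x_d$ over a field $\mathbb K$, let $s\in\mathbb N$ and let $\underline Y\in dom_s(R)$. 1. If $\widetilde{\underline Y}\in dom_s(R)$, then $L_R(\underline Y)=L_R(\widetilde{\underline Y})$. 2. If $n\in\mathbb N$, then $I_n\otimes\underline Y\in dom_{sn}(R)$ and $L_R(I_n\otimes\underline Y)=n\,L_R(\underline Y)$. 3. If $s'\in\mathbb N$ and $\underline Y'\in dom_{s'}(R)$, then $s'L_R(\underline Y)=s\,L_R(\underline Y')$.
   Context: $\mathbb K$ is a field, $\mathbb N=\{1,2,\dots\}$, $d\in\mathbb N$; underlined letters denote tuples; $\otimes$ is the Kronecker product and $I_n\otimes\underline Y=(I_n\otimes Y_1,\dots,I_n\otimes Y_d)$. NC rational expressions. A nc rational expression $R$ in $x_1,\dots,x_d$ over $\mathbb K$ is a formal expression obtained from nc polynomials in $\mathbb K\langle x_1,\dots,x_d\rangle$ by successive additions, multiplications and inversions. $dom_n(R)\subseteq(\mathbb K^{n\times n})^d$ is the set of $d$-tuples of $n\times n$ matrices at which all inverses occurring in $R$ exist (evaluating recursively), and $R(\underline X)\in\mathbb K^{n\times n}$ is the resulting value. $R$ is non-degenerate if $dom_n(R)\ne\emptyset$ for some $n$. Realizations. A nc Fornasini--Marchesini realization $\mathcal R$ centred at $\underline Y\in(\mathbb K^{s\times s})^d$, described by $(L,D,C,\underline{\mathbf A},\underline{\mathbf B})$, consists of a dimension $L\in\mathbb N$, linear mappings $\mathbf A_1,\dots,\mathbf A_d:\mathbb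 K^{s\times s}\to\mathbb K^{L\times L}$, $\mathbf B_1,\dots,\mathbf B_d:\mathbb K^{s\times s}\to\mathbb K^{L\times s}$ and matrices $C\in\mathbb K^{s\times L}$, $D\in\mathbb K^{s\times s}$. A linear mapping $\mathbf T$ on $s\times s$ matrices is extended to $X=[X_{ij}]_{i,j=1}^m\in\mathbb K^{sm\times sm}$ ($X_{ij}\in\mathbb K^{s\times s}$) by $(X)\mathbf T=[\mathbf T(X_{ij})]_{i,j=1}^m$. Put $DOM_{sm}(\mathcal R)=\{\underline X\in(\mathbb K^{sm\times sm})^d:\det(I_{Lm}-\sum_{k=1}^d(X_k-I_m\otimes Y_k)\mathbf A_k)\ne0\}$ and for such $\underline X$ $$\mathcal R(\underline X)=I_m\otimes D+(I_m\otimes C)\Big(I_{Lm}-\sum_{k=1}^d(X_k-I_m\otimes Y_k)\mathbf A_k\Big)^{-1}\sum_{k=1}^d(X_k-I_m\otimes Y_k)\mathbf B_k.$$ For $\underline Y\in dom_s(R)$, $\mathcal R$ is a realization of $R$ centred at $\underline Y$ if for every $m\in\mathbb N$: $dom_{sm}(R)\subseteq DOM_{sm}(\mathcal R)$ and $R(\underline X)=\mathcal R(\underline X)$ for all $\underline X\in dom_{sm}(R)$. $L_R(\underline Y)$ denotes the dimension of a minimal such realization, i.e. the smallest $L\in\mathbb N$ for which $R$ admits a nc Fornasini--Marchesini realization of dimension $L$ centred at $\underline Y$ (one always exists).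
   Formalization: Realizations of dimension L = 0 are also allowed in the definition of L_R. With L in {1,2,...} the claim fails for constants: R = 0 has L_R = 1 at every centre, contradicting parts 2 and 3. For expressions without a 0-dimensional realization, L_R is unchanged. *)

theory Defs
  imports
    "HOL-Library.Poly_Mapping"
    "Jordan_Normal_Form.Gauss_Jordan_Elimination"
    "Jordan_Normal_Form.Determinant"
begin

(* The variables x_1, ..., x_d are indexed by a finite type 'd, so d = CARD('d) >= 1, and a
   d-tuple of matrices is a function 'd => 'a mat. *)

section \<open>Matrix operations\<close>

definition mat_sum :: "nat \<Rightarrow> nat \<Rightarrow> ('i \<Rightarrow> 'a::comm_monoid_add mat) \<Rightarrow> 'i set \<Rightarrow> 'a mat" where
  "mat_sum nr nc F I = mat nr nc (\<lambda>(i, j). \<Sum>k\<in>I. F k $$ (i, j))"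

definition kronecker :: "'a::semiring_1 mat \<Rightarrow> 'a mat \<Rightarrow> 'a mat" where
  "kronecker A B = mat (dim_row A * dim_row B) (dim_col A * dim_col B)
     (\<lambda>(i, j). A $$ (i div dim_row B, j div dim_col B) * B $$ (i mod dim_row B, j mod dim_col B))"

definition ampl :: "nat \<Rightarrow> ('d \<Rightarrow> 'a::semiring_1 mat) \<Rightarrow> 'd \<Rightarrow> 'a mat" where
  "ampl n Y = (\<lambda>k. kronecker (1\<^sub>m n) (Y k))"

definition linear_mat_map :: "nat \<Rightarrow> nat \<Rightarrow> nat \<Rightarrow> ('a::field mat \<Rightarrow> 'a mat) \<Rightarrow> bool" where
  "linear_mat_map s r c T \<longleftrightarrow>
     (\<forall>M \<in> carrier_mat s s. T M \<in> carrier_mat r c) \<and>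
     (\<forall>M \<in> carrier_mat s s. \<forall>N \<in> carrier_mat s s. T (M + N) = T M + T N) \<and>
     (\<forall>a. \<forall>M \<in> carrier_mat s s. T (a \<cdot>\<^sub>m M) = a \<cdot>\<^sub>m T M)"

definition mat_block :: "nat \<Rightarrow> 'a mat \<Rightarrow> nat \<Rightarrow> nat \<Rightarrow> 'a mat" where
  "mat_block s X i j = mat s s (\<lambda>(p, q). X $$ (s * i + p, s * j + q))"

(* (X)T = [T(X_ij)] for an m-by-m block matrix X with s-by-s blocks X_ij and T with values
   in r-by-c matrices. *)
definition block_apply ::
    "nat \<Rightarrow> nat \<Rightarrow> nat \<Rightarrow> nat \<Rightarrow> ('a mat \<Rightarrow> 'a mat) \<Rightarrow> 'a mat \<Rightarrow> 'a mat" where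
  "block_apply s r c m T X =
     mat (r * m) (c * m) (\<lambda>(i, j). T (mat_block s X (i div r) (j div c)) $$ (i mod r, j mod c))"

section \<open>Noncommutative rational expressions\<close>

(* A nc polynomial is a finitely supported family of coefficients indexed by words. *)
type_synonym ('d, 'a) nc_poly = "'d list \<Rightarrow>\<^sub>0 'a"

datatype 'p rat_expr =
    Poly 'p
  | Plus "'p rat_expr" "'p rat_expr"
  | Times "'p rat_expr" "'p rat_expr"
  | Inverse "'p rat_expr"

type_synonym ('d, 'a) nc_rat = "('d, 'a) nc_poly rat_expr"

definition word_eval :: "nat \<Rightarrow> ('d \<Rightarrow> 'a::field mat) \<Rightarrow> 'd list \<Rightarrow> 'a mat" where
  "word_eval n X w = foldr (\<lambda>k M. X k * M) w (1\<^sub>m n)"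

definition poly_eval :: "nat \<Rightarrow> ('d \<Rightarrow> 'a::field mat) \<Rightarrow> ('d, 'a) nc_poly \<Rightarrow> 'a mat" where
  "poly_eval n X p =
     mat_sum n n (\<lambda>w. Poly_Mapping.lookup p w \<cdot>\<^sub>m word_eval n X w) (Poly_Mapping.keys p)"

(* Partial evaluation: None iff some inverse occurring in the expression does not exist
   (mat_inverse returns None on singular matrices). *)
primrec nc_eval ::
    "nat \<Rightarrow> ('d \<Rightarrow> 'a::field mat) \<Rightarrow> ('d, 'a) nc_rat \<Rightarrow> 'a mat option" where
  "nc_eval n X (Poly p) = Some (poly_eval n X p)"
| "nc_eval n X (Plus R S) =
     Option.bind (nc_eval n X R) (\<lambda>M. Option.bind (nc_eval n X S) (\<lambda>N. Some (M + N)))"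
| "nc_eval n X (Times R S) =
     Option.bind (nc_eval n X R) (\<lambda>M. Option.bind (nc_eval n X S) (\<lambda>N. Some (M * N)))"
| "nc_eval n X (Inverse R) = Option.bind (nc_eval n X R) mat_inverse"

definition nc_dom :: "nat \<Rightarrow> ('d, 'a::field) nc_rat \<Rightarrow> ('d \<Rightarrow> 'a mat) set" where
  "nc_dom n R = {X. (\<forall>k. X k \<in> carrier_mat n n) \<and> nc_eval n X R \<noteq> None}"

definition nondegenerate :: "('d, 'a::field) nc_rat \<Rightarrow> bool" where
  "nondegenerate R \<longleftrightarrow> (\<exists>n\<ge>1. nc_dom n R \<noteq> {})"

section \<open>Fornasini--Marchesini realizations\<close>

record ('d, 'a) fm_realization =
  fm_L :: nat
  fm_D :: "'a mat"
  fm_C :: "'a mat"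
  fm_A :: "'d \<Rightarrow> 'a mat \<Rightarrow> 'a mat"
  fm_B :: "'d \<Rightarrow> 'a mat \<Rightarrow> 'a mat"

(* The dimension 0 is admitted: it corresponds to the constant functions X |-> I_m (x) D.
   Requiring dimension >= 1 would give every constant expression minimal dimension 1 at every
   centre, whatever its size; see fm_min_dim_eq_positive for all other expressions. *)
definition is_fm_realization :: "nat \<Rightarrow> ('d, 'a::field) fm_realization \<Rightarrow> bool" where
  "is_fm_realization s \<R> \<longleftrightarrow>
     fm_D \<R> \<in> carrier_mat s s \<and>
     fm_C \<R> \<in> carrier_mat s (fm_L \<R>) \<and>
     (\<forall>k. linear_mat_map s (fm_L \<R>) (fm_L \<R>) (fm_A \<R> k)) \<and>
     (\<forall>k. linear_mat_map s (fm_L \<R>) s (fm_B \<R> k))"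

definition fm_pencil ::
    "nat \<Rightarrow> ('d::finite \<Rightarrow> 'a::field mat) \<Rightarrow> ('d, 'a) fm_realization \<Rightarrow>
     nat \<Rightarrow> ('d \<Rightarrow> 'a mat) \<Rightarrow> 'a mat" where
  "fm_pencil s Y \<R> m X =
     1\<^sub>m (fm_L \<R> * m) -
     mat_sum (fm_L \<R> * m) (fm_L \<R> * m)
       (\<lambda>k. block_apply s (fm_L \<R>) (fm_L \<R>) m (fm_A \<R> k) (X k - ampl m Y k)) UNIV"

definition fm_DOM ::
    "nat \<Rightarrow> ('d::finite \<Rightarrow> 'a::field mat) \<Rightarrow> ('d, 'a) fm_realization \<Rightarrow>
     nat \<Rightarrow> ('d \<Rightarrow> 'a mat) set" where
  "fm_DOM s Y \<R> m =
     {X. (\<forall>k. X k \<in> carrier_mat (s * m) (s * m)) \<and> det (fm_pencil s Y \<R> m X) \<noteq> 0}"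

definition fm_eval ::
    "nat \<Rightarrow> ('d::finite \<Rightarrow> 'a::field mat) \<Rightarrow> ('d, 'a) fm_realization \<Rightarrow>
     nat \<Rightarrow> ('d \<Rightarrow> 'a mat) \<Rightarrow> 'a mat" where
  "fm_eval s Y \<R> m X =
     kronecker (1\<^sub>m m) (fm_D \<R>) +
     kronecker (1\<^sub>m m) (fm_C \<R>) * the (mat_inverse (fm_pencil s Y \<R> m X)) *
     mat_sum (fm_L \<R> * m) (s * m)
       (\<lambda>k. block_apply s (fm_L \<R>) s m (fm_B \<R> k) (X k - ampl m Y k)) UNIV"

definition fm_realizes ::
    "nat \<Rightarrow> ('d::finite \<Rightarrow> 'a::field mat) \<Rightarrow> ('d, 'a) fm_realization \<Rightarrow>
     ('d, 'a) nc_rat \<Rightarrow> bool" where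
  "fm_realizes s Y \<R> R \<longleftrightarrow>
     is_fm_realization s \<R> \<and>
     (\<forall>m\<ge>1. nc_dom (s * m) R \<subseteq> fm_DOM s Y \<R> m \<and>
            (\<forall>X \<in> nc_dom (s * m) R. nc_eval (s * m) X R = Some (fm_eval s Y \<R> m X)))"

(* L_R(Y) for a centre Y in dom_s(R) *)
definition fm_min_dim ::
    "nat \<Rightarrow> ('d, 'a) nc_rat \<Rightarrow> ('d::finite \<Rightarrow> 'a::field mat) \<Rightarrow> nat" where
  "fm_min_dim s R Y = (LEAST L. \<exists>\<R>. fm_realizes s Y \<R> R \<and> fm_L \<R> = L)"

lemma fm_min_dim_eq_positive:
  assumes "\<not> (\<exists>\<R>. fm_realizes s Y \<R> R \<and> fm_L \<R> = 0)"
  shows "fm_min_dim s R Y = (LEAST L. L \<ge> 1 \<and> (\<exists>\<R>. fm_realizes s Y \<R> R \<and> fm_L \<R> = L))"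
proof -
  have "(\<exists>\<R>. fm_realizes s Y \<R> R \<and> fm_L \<R> = L) \<longleftrightarrow>
        L \<ge> 1 \<and> (\<exists>\<R>. fm_realizes s Y \<R> R \<and> fm_L \<R> = L)" for L
    using assms by (cases L) auto
  then show ?thesis
    unfolding fm_min_dim_def by presburger
qed

end

theory Submission
  imports Defs
begin

text \<open>Realizations of \<open>R\<close> at two centres in \<open>nc_dom s R\<close> translate into each other without changing
  the dimension, since the pencil is invertible at the new centre and can be factored out. Ampliating
  a realization multiplies its dimension by \<open>n\<close>, so the point is that the ampliation of a minimal
  realization is again minimal. The domain of \<open>R\<close> is closed under block upper triangular
  extensions; evaluating \<open>R\<close> at block bidiagonal points therefore shows that the Taylor coefficients
  \<open>C A(Z1) \<dots> A(Zl) B(Z)\<close> do not depend on the realization. A minimal realization is controllable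
  and observable, for otherwise restricting to the reachable space, or dividing by the unobservable
  one, would lower the dimension, without losing any point of the domain because the pencil is block
  triangular. Both properties pass to ampliations, and a controllable and observable realization
  injects into every other realization with the same Taylor coefficients. The third claim compares
  \<open>ampl s' Y\<close> with \<open>ampl s Y'\<close>.\<close>

section \<open>Auxiliary facts on sums and matrices\<close>

text \<open>The lower bound for the ampliation is the obstacle. A realization centred at
  \<open>ampl n Y\<close> may use arbitrary linear maps on matrices of size s * n, so nothing forces
  it to come from one centred at \<open>Y\<close>; dimensions can only be compared through an
  invariant of R itself. Power series and generic points are no option, because the field may be
  finite and the domain of R at a given size may be small. The points available over every field are
  those with nilpotent displacement from I \<otimes> Y: there the inverse pencil is a finite sum of
  products, and one block of the value isolates one coefficient. Controllability survives ampliation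
  because the ampliated maps are tested at all matrices, in particular at those with a single
  nonzero diagonal block, so each block of the state can be steered alone. Observability is encoded
  as controllability of the transposed data, to share these arguments. Dimension 0 is kept because
  for constant expressions it is the only value compatible with the factor n.\<close>

lemma sum_lessThan_mult:
  fixes f :: "nat \<Rightarrow> 'a::comm_monoid_add"
  shows "(\<Sum>t<r * m. f t) = (\<Sum>b<m. \<Sum>p<r. f (r * b + p))"
proof -
  have "(\<Sum>t<r * m. f t) = (\<Sum>b<m. sum f {b * r..<b * r + r})"
    using sum.nat_group[of f r m] by (simp add: mult.commute)
  also have "\<dots> = (\<Sum>b<m. \<Sum>p<r. f (r * b + p))"
  proof (rule sum.cong[OF refl])
    fix b
    have "sum f {b * r..<b * r + r} = sum f {0 + b * r..<r + b * r}"
      by (simp add: add.commute)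
    also have "\<dots> = (\<Sum>p = 0..<r. f (p + b * r))"
      by (rule sum.shift_bounds_nat_ivl)
    finally show "sum f {b * r..<b * r + r} = (\<Sum>p<r. f (r * b + p))"
      by (simp add: atLeast0LessThan add.commute mult.commute)
  qed
  finally show ?thesis .
qed

lemma div_lt_mult [simp]: "i < r * m \<Longrightarrow> i div r < m" for i r m :: nat
  by (simp add: less_mult_imp_div_less mult.commute)

lemma mod_lt_mult [simp]: "i < r * m \<Longrightarrow> i mod r < r" for i r m :: nat
  by (cases "r = 0") auto

lemma mult_add_lt [simp]: "b < m \<Longrightarrow> p < r \<Longrightarrow> r * b + p < r * m" for b m p r :: nat
proof -
  assume "b < m" "p < r"
  then have "r * b + p < r * Suc b" by simp
  also have "\<dots> \<le> r * m" using \<open>b < m\<close> by (intro mult_le_mono2) simp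
  finally show ?thesis .
qed

section \<open>Matrix products under dimension equations\<close>

lemma index_mult_mat_sum:
  "i < dim_row A \<Longrightarrow> j < dim_col B \<Longrightarrow> dim_col A = dim_row B \<Longrightarrow>
   (A * B) $$ (i, j) = (\<Sum>t<dim_row B. A $$ (i, t) * B $$ (t, j))"
  by (simp add: scalar_prod_def atLeast0LessThan)

text \<open>Premises are equations between \<open>dim_row\<close> and \<open>dim_col\<close>: the
  dimensions in the \<open>carrier_mat\<close> form cannot be read off the product, so simp could
  not discharge them. With the dimensions of all atoms collected in a fact \<open>dims\<close>,
  whole products are rearranged by rewriting.\<close>

lemma assoc_mult_mat_dim:
  fixes A :: "'a::semiring_0 mat"
  shows "dim_col A = dim_row B \<Longrightarrow> dim_col B = dim_row C \<Longrightarrow> (A * B) * C = A * (B * C)"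
  by (rule assoc_mult_mat[of _ "dim_row A" "dim_row B" _ "dim_row C" _ "dim_col C"]) auto

lemma add_mult_distrib_mat_dim:
  fixes A :: "'a::semiring_0 mat"
  shows "dim_row A = dim_row B \<Longrightarrow> dim_col A = dim_col B \<Longrightarrow> dim_col B = dim_row C \<Longrightarrow>
    (A + B) * C = A * C + B * C"
  by (rule add_mult_distrib_mat[of _ "dim_row A" "dim_row C"]) auto

lemma mult_add_distrib_mat_dim:
  fixes A :: "'a::semiring_0 mat"
  shows "dim_col A = dim_row B \<Longrightarrow> dim_row B = dim_row C \<Longrightarrow> dim_col B = dim_col C \<Longrightarrow>
    A * (B + C) = A * B + A * C"
  by (rule mult_add_distrib_mat[of _ "dim_row A" "dim_row C" _ "dim_col C"]) auto

lemma minus_mult_distrib_mat_dim: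
  fixes A :: "'a::ring mat"
  shows "dim_row A = dim_row B \<Longrightarrow> dim_col A = dim_col B \<Longrightarrow> dim_col B = dim_row C \<Longrightarrow>
    (A - B) * C = A * C - B * C"
  by (rule minus_mult_distrib_mat[of _ "dim_row A" "dim_row C"]) auto

lemma mult_minus_distrib_mat_dim:
  fixes A :: "'a::ring mat"
  shows "dim_col A = dim_row B \<Longrightarrow> dim_row B = dim_row C \<Longrightarrow> dim_col B = dim_col C \<Longrightarrow>
    A * (B - C) = A * B - A * C"
  by (rule mult_minus_distrib_mat[of _ "dim_row A" "dim_row C" _ "dim_col C"]) auto

lemma left_one_mult_mat_dim: "dim_row A = n \<Longrightarrow> 1\<^sub>m n * A = A" for A :: "'a::semiring_1 mat"
  by (rule left_mult_one_mat) auto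

lemma right_one_mult_mat_dim: "dim_col A = n \<Longrightarrow> A * 1\<^sub>m n = A" for A :: "'a::semiring_1 mat"
  by (rule right_mult_one_mat) auto

lemma left_zero_mult_mat_dim: "dim_row A = n \<Longrightarrow> 0\<^sub>m k n * A = 0\<^sub>m k (dim_col A)" 
  for A :: "'a::semiring_0 mat"
  by (rule left_mult_zero_mat) auto

lemma right_zero_mult_mat_dim: "dim_col A = n \<Longrightarrow> A * 0\<^sub>m n k = 0\<^sub>m (dim_row A) k"
  for A :: "'a::semiring_0 mat"
  by (rule right_mult_zero_mat) auto

lemmas mat_dim_simps = assoc_mult_mat_dim add_mult_distrib_mat_dim mult_add_distrib_mat_dim
  minus_mult_distrib_mat_dim mult_minus_distrib_mat_dim left_one_mult_mat_dim
  right_one_mult_mat_dim left_zero_mult_mat_dim right_zero_mult_mat_dim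

text \<open>For square matrices a right inverse is also a left inverse, so singularity is excluded
  and the value is forced. Inverses can then be supplied as witnesses and never have to be
  computed.\<close>

lemma mat_inverse_eqI:
  fixes A :: "'a::field mat"
  assumes A: "A \<in> carrier_mat n n" and B: "B \<in> carrier_mat n n" and AB: "A * B = 1\<^sub>m n"
  shows "mat_inverse A = Some B"
proof (cases "mat_inverse A")
  case None
  from mat_inverse(1)[OF A this, of "()"] mat_mult_left_right_inverse[OF A B AB] A B AB
  show ?thesis unfolding Units_def by (auto simp: ring_mat_simps)
next
  case (Some W)
  from mat_inverse(2)[OF A Some] have W: "W * A = 1\<^sub>m n" "W \<in> carrier_mat n n" by auto
  have "W = W * (A * B)" using W AB by simp
  also have "\<dots> = (W * A) * B" using assoc_mult_mat[OF W(2) A B] by simp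
  finally show ?thesis using W B Some by simp
qed

section \<open>Kronecker products with the identity and block-wise linear maps\<close>

abbreviation Ikron :: "nat \<Rightarrow> 'a::semiring_1 mat \<Rightarrow> 'a mat" where
  "Ikron m D \<equiv> kronecker (1\<^sub>m m) D"

lemma dim_Ikron [simp]:
  "dim_row (Ikron m D) = dim_row D * m" "dim_col (Ikron m D) = dim_col D * m"
  by (auto simp: kronecker_def mult.commute)

lemma Ikron_carrier [simp]: "D \<in> carrier_mat r c \<Longrightarrow> Ikron m D \<in> carrier_mat (r * m) (c * m)"
  by (intro carrier_matI) auto

lemma Ikron_index:
  "i < dim_row D * m \<Longrightarrow> j < dim_col D * m \<Longrightarrow>
   Ikron m D $$ (i, j) =
     (if i div dim_row D = j div dim_col D then D $$ (i mod dim_row D, j mod dim_col D) else 0)"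
  by (auto simp: kronecker_def mult.commute)

text \<open>Row i of I \<otimes> D is supported in a single block of columns, so the sum over all
  columns collapses to that block.\<close>

lemma Ikron_sum_left:
  assumes "i < dim_row D * m"
  shows "(\<Sum>t<dim_col D * m. Ikron m D $$ (i, t) * f t) =
    (\<Sum>p<dim_col D. D $$ (i mod dim_row D, p) * f (dim_col D * (i div dim_row D) + p))"
proof -
  have i: "i div dim_row D < m" using assms by simp
  have "(\<Sum>t<dim_col D * m. Ikron m D $$ (i, t) * f t) =
     (\<Sum>b<m. if b = i div dim_row D then
       (\<Sum>p<dim_col D. D $$ (i mod dim_row D, p) * f (dim_col D * b + p)) else 0)"
    unfolding sum_lessThan_mult
    by (intro sum.cong refl) (auto simp: Ikron_index assms intro!: sum.neutral sum.cong)
  then show ?thesis using i by (simp add: sum.delta)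
qed

lemma Ikron_sum_right:
  fixes D :: "'a::semiring_1 mat"
  assumes "j < dim_col D * m"
  shows "(\<Sum>t<dim_row D * m. f t * Ikron m D $$ (t, j)) =
    (\<Sum>p<dim_row D. f (dim_row D * (j div dim_col D) + p) * D $$ (p, j mod dim_col D))"
proof -
  have j: "j div dim_col D < m" using assms by simp
  have "(\<Sum>t<dim_row D * m. f t * Ikron m D $$ (t, j)) =
     (\<Sum>b<m. if b = j div dim_col D then
       (\<Sum>p<dim_row D. f (dim_row D * b + p) * D $$ (p, j mod dim_col D)) else 0)"
    unfolding sum_lessThan_mult
    by (intro sum.cong refl) (auto simp: Ikron_index assms intro!: sum.neutral sum.cong)
  then show ?thesis using j by (simp add: sum.delta)
qed

lemma Ikron_mult:
  assumes "dim_col A = dim_row B"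
  shows "Ikron m A * Ikron m B = Ikron m (A * B)"
proof (rule eq_matI)
  fix i j assume "i < dim_row (Ikron m (A * B))" "j < dim_col (Ikron m (A * B))"
  then have i: "i < dim_row A * m" and j: "j < dim_col B * m" by auto
  have ip: "dim_col A * (i div dim_row A) + p < dim_row B * m" if "p < dim_row B" for p
    using that i assms by simp
  have "(Ikron m A * Ikron m B) $$ (i, j) =
    (\<Sum>t<dim_col A * m. Ikron m A $$ (i, t) * Ikron m B $$ (t, j))"
    using i j assms by (subst index_mult_mat_sum) auto
  also have "\<dots> = (\<Sum>p<dim_col A. A $$ (i mod dim_row A, p) *
      Ikron m B $$ (dim_col A * (i div dim_row A) + p, j))"
    using Ikron_sum_left[OF i] .
  also have "\<dots> = (\<Sum>p<dim_row B. if i div dim_row A = j div dim_col B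
      then A $$ (i mod dim_row A, p) * B $$ (p, j mod dim_col B) else 0)"
    using assms i j by (intro sum.cong) (auto simp: Ikron_index ip[unfolded assms])
  also have "\<dots> = Ikron m (A * B) $$ (i, j)"
    using i j assms by (subst Ikron_index) (auto simp: index_mult_mat_sum simp del: index_mult_mat(1))
  finally show "(Ikron m A * Ikron m B) $$ (i, j) = Ikron m (A * B) $$ (i, j)" .
qed (use assms in auto)

lemma Ikron_one [simp]: "Ikron m (1\<^sub>m n) = 1\<^sub>m (n * m)"
proof (rule eq_matI)
  fix i j assume "i < dim_row (1\<^sub>m (n * m))" "j < dim_col (1\<^sub>m (n * m))"
  then have "i < n * m" "j < n * m" by auto
  moreover have "i div n = j div n \<and> i mod n = j mod n \<longleftrightarrow> i = j"
    by (metis mult_div_mod_eq)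
  ultimately show "Ikron m (1\<^sub>m n) $$ (i, j) = 1\<^sub>m (n * m) $$ (i, j)"
    by (auto simp: Ikron_index)
qed auto

lemma Ikron_zero [simp]: "Ikron m (0\<^sub>m r c) = 0\<^sub>m (r * m) (c * m)"
  by (rule eq_matI) (auto simp: Ikron_index)

lemma Ikron_add:
  "dim_row A = dim_row B \<Longrightarrow> dim_col A = dim_col B \<Longrightarrow> Ikron m (A + B) = Ikron m A + Ikron m B"
  by (rule eq_matI) (auto simp: Ikron_index)

lemma Ikron_minus:
  fixes A :: "'a::ring_1 mat"
  shows "dim_row A = dim_row B \<Longrightarrow> dim_col A = dim_col B \<Longrightarrow>
    Ikron m (A - B) = Ikron m A - Ikron m B"
  by (rule eq_matI) (auto simp: Ikron_index)

lemma Ikron_smult: "Ikron m (a \<cdot>\<^sub>m A) = a \<cdot>\<^sub>m Ikron m A"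
  by (rule eq_matI) (auto simp: Ikron_index)

text \<open>Grouping indices in two stages or all at once gives the same blocks. This identifies the
  displacement from \<open>ampl n Y\<close> at block size m with the one from \<open>Y\<close> at
  block size n * m.\<close>

lemma Ikron_Ikron: "Ikron m (Ikron n D) = Ikron (n * m) D"
proof (rule eq_matI)
  fix i j assume "i < dim_row (Ikron (n * m) D)" "j < dim_col (Ikron (n * m) D)"
  then have i: "i < dim_row D * (n * m)" and j: "j < dim_col D * (n * m)" by auto
  let ?r = "dim_row D" and ?c = "dim_col D"
  have *: "i div (?r * n) = j div (?c * n) \<and> i mod (?r * n) div ?r = j mod (?c * n) div ?c
      \<longleftrightarrow> i div ?r = j div ?c"
  proof -
    have "0 < ?r" "0 < ?c"
      using i j by (auto intro: gr0I)
    then have "i mod (?r * n) div ?r = i div ?r mod n" "j mod (?c * n) div ?c = j div ?c mod n"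
      by (auto simp: mod_mult2_eq)
    then show ?thesis by (metis div_mult2_eq mult_div_mod_eq)
  qed
  show "Ikron m (Ikron n D) $$ (i, j) = Ikron (n * m) D $$ (i, j)"
  proof -
    have pos: "0 < ?r" "0 < ?c"
      using i j by (auto intro: gr0I)
    have i': "i < dim_row (Ikron n D) * m" "i mod (?r * n) < ?r * n"
      and j': "j < dim_col (Ikron n D) * m" "j mod (?c * n) < ?c * n"
      using i j by (auto simp: mult.assoc intro!: mod_lt_mult[of _ _ m])
    have "i mod (?r * n) mod ?r = i mod ?r" "j mod (?c * n) mod ?c = j mod ?c"
      by (auto simp: mod_mult2_eq)
    with * show ?thesis
      by (auto simp: Ikron_index[OF i j] Ikron_index[OF i'(1) j'(1)] Ikron_index[OF i'(2) j'(2)])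
  qed
qed (auto simp: mult.assoc)

lemma Ikron_1 [simp]: "Ikron (Suc 0) D = D"
  by (rule eq_matI) (auto simp: Ikron_index)

text \<open>The sum over k of (Z_k)F_k, the shape shared by the pencil, with F = A, and by the input
  term, with F = B.\<close>

definition block_lin ::
  "nat \<Rightarrow> nat \<Rightarrow> nat \<Rightarrow> nat \<Rightarrow> ('d::finite \<Rightarrow> 'a::semiring_1 mat \<Rightarrow> 'a mat) \<Rightarrow> ('d \<Rightarrow> 'a mat) \<Rightarrow> 'a mat"
  where "block_lin s r c m F Z =
    mat_sum (r * m) (c * m) (\<lambda>k. block_apply s r c m (F k) (Z k)) UNIV"

lemma dim_block_lin [simp]:
  "dim_row (block_lin s r c m F Z) = r * m" "dim_col (block_lin s r c m F Z) = c * m"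
  by (auto simp: block_lin_def mat_sum_def)

lemma block_lin_carrier [simp]: "block_lin s r c m F Z \<in> carrier_mat (r * m) (c * m)"
  by (intro carrier_matI) auto

lemma block_lin_index:
  "i < r * m \<Longrightarrow> j < c * m \<Longrightarrow> block_lin s r c m F Z $$ (i, j) =
     (\<Sum>k\<in>UNIV. F k (mat_block s (Z k) (i div r) (j div c)) $$ (i mod r, j mod c))"
  by (simp add: block_lin_def mat_sum_def block_apply_def)

lemma mat_block_carrier [simp]: "mat_block s X i j \<in> carrier_mat s s"
  by (simp add: mat_block_def)

lemma dim_mat_block [simp]: "dim_row (mat_block s X i j) = s" "dim_col (mat_block s X i j) = s"
  by (simp_all add: mat_block_def)

section \<open>Linear maps on square matrices and their closure properties\<close>

lemma linear_mat_map_carrier: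
  "linear_mat_map s r c T \<Longrightarrow> M \<in> carrier_mat s s \<Longrightarrow> T M \<in> carrier_mat r c"
  by (simp add: linear_mat_map_def)

lemma linear_mat_map_add:
  "linear_mat_map s r c T \<Longrightarrow> M \<in> carrier_mat s s \<Longrightarrow> N \<in> carrier_mat s s \<Longrightarrow> T (M + N) = T M + T N"
  by (simp add: linear_mat_map_def)

lemma linear_mat_map_smult:
  "linear_mat_map s r c T \<Longrightarrow> M \<in> carrier_mat s s \<Longrightarrow> T (a \<cdot>\<^sub>m M) = a \<cdot>\<^sub>m T M"
  by (simp add: linear_mat_map_def)

lemma linear_mat_map_zero:
  assumes "linear_mat_map s r c T"
  shows "T (0\<^sub>m s s) = 0\<^sub>m r c"
proof -
  have "T (0 \<cdot>\<^sub>m 0\<^sub>m s s) = 0 \<cdot>\<^sub>m T (0\<^sub>m s s)"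
    by (rule linear_mat_map_smult[OF assms]) simp
  moreover have "0 \<cdot>\<^sub>m 0\<^sub>m s s = (0\<^sub>m s s :: 'a mat)" by auto
  moreover have "0 \<cdot>\<^sub>m T (0\<^sub>m s s) = 0\<^sub>m r c"
    using linear_mat_map_carrier[OF assms, of "0\<^sub>m s s"] by (intro eq_matI) auto
  ultimately show ?thesis by simp
qed

lemma linear_mat_map_mult_left:
  assumes "linear_mat_map s r c T" "P \<in> carrier_mat r' r"
  shows "linear_mat_map s r' c (\<lambda>M. P * T M)"
  using assms mult_smult_distrib[OF assms(2)]
  unfolding linear_mat_map_def
  by (auto intro!: mult_add_distrib_mat[OF assms(2)])

lemma linear_mat_map_mult_right:
  assumes "linear_mat_map s r c T" "P \<in> carrier_mat c c'"
  shows "linear_mat_map s r c' (\<lambda>M. T M * P)"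
  using assms unfolding linear_mat_map_def
  by (auto intro!: add_mult_distrib_mat[of _ r c] mult_smult_assoc_mat[OF _ assms(2)])

lemma linear_mat_map_plus:
  assumes "linear_mat_map s r c T" "linear_mat_map s r c S"
  shows "linear_mat_map s r c (\<lambda>M. T M + S M)"
  unfolding linear_mat_map_def
proof (intro conjI ballI allI)
  fix M N :: "'a mat" and a assume M: "M \<in> carrier_mat s s" and N: "N \<in> carrier_mat s s"
  note c = linear_mat_map_carrier[OF assms(1) M] linear_mat_map_carrier[OF assms(2) M]
    linear_mat_map_carrier[OF assms(1) N] linear_mat_map_carrier[OF assms(2) N]
  show "T (M + N) + S (M + N) = T M + S M + (T N + S N)"
    unfolding linear_mat_map_add[OF assms(1) M N] linear_mat_map_add[OF assms(2) M N]
    using c by (intro eq_matI) auto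
qed (use assms in \<open>auto simp: linear_mat_map_def add_smult_distrib_left_mat\<close>)

lemma linear_mat_map_minus:
  assumes "linear_mat_map s r c T" "linear_mat_map s r c S"
  shows "linear_mat_map s r c (\<lambda>M. T M - S M)"
  unfolding linear_mat_map_def
proof (intro conjI ballI allI)
  fix M :: "'a mat" assume M: "M \<in> carrier_mat s s"
  note c = linear_mat_map_carrier[OF assms(1) M] linear_mat_map_carrier[OF assms(2) M]
  show "T M - S M \<in> carrier_mat r c" using c by auto
  show "T (a \<cdot>\<^sub>m M) - S (a \<cdot>\<^sub>m M) = a \<cdot>\<^sub>m (T M - S M)" for a
    unfolding linear_mat_map_smult[OF assms(1) M] linear_mat_map_smult[OF assms(2) M]
    using c by (intro eq_matI) (auto simp: algebra_simps)
  fix N :: "'a mat" assume N: "N \<in> carrier_mat s s"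
  note d = linear_mat_map_carrier[OF assms(1) N] linear_mat_map_carrier[OF assms(2) N]
  show "T (M + N) - S (M + N) = T M - S M + (T N - S N)"
    unfolding linear_mat_map_add[OF assms(1) M N] linear_mat_map_add[OF assms(2) M N]
    using c d by (intro eq_matI) auto
qed

lemma linear_mat_map_0: "linear_mat_map s r c (\<lambda>_. 0\<^sub>m r c)"
  by (auto simp: linear_mat_map_def)

lemma linear_mat_map_id: "linear_mat_map s s s (\<lambda>M. M)"
  by (auto simp: linear_mat_map_def)

definition linear_family :: "nat \<Rightarrow> nat \<Rightarrow> nat \<Rightarrow> ('d \<Rightarrow> 'a::field mat \<Rightarrow> 'a mat) \<Rightarrow> bool" where
  "linear_family s r c F \<longleftrightarrow> (\<forall>k. linear_mat_map s r c (F k))"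

lemma linear_family_carrier:
  "linear_family s r c F \<Longrightarrow> M \<in> carrier_mat s s \<Longrightarrow> F k M \<in> carrier_mat r c"
  unfolding linear_family_def using linear_mat_map_carrier by blast

lemma linear_family_dim:
  "linear_family s r c F \<Longrightarrow> M \<in> carrier_mat s s \<Longrightarrow> dim_row (F k M) = r"
  "linear_family s r c F \<Longrightarrow> M \<in> carrier_mat s s \<Longrightarrow> dim_col (F k M) = c"
  using linear_family_carrier by (metis carrier_matD)+

text \<open>Left multiplication by the constant P acts on each block separately. Together with its
  right-hand counterpart this turns every change of A or B by constant factors into multiplication
  by Kronecker products, so that later verifications only manipulate a few abstract
  matrices.\<close>

lemma Ikron_mult_block_lin:
  assumes F: "linear_family s (dim_col P) c F"
  shows "Ikron m P * block_lin s (dim_col P) c m F Z =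
    block_lin s (dim_row P) c m (\<lambda>k M. P * F k M) Z"
proof (rule eq_matI)
  let ?r = "dim_col P" and ?r' = "dim_row P"
  fix i j assume "i < dim_row (block_lin s (dim_row P) c m (\<lambda>k M. P * F k M) Z)"
    "j < dim_col (block_lin s (dim_row P) c m (\<lambda>k M. P * F k M) Z)"
  then have i: "i < ?r' * m" and j: "j < c * m" by auto
  let ?B = "\<lambda>k. F k (mat_block s (Z k) (i div ?r') (j div c))"
  have ip: "?r * (i div ?r') + p < ?r * m" if "p < ?r" for p
    using that i by simp
  have "(Ikron m P * block_lin s ?r c m F Z) $$ (i, j) =
    (\<Sum>t<?r * m. Ikron m P $$ (i, t) * block_lin s ?r c m F Z $$ (t, j))"
    using i j by (subst index_mult_mat_sum) auto
  also have "\<dots> = (\<Sum>p<?r. P $$ (i mod ?r', p) *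
      block_lin s ?r c m F Z $$ (?r * (i div ?r') + p, j))"
    by (rule Ikron_sum_left[OF i])
  also have "\<dots> = (\<Sum>p<?r. \<Sum>k\<in>UNIV. P $$ (i mod ?r', p) * ?B k $$ (p, j mod c))"
    using j by (intro sum.cong) (auto simp: block_lin_index ip sum_distrib_left)
  also have "\<dots> = (\<Sum>k\<in>UNIV. \<Sum>p<?r. P $$ (i mod ?r', p) * ?B k $$ (p, j mod c))"
    by (rule sum.swap)
  also have "\<dots> = block_lin s ?r' c m (\<lambda>k M. P * F k M) Z $$ (i, j)"
    using i j linear_family_dim[OF F]
    by (auto simp: block_lin_index index_mult_mat_sum simp del: index_mult_mat(1))
  finally show "(Ikron m P * block_lin s ?r c m F Z) $$ (i, j) =
    block_lin s ?r' c m (\<lambda>k M. P * F k M) Z $$ (i, j)" .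
qed auto

lemma block_lin_mult_Ikron:
  assumes F: "linear_family s r (dim_row P) F"
  shows "block_lin s r (dim_row P) m F Z * Ikron m P =
    block_lin s r (dim_col P) m (\<lambda>k M. F k M * P) Z"
proof (rule eq_matI)
  let ?c = "dim_row P" and ?c' = "dim_col P"
  fix i j assume "i < dim_row (block_lin s r ?c' m (\<lambda>k M. F k M * P) Z)"
    "j < dim_col (block_lin s r ?c' m (\<lambda>k M. F k M * P) Z)"
  then have i: "i < r * m" and j: "j < ?c' * m" by auto
  let ?B = "\<lambda>k. F k (mat_block s (Z k) (i div r) (j div ?c'))"
  have jp: "?c * (j div ?c') + p < ?c * m" if "p < ?c" for p
    using that j by simp
  have "(block_lin s r ?c m F Z * Ikron m P) $$ (i, j) =
    (\<Sum>t<?c * m. block_lin s r ?c m F Z $$ (i, t) * Ikron m P $$ (t, j))"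
    using i j by (subst index_mult_mat_sum) auto
  also have "\<dots> = (\<Sum>p<?c. block_lin s r ?c m F Z $$ (i, ?c * (j div ?c') + p) *
      P $$ (p, j mod ?c'))"
    by (rule Ikron_sum_right[OF j])
  also have "\<dots> = (\<Sum>p<?c. \<Sum>k\<in>UNIV. ?B k $$ (i mod r, p) * P $$ (p, j mod ?c'))"
    using i by (intro sum.cong) (auto simp: block_lin_index jp sum_distrib_right)
  also have "\<dots> = (\<Sum>k\<in>UNIV. \<Sum>p<?c. ?B k $$ (i mod r, p) * P $$ (p, j mod ?c'))"
    by (rule sum.swap)
  also have "\<dots> = block_lin s r ?c' m (\<lambda>k M. F k M * P) Z $$ (i, j)"
    using i j linear_family_dim[OF F]
    by (auto simp: block_lin_index index_mult_mat_sum simp del: index_mult_mat(1))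
  finally show "(block_lin s r ?c m F Z * Ikron m P) $$ (i, j) =
    block_lin s r ?c' m (\<lambda>k M. F k M * P) Z $$ (i, j)" .
qed auto

lemma block_lin_plus:
  assumes "linear_family s r c F" "linear_family s r c G"
  shows "block_lin s r c m (\<lambda>k M. F k M + G k M) Z = block_lin s r c m F Z + block_lin s r c m G Z"
  using linear_family_dim[OF assms(1)] linear_family_dim[OF assms(2)]
  by (intro eq_matI) (auto simp: block_lin_index sum.distrib)

lemma block_lin_minus:
  assumes "linear_family s r c F" "linear_family s r c G"
  shows "block_lin s r c m (\<lambda>k M. F k M - G k M) Z = block_lin s r c m F Z - block_lin s r c m G Z"
  using linear_family_dim[OF assms(1)] linear_family_dim[OF assms(2)]
  by (intro eq_matI) (auto simp: block_lin_index sum_subtractf)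

lemma mat_block_add:
  assumes "A \<in> carrier_mat (s * m) (s * m)" "B \<in> carrier_mat (s * m) (s * m)" "i < m" "j < m"
  shows "mat_block s (A + B) i j = mat_block s A i j + mat_block s B i j"
  using assms by (intro eq_matI) (auto simp: mat_block_def)

lemma mat_block_Ikron:
  assumes "D \<in> carrier_mat s s" "i < m" "j < m"
  shows "mat_block s (Ikron m D) i j = (if i = j then D else 0\<^sub>m s s)"
  using assms by (intro eq_matI) (auto simp: mat_block_def Ikron_index)

lemma block_lin_add_arg:
  assumes F: "linear_family s r c F"
    and "\<And>k. Z k \<in> carrier_mat (s * m) (s * m)" "\<And>k. W k \<in> carrier_mat (s * m) (s * m)"
  shows "block_lin s r c m F (\<lambda>k. Z k + W k) = block_lin s r c m F Z + block_lin s r c m F W"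
proof (rule eq_matI)
  fix i j assume "i < dim_row (block_lin s r c m F Z + block_lin s r c m F W)"
    "j < dim_col (block_lin s r c m F Z + block_lin s r c m F W)"
  then have i: "i < r * m" and j: "j < c * m" by auto
  have "F k (mat_block s (Z k + W k) (i div r) (j div c)) =
      F k (mat_block s (Z k) (i div r) (j div c)) + F k (mat_block s (W k) (i div r) (j div c))" for k
    using F i j by (subst mat_block_add[OF assms(2,3)])
      (auto simp: linear_family_def intro: linear_mat_map_add)
  then show "block_lin s r c m F (\<lambda>k. Z k + W k) $$ (i, j) =
      (block_lin s r c m F Z + block_lin s r c m F W) $$ (i, j)"
    using i j linear_family_dim[OF F] by (auto simp: block_lin_index sum.distrib)
qed auto

text \<open>Linearity sends the zero off-diagonal blocks to zero. A constant displacement thus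
  contributes a constant term, which is what permits moving the centre.\<close>

lemma block_lin_Ikron:
  assumes F: "linear_family s r c F" and Z: "\<And>k. Z k \<in> carrier_mat s s"
  shows "block_lin s r c m F (\<lambda>k. Ikron m (Z k)) = Ikron m (block_lin s r c 1 F Z)"
proof (rule eq_matI)
  fix i j assume "i < dim_row (Ikron m (block_lin s r c 1 F Z))"
    "j < dim_col (Ikron m (block_lin s r c 1 F Z))"
  then have i: "i < r * m" and j: "j < c * m" by auto
  have 0: "F k (0\<^sub>m s s) = 0\<^sub>m r c" for k
    using linear_mat_map_zero[of s r c "F k"] F by (simp add: linear_family_def)
  have 1: "mat_block s (Z k) 0 0 = Z k" for k
    using Z[of k] by (intro eq_matI) (auto simp: mat_block_def)
  show "block_lin s r c m F (\<lambda>k. Ikron m (Z k)) $$ (i, j) =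
      Ikron m (block_lin s r c 1 F Z) $$ (i, j)"
    using i j by (auto simp: block_lin_index mat_block_Ikron[OF Z] Ikron_index 0 1)
qed auto

lemma Ikron_uminus:
  fixes A :: "'a::ring_1 mat"
  shows "Ikron m (- A) = - Ikron m A"
  by (rule eq_matI) (auto simp: Ikron_index)

lemma linear_family_mult_left:
  "linear_family s r c F \<Longrightarrow> P \<in> carrier_mat r' r \<Longrightarrow> linear_family s r' c (\<lambda>k M. P * F k M)"
  unfolding linear_family_def by (blast intro: linear_mat_map_mult_left)

lemma linear_family_mult_right:
  "linear_family s r c F \<Longrightarrow> P \<in> carrier_mat c c' \<Longrightarrow> linear_family s r c' (\<lambda>k M. F k M * P)"
  unfolding linear_family_def by (blast intro: linear_mat_map_mult_right)

lemma linear_family_plus: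
  "linear_family s r c F \<Longrightarrow> linear_family s r c G \<Longrightarrow> linear_family s r c (\<lambda>k M. F k M + G k M)"
  unfolding linear_family_def by (blast intro: linear_mat_map_plus)

lemma linear_family_minus:
  "linear_family s r c F \<Longrightarrow> linear_family s r c G \<Longrightarrow> linear_family s r c (\<lambda>k M. F k M - G k M)"
  unfolding linear_family_def by (blast intro: linear_mat_map_minus)

lemma linear_family_0: "linear_family s r c (\<lambda>_ _. 0\<^sub>m r c)"
  by (simp add: linear_family_def linear_mat_map_0)

lemma block_lin_mult_left:
  assumes "linear_family s r c F" "P \<in> carrier_mat r' r"
  shows "block_lin s r' c m (\<lambda>k M. P * F k M) Z = Ikron m P * block_lin s r c m F Z"
  using Ikron_mult_block_lin[of s P c F m Z] assms by auto

lemma block_lin_mult_right: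
  assumes "linear_family s r c F" "P \<in> carrier_mat c c'"
  shows "block_lin s r c' m (\<lambda>k M. F k M * P) Z = block_lin s r c m F Z * Ikron m P"
  using block_lin_mult_Ikron[of s r P F m Z] assms by auto

lemma block_lin_0: "block_lin s r c m (\<lambda>_ _. 0\<^sub>m r c) Z = 0\<^sub>m (r * m) (c * m)"
  by (rule eq_matI) (auto simp: block_lin_index)

section \<open>Pointwise values of a realization\<close>

definition displ :: "nat \<Rightarrow> ('d \<Rightarrow> 'a::field mat) \<Rightarrow> ('d \<Rightarrow> 'a mat) \<Rightarrow> 'd \<Rightarrow> 'a mat" where
  "displ m Y X k = X k - Ikron m (Y k)"

lemma fm_pencil_block_lin:
  "fm_pencil s Y \<R> m X =
     1\<^sub>m (fm_L \<R> * m) - block_lin s (fm_L \<R>) (fm_L \<R>) m (fm_A \<R>) (displ m Y X)"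
  by (simp add: fm_pencil_def block_lin_def ampl_def displ_def[abs_def])

lemma dim_fm_pencil [simp]:
  "dim_row (fm_pencil s Y \<R> m X) = fm_L \<R> * m" "dim_col (fm_pencil s Y \<R> m X) = fm_L \<R> * m"
  by (simp_all add: fm_pencil_block_lin)

lemma fm_pencil_carrier: "fm_pencil s Y \<R> m X \<in> carrier_mat (fm_L \<R> * m) (fm_L \<R> * m)"
  by (intro carrier_matI) auto

abbreviation fm_input ::
  "nat \<Rightarrow> ('d::finite \<Rightarrow> 'a::field mat) \<Rightarrow> ('d, 'a) fm_realization \<Rightarrow> nat \<Rightarrow> ('d \<Rightarrow> 'a mat) \<Rightarrow> 'a mat"
  where "fm_input s Y \<R> m X \<equiv> block_lin s (fm_L \<R>) s m (fm_B \<R>) (displ m Y X)"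

definition fm_inv ::
  "nat \<Rightarrow> ('d::finite \<Rightarrow> 'a::field mat) \<Rightarrow> ('d, 'a) fm_realization \<Rightarrow> nat \<Rightarrow> ('d \<Rightarrow> 'a mat) \<Rightarrow>
   'a mat \<Rightarrow> bool"
  where "fm_inv s Y \<R> m X V \<longleftrightarrow> V \<in> carrier_mat (fm_L \<R> * m) (fm_L \<R> * m) \<and>
    fm_pencil s Y \<R> m X * V = 1\<^sub>m (fm_L \<R> * m) \<and> V * fm_pencil s Y \<R> m X = 1\<^sub>m (fm_L \<R> * m)"

definition fm_out ::
  "nat \<Rightarrow> ('d::finite \<Rightarrow> 'a::field mat) \<Rightarrow> ('d, 'a) fm_realization \<Rightarrow> nat \<Rightarrow> ('d \<Rightarrow> 'a mat) \<Rightarrow>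
   'a mat \<Rightarrow> 'a mat"
  where "fm_out s Y \<R> m X V =
    Ikron m (fm_D \<R>) + Ikron m (fm_C \<R>) * (V * fm_input s Y \<R> m X)"

text \<open>A relation with a witness V in place of \<open>det\<close> and
  \<open>mat_inverse\<close>: it records membership in the domain and the value at once, and is
  established by exhibiting a one-sided inverse of the pencil.\<close>

definition fm_val ::
  "nat \<Rightarrow> ('d::finite \<Rightarrow> 'a::field mat) \<Rightarrow> ('d, 'a) fm_realization \<Rightarrow> nat \<Rightarrow> ('d \<Rightarrow> 'a mat) \<Rightarrow>
   'a mat \<Rightarrow> bool"
  where "fm_val s Y \<R> m X M \<longleftrightarrow> (\<exists>V. fm_inv s Y \<R> m X V \<and> M = fm_out s Y \<R> m X V)"

lemma fm_valI_left:
  assumes "V \<in> carrier_mat (fm_L \<R> * m) (fm_L \<R> * m)"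
    "V * fm_pencil s Y \<R> m X = 1\<^sub>m (fm_L \<R> * m)" "fm_out s Y \<R> m X V = M"
  shows "fm_val s Y \<R> m X M"
  using assms mat_mult_left_right_inverse[OF assms(1) fm_pencil_carrier assms(2)]
  by (auto simp: fm_val_def fm_inv_def)

lemma fm_valI_right:
  assumes "V \<in> carrier_mat (fm_L \<R> * m) (fm_L \<R> * m)"
    "fm_pencil s Y \<R> m X * V = 1\<^sub>m (fm_L \<R> * m)" "fm_out s Y \<R> m X V = M"
  shows "fm_val s Y \<R> m X M"
  using assms mat_mult_left_right_inverse[OF fm_pencil_carrier assms(1) assms(2)]
  by (auto simp: fm_val_def fm_inv_def)

lemma is_fm_realization_iff:
  "is_fm_realization s \<R> \<longleftrightarrow> fm_D \<R> \<in> carrier_mat s s \<and> fm_C \<R> \<in> carrier_mat s (fm_L \<R>) \<and>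
     linear_family s (fm_L \<R>) (fm_L \<R>) (fm_A \<R>) \<and> linear_family s (fm_L \<R>) s (fm_B \<R>)"
  by (simp add: is_fm_realization_def linear_family_def)

lemma fm_inv_mat_inverse:
  "fm_inv s Y \<R> m X V \<Longrightarrow> mat_inverse (fm_pencil s Y \<R> m X) = Some V"
  unfolding fm_inv_def by (auto intro: mat_inverse_eqI[OF fm_pencil_carrier])

lemma fm_val_iff_det:
  assumes "is_fm_realization s \<R>"
  shows "fm_val s Y \<R> m X M \<longleftrightarrow> det (fm_pencil s Y \<R> m X) \<noteq> 0 \<and> M = fm_eval s Y \<R> m X"
proof -
  let ?P = "fm_pencil s Y \<R> m X" and ?n = "fm_L \<R> * m"
  have eval: "fm_eval s Y \<R> m X = fm_out s Y \<R> m X V" if V: "fm_inv s Y \<R> m X V" for V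
  proof -
    have "dim_row V = ?n" "dim_col V = ?n" "dim_col (fm_C \<R>) = fm_L \<R>"
      using V assms by (auto simp: fm_inv_def is_fm_realization_iff)
    then show ?thesis
      using fm_inv_mat_inverse[OF V] assms
      by (simp add: fm_eval_def fm_out_def block_lin_def[symmetric] assoc_mult_mat_dim
          is_fm_realization_iff ampl_def displ_def[abs_def])
  qed
  have "det ?P \<noteq> 0 \<longleftrightarrow> (\<exists>V. fm_inv s Y \<R> m X V)"
  proof
    assume "det ?P \<noteq> 0"
    from det_non_zero_imp_unit[OF fm_pencil_carrier this, of "()"]
    show "\<exists>V. fm_inv s Y \<R> m X V"
      unfolding Units_def fm_inv_def by (auto simp: ring_mat_simps)
  next
    assume "\<exists>V. fm_inv s Y \<R> m X V"
    then obtain V where V: "V \<in> carrier_mat ?n ?n" "?P * V = 1\<^sub>m ?n" by (auto simp: fm_inv_def)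
    then have "det ?P * det V = 1"
      using det_mult[OF fm_pencil_carrier V(1), of s Y X] by simp
    then show "det ?P \<noteq> 0" by auto
  qed
  then show ?thesis using eval by (metis fm_val_def)
qed

text \<open>Inclusion of domains and equality of values merge into one implication, because
  \<open>fm_val\<close> asserts both. All later work on realizations goes through it.\<close>

lemma fm_realizes_iff:
  "fm_realizes s Y \<R> R \<longleftrightarrow> is_fm_realization s \<R> \<and>
    (\<forall>m\<ge>1. \<forall>X M. (\<forall>k. X k \<in> carrier_mat (s * m) (s * m)) \<longrightarrow> nc_eval (s * m) X R = Some M \<longrightarrow>
      fm_val s Y \<R> m X M)"
proof (cases "is_fm_realization s \<R>")
  case True
  show ?thesis
    unfolding fm_realizes_def fm_val_iff_det[OF True] nc_dom_def fm_DOM_def using True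
    by (auto simp: subset_iff) (metis option.inject)
qed (simp add: fm_realizes_def)

section \<open>Moving the centre\<close>

text \<open>Relative to Y' the pencil reads I \<otimes> P0 - a, where P0 is the old pencil at Y',
  invertible by \<open>val\<close>. Multiplying by I \<otimes> Q0, with Q0 the inverse of P0,
  restores the constant term 1; this changes A and B but not the dimension. The input acquires a
  constant b0, which is absorbed by shifting the state.\<close>

lemma fm_recentre:
  fixes Y Y' :: "'d::finite \<Rightarrow> 'a::field mat"
  assumes fm: "is_fm_realization s \<R>"
    and Y: "\<And>k. Y k \<in> carrier_mat s s" and Y': "\<And>k. Y' k \<in> carrier_mat s s"
    and val: "fm_val s Y \<R> 1 Y' M0"
  shows "\<exists>\<R>'. is_fm_realization s \<R>' \<and> fm_L \<R>' = fm_L \<R> \<and>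
    (\<forall>m X M. (\<forall>k. X k \<in> carrier_mat (s * m) (s * m)) \<longrightarrow> fm_val s Y \<R> m X M \<longrightarrow> fm_val s Y' \<R>' m X M)"
proof -
  let ?L = "fm_L \<R>" and ?A = "fm_A \<R>" and ?B = "fm_B \<R>" and ?C = "fm_C \<R>" and ?D = "fm_D \<R>"
  have A: "linear_family s ?L ?L ?A" and B: "linear_family s ?L s ?B"
    and C: "?C \<in> carrier_mat s ?L" and D: "?D \<in> carrier_mat s s"
    using fm by (auto simp: is_fm_realization_iff)
  define \<Delta> where "\<Delta> k = Y' k - Y k" for k
  have \<Delta>: "\<Delta> k \<in> carrier_mat s s" for k using minus_carrier_mat[OF Y[of k], of "Y' k"] by (simp add: \<Delta>_def)
  define P0 where "P0 = fm_pencil s Y \<R> 1 Y'"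
  have P0_eq: "P0 = 1\<^sub>m ?L - block_lin s ?L ?L 1 ?A \<Delta>"
    by (simp add: P0_def fm_pencil_block_lin displ_def[abs_def] \<Delta>_def[abs_def])
  obtain Q0 where Q0: "Q0 \<in> carrier_mat ?L ?L" "P0 * Q0 = 1\<^sub>m ?L" "Q0 * P0 = 1\<^sub>m ?L"
    using val by (auto simp: fm_val_def fm_inv_def P0_def)
  have P0: "P0 \<in> carrier_mat ?L ?L" by (auto simp: P0_eq)
  define b0 where "b0 = block_lin s ?L s 1 ?B \<Delta>"
  have b0: "b0 \<in> carrier_mat ?L s" using block_lin_carrier[of s ?L s 1] by (simp add: b0_def)
  \<comment> \<open>The state of \<open>\<R>\<close> at Y'. Subtracting it makes the state vanish at
    the new centre and adds C \<beta> to D, which becomes the value at Y'.\<close>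
  define \<beta> where "\<beta> = Q0 * b0"
  have \<beta>: "\<beta> \<in> carrier_mat ?L s" using Q0 b0 by (auto simp: \<beta>_def)
  have P0\<beta>: "P0 * \<beta> = b0"
    using P0 Q0 b0 by (simp add: \<beta>_def assoc_mult_mat_dim[symmetric])
  define \<R>' where "\<R>' = \<lparr>fm_L = ?L, fm_D = ?D + ?C * \<beta>, fm_C = ?C,
     fm_A = (\<lambda>k M. Q0 * ?A k M), fm_B = (\<lambda>k M. Q0 * (?B k M + ?A k M * \<beta>))\<rparr>"
  have "is_fm_realization s \<R>'"
    using A B C D Q0 \<beta> by (auto simp: \<R>'_def is_fm_realization_iff
        intro!: linear_family_mult_left linear_family_mult_right linear_family_plus)
  moreover have "fm_val s Y' \<R>' m X M"
    if X: "\<forall>k. X k \<in> carrier_mat (s * m) (s * m)" and valX: "fm_val s Y \<R> m X M" for m X M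
  proof -
    obtain V where V: "fm_inv s Y \<R> m X V" and M: "M = fm_out s Y \<R> m X V"
      using valX by (auto simp: fm_val_def)
    define P where "P = fm_pencil s Y \<R> m X"
    have VP: "V \<in> carrier_mat (?L * m) (?L * m)" "V * P = 1\<^sub>m (?L * m)"
      using V by (auto simp: fm_inv_def P_def)
    let ?Z = "displ m Y' X"
    have Z: "?Z k \<in> carrier_mat (s * m) (s * m)" for k
      using minus_carrier_mat[OF Ikron_carrier[OF Y'[of k]], of "X k" m] by (simp add: displ_def)
    have Z': "displ m Y X = (\<lambda>k. ?Z k + Ikron m (\<Delta> k))"
    proof
      fix k show "displ m Y X k = ?Z k + Ikron m (\<Delta> k)"
        using X[rule_format, of k] Y[of k] Y'[of k] Ikron_minus[of "Y' k" "Y k" m]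
        by (intro eq_matI) (auto simp: displ_def \<Delta>_def)
    qed
    define a where "a = block_lin s ?L ?L m ?A ?Z"
    define b where "b = block_lin s ?L s m ?B ?Z"
    have a: "a \<in> carrier_mat (?L * m) (?L * m)" and b: "b \<in> carrier_mat (?L * m) (s * m)"
      by (auto simp: a_def b_def)
    have split: "block_lin s ?L c m F (displ m Y X) =
        block_lin s ?L c m F ?Z + Ikron m (block_lin s ?L c 1 F \<Delta>)" if "linear_family s ?L c F" for c F
      unfolding Z' using Z \<Delta> that
      by (subst block_lin_add_arg[OF that]) (auto simp: block_lin_Ikron)
    note dims = carrier_matD[OF P0] carrier_matD[OF Q0(1)] carrier_matD[OF \<beta>] carrier_matD[OF b0]
      carrier_matD[OF a] carrier_matD[OF b] carrier_matD[OF VP(1)] carrier_matD[OF C] carrier_matD[OF D]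
    have P_eq: "P = Ikron m P0 - a"
      unfolding P_def fm_pencil_block_lin split[OF A] P0_eq
      by (subst Ikron_minus) (auto simp: a_def intro!: eq_matI)
    have in_eq: "fm_input s Y \<R> m X = b + Ikron m b0"
      unfolding split[OF B] b_def b0_def ..
    \<comment> \<open>From I \<otimes> P0 = P + a and P0 \<beta> = b0. It trades the term a \<beta>
      of the new input for the constant input b0 and for P \<beta>, which V cancels to
      \<beta>.\<close>
    have a\<beta>: "a * Ikron m \<beta> = Ikron m b0 - P * Ikron m \<beta>"
    proof -
      have "P * Ikron m \<beta> = Ikron m b0 - a * Ikron m \<beta>"
        using dims by (simp add: P_eq minus_mult_distrib_mat_dim Ikron_mult P0\<beta>)
      \<comment> \<open>Here and below \<open>index_mult_mat(1)\<close> is withheld, so that entries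
        of products stay atoms and only additive identities remain after
        \<open>eq_matI\<close>.\<close>
      then show ?thesis using dims by (intro eq_matI) (auto simp del: index_mult_mat(1))
    qed
    have a': "block_lin s ?L ?L m (fm_A \<R>') ?Z = Ikron m Q0 * a"
      using block_lin_mult_left[OF A Q0(1)] by (simp add: \<R>'_def a_def)
    have b': "block_lin s ?L s m (fm_B \<R>') ?Z = Ikron m Q0 * (b + a * Ikron m \<beta>)"
    proof -
      have A\<beta>: "linear_family s ?L s (\<lambda>k M. ?A k M * \<beta>)" by (rule linear_family_mult_right[OF A \<beta>])
      show ?thesis
        using block_lin_mult_left[OF linear_family_plus[OF B A\<beta>] Q0(1), of m ?Z]
          block_lin_plus[OF B A\<beta>, of m ?Z] block_lin_mult_right[OF A \<beta>, of m ?Z]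
        by (simp add: \<R>'_def a_def b_def)
    qed
    have L': "fm_L \<R>' = ?L" by (simp add: \<R>'_def)
    have PQ: "Ikron m P0 * Ikron m Q0 = 1\<^sub>m (?L * m)"
      using dims Q0 by (simp add: Ikron_mult)
    show ?thesis
    proof (rule fm_valI_left)
      \<comment> \<open>The new pencil is (I \<otimes> Q0) P, so its inverse is V (I \<otimes>
        P0).\<close>
      show "V * Ikron m P0 \<in> carrier_mat (fm_L \<R>' * m) (fm_L \<R>' * m)"
        using dims by (auto simp: L')
      have "Ikron m P0 * (Ikron m Q0 * a) = a"
        using dims PQ by (simp add: assoc_mult_mat_dim[symmetric] left_one_mult_mat_dim)
      then have "Ikron m P0 * (1\<^sub>m (?L * m) - Ikron m Q0 * a) = P"
        using dims by (simp add: mult_minus_distrib_mat_dim right_one_mult_mat_dim P_eq)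
      then show "V * Ikron m P0 * fm_pencil s Y' \<R>' m X = 1\<^sub>m (fm_L \<R>' * m)"
        using dims VP by (simp add: fm_pencil_block_lin L' a' assoc_mult_mat_dim)
      have "(V * Ikron m P0) * (Ikron m Q0 * (b + a * Ikron m \<beta>)) =
          V * ((Ikron m P0 * Ikron m Q0) * (b + a * Ikron m \<beta>))"
        using dims by (simp add: assoc_mult_mat_dim)
      also have "\<dots> = V * (b + a * Ikron m \<beta>)"
        using dims unfolding PQ by (simp add: left_one_mult_mat_dim)
      also have "\<dots> = V * (b + Ikron m b0) - V * (P * Ikron m \<beta>)"
        using dims unfolding a\<beta> by (simp add: P_eq mult_add_distrib_mat_dim mult_minus_distrib_mat_dim)
          (intro eq_matI, auto simp del: index_mult_mat(1))
      also have "V * (P * Ikron m \<beta>) = Ikron m \<beta>"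
        using dims VP by (simp add: P_eq assoc_mult_mat_dim[symmetric] left_one_mult_mat_dim)
      finally have *: "(V * Ikron m P0) * (Ikron m Q0 * (b + a * Ikron m \<beta>)) =
         V * (b + Ikron m b0) - Ikron m \<beta>" .
      have "fm_out s Y' \<R>' m X (V * Ikron m P0) =
         Ikron m (?D + ?C * \<beta>) + Ikron m ?C * (V * (b + Ikron m b0) - Ikron m \<beta>)"
        unfolding fm_out_def L' b' * by (simp add: \<R>'_def)
      also have "\<dots> = Ikron m ?D + Ikron m ?C * (V * (b + Ikron m b0))"
        using dims by (simp add: Ikron_add Ikron_mult[symmetric] mult_minus_distrib_mat_dim)
          (intro eq_matI, auto simp del: index_mult_mat(1))
      also have "\<dots> = M"
        by (simp add: M fm_out_def in_eq)
      finally show "fm_out s Y' \<R>' m X (V * Ikron m P0) = M" .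
    qed
  qed
  ultimately show ?thesis by (auto simp: \<R>'_def)
qed

section \<open>Existence of realizations\<close>

text \<open>Inclusions J and projections K of a direct sum of state spaces. Beyond the dimensions
  only these five relations are used, so block matrices on the sum are multiplied by
  rewriting.\<close>

lemma direct_sum_embeddings:
  obtains J1 J2 K1 K2 :: "'a::comm_ring_1 mat"
  where "J1 \<in> carrier_mat (a + b) a" "J2 \<in> carrier_mat (a + b) b"
    "K1 \<in> carrier_mat a (a + b)" "K2 \<in> carrier_mat b (a + b)"
    "K1 * J1 = 1\<^sub>m a" "K1 * J2 = 0\<^sub>m a b" "K2 * J1 = 0\<^sub>m b a" "K2 * J2 = 1\<^sub>m b"
    "J1 * K1 + J2 * K2 = 1\<^sub>m (a + b)"
proof -
  define J1 :: "'a mat" where "J1 = mat (a + b) a (\<lambda>(i, j). if i = j then 1 else 0)"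
  define J2 :: "'a mat" where "J2 = mat (a + b) b (\<lambda>(i, j). if i = a + j then 1 else 0)"
  define K1 where "K1 = J1\<^sup>T"
  define K2 where "K2 = J2\<^sup>T"
  note defs = J1_def J2_def K1_def K2_def
  have ind: "(if P then 1 else 0) * x = (if P then x else 0)" for P and x :: 'a
    by simp
  have shift: "(\<Sum>t<b. if i = a + t then f t else 0) = (if a \<le> i \<and> i < a + b then f (i - a) else 0)"
    for i and f :: "nat \<Rightarrow> 'a"
  proof -
    have "(\<Sum>t<b. if i = a + t then f t else 0) = (\<Sum>t<b. if t = i - a then (if a \<le> i then f t else 0) else 0)"
      by (intro sum.cong) auto
    then show ?thesis by (auto simp: sum.delta)
  qed
  have "J1 * K1 + J2 * K2 = 1\<^sub>m (a + b)"
  proof (rule eq_matI)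
    fix i j assume ij: "i < dim_row (1\<^sub>m (a + b))" "j < dim_col (1\<^sub>m (a + b))"
    have "(J1 * K1) $$ (i, j) = (\<Sum>t<a. (if i = t then 1 else 0) * (if j = t then 1 else 0))"
      using ij by (subst index_mult_mat_sum) (simp_all add: defs)
    also have "\<dots> = (\<Sum>t<a. if i = t then (if j = t then 1 else 0) else 0)"
      by (intro sum.cong) auto
    also have "\<dots> = (if i = j \<and> i < a then 1 else 0)"
      by (simp add: sum.delta')
    finally have "(J1 * K1) $$ (i, j) = (if i = j \<and> i < a then 1 else 0)" .
    moreover have "(J2 * K2) $$ (i, j) = (\<Sum>t<b. if i = a + t then (if j = a + t then 1 else 0) else 0)"
      using ij by (subst index_mult_mat_sum) (auto simp: defs intro!: sum.cong)
    moreover have "dim_row J2 = a + b" "dim_col K2 = a + b"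
      by (auto simp: defs)
    ultimately show "(J1 * K1 + J2 * K2) $$ (i, j) = 1\<^sub>m (a + b) $$ (i, j)"
      using ij unfolding shift
      by (auto simp: sum.delta' simp del: index_mult_mat(1))
  qed (auto simp: defs)
  moreover have "K1 * J1 = 1\<^sub>m a"
  proof (rule eq_matI)
    fix i j assume "i < dim_row (1\<^sub>m a)" "j < dim_col (1\<^sub>m a)"
    then have ij: "i < a" "j < a" by auto
    have "(K1 * J1) $$ (i, j) = (\<Sum>t<a + b. (if t = i then 1 else 0) * (if t = j then 1 else 0))"
      using ij by (subst index_mult_mat_sum) (simp_all add: defs)
    then show "(K1 * J1) $$ (i, j) = 1\<^sub>m a $$ (i, j)"
      using ij by (simp add: ind sum.delta)
  qed (simp_all add: defs)
  moreover have "K2 * J2 = 1\<^sub>m b"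
  proof (rule eq_matI)
    fix i j assume "i < dim_row (1\<^sub>m b)" "j < dim_col (1\<^sub>m b)"
    then have ij: "i < b" "j < b" by auto
    have "(K2 * J2) $$ (i, j) = (\<Sum>t<a + b. (if t = a + i then 1 else 0) * (if t = a + j then 1 else 0))"
      using ij by (subst index_mult_mat_sum) (simp_all add: defs)
    then show "(K2 * J2) $$ (i, j) = 1\<^sub>m b $$ (i, j)"
      using ij by (simp add: ind sum.delta)
  qed (simp_all add: defs)
  moreover have "K1 * J2 = 0\<^sub>m a b"
  proof (rule eq_matI)
    fix i j assume "i < dim_row (0\<^sub>m a b)" "j < dim_col (0\<^sub>m a b)"
    then have ij: "i < a" "j < b" by auto
    have "(K1 * J2) $$ (i, j) = (\<Sum>t<a + b. (if t = i then 1 else 0) * (if t = a + j then 1 else 0))"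
      using ij by (subst index_mult_mat_sum) (simp_all add: defs)
    then show "(K1 * J2) $$ (i, j) = 0\<^sub>m a b $$ (i, j)"
      using ij by (simp add: ind sum.delta)
  qed (simp_all add: defs)
  moreover have "K2 * J1 = 0\<^sub>m b a"
  proof (rule eq_matI)
    fix i j assume "i < dim_row (0\<^sub>m b a)" "j < dim_col (0\<^sub>m b a)"
    then have ij: "i < b" "j < a" by auto
    have "(K2 * J1) $$ (i, j) = (\<Sum>t<a + b. (if t = a + i then 1 else 0) * (if t = j then 1 else 0))"
      using ij by (subst index_mult_mat_sum) (simp_all add: defs)
    then show "(K2 * J1) $$ (i, j) = 0\<^sub>m b a $$ (i, j)"
      using ij by (simp add: ind sum.delta)
  qed (simp_all add: defs)
  ultimately show ?thesis
    by (intro that[of J1 J2 K1 K2]) (auto simp: defs)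
qed

lemma mat_minus_eq_swap:
  fixes A :: "'a::ab_group_add mat"
  assumes "A - B = C" "dim_row A = dim_row B" "dim_col A = dim_col B"
  shows "B = A - C"
  unfolding assms(1)[symmetric] using assms(2,3) by (intro eq_matI) auto

text \<open>One cascade covers both the sum (\<open>G = 0\<close>) and the product (\<open>G\<close> the output matrix of the
  second factor).\<close>

lemma fm_cascade:
  fixes Y :: "'d::finite \<Rightarrow> 'a::field mat"
  assumes fm1: "is_fm_realization s \<R>1" and fm2: "is_fm_realization s \<R>2"
    and G: "G \<in> carrier_mat s (fm_L \<R>2)" and d1: "d1 \<in> carrier_mat s s" and d2: "d2 \<in> carrier_mat s s"
    and E: "E \<in> carrier_mat s s"
  shows "\<exists>\<R>. is_fm_realization s \<R> \<and> (\<forall>m X V1 V2. fm_inv s Y \<R>1 m X V1 \<longrightarrow> fm_inv s Y \<R>2 m X V2 \<longrightarrow>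
    fm_val s Y \<R> m X (Ikron m E + (Ikron m (fm_C \<R>1) * (V1 * (fm_input s Y \<R>1 m X * Ikron m d2)) +
      Ikron m (fm_C \<R>1) * (V1 * (fm_input s Y \<R>1 m X * (Ikron m G * (V2 * fm_input s Y \<R>2 m X)))) +
      Ikron m d1 * (Ikron m (fm_C \<R>2) * (V2 * fm_input s Y \<R>2 m X)))))"
proof -
  let ?L1 = "fm_L \<R>1" and ?A1 = "fm_A \<R>1" and ?B1 = "fm_B \<R>1" and ?C1 = "fm_C \<R>1"
  let ?L2 = "fm_L \<R>2" and ?A2 = "fm_A \<R>2" and ?B2 = "fm_B \<R>2" and ?C2 = "fm_C \<R>2"
  let ?L = "?L1 + ?L2"
  have A1: "linear_family s ?L1 ?L1 ?A1" and B1: "linear_family s ?L1 s ?B1"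
    and C1: "?C1 \<in> carrier_mat s ?L1"
    using fm1 by (auto simp: is_fm_realization_iff)
  have A2: "linear_family s ?L2 ?L2 ?A2" and B2: "linear_family s ?L2 s ?B2"
    and C2: "?C2 \<in> carrier_mat s ?L2"
    using fm2 by (auto simp: is_fm_realization_iff)
  obtain J1 J2 K1 K2 :: "'a mat" where J: "J1 \<in> carrier_mat ?L ?L1" "J2 \<in> carrier_mat ?L ?L2"
    "K1 \<in> carrier_mat ?L1 ?L" "K2 \<in> carrier_mat ?L2 ?L"
    and KJ: "K1 * J1 = 1\<^sub>m ?L1" "K1 * J2 = 0\<^sub>m ?L1 ?L2" "K2 * J1 = 0\<^sub>m ?L2 ?L1" "K2 * J2 = 1\<^sub>m ?L2"
    and JK: "J1 * K1 + J2 * K2 = 1\<^sub>m ?L"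
    by (rule direct_sum_embeddings)
  have GK2: "G * K2 \<in> carrier_mat s ?L" using G J by auto
  \<comment> \<open>In block form A = [[A1, B1 G], [0, A2]], B = [B1 d2; B2] and C = [C1, d1 C2]:
    the state of the second system, read through G, is fed into the first.\<close>
  define A where "A k M = J1 * (?A1 k M * K1) + (J1 * (?B1 k M * (G * K2)) + J2 * (?A2 k M * K2))" for k M
  define B where "B k M = J1 * (?B1 k M * d2) + J2 * ?B2 k M" for k M
  define C where "C = ?C1 * K1 + d1 * (?C2 * K2)"
  define \<R> where "\<R> = \<lparr>fm_L = ?L, fm_D = E, fm_C = C, fm_A = A, fm_B = B\<rparr>"
  note lins = linear_family_mult_left[OF linear_family_mult_right[OF A1 J(3)] J(1)]
    linear_family_mult_left[OF linear_family_mult_right[OF B1 GK2] J(1)]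
    linear_family_mult_left[OF linear_family_mult_right[OF A2 J(4)] J(2)]
    linear_family_mult_left[OF linear_family_mult_right[OF B1 d2] J(1)]
    linear_family_mult_left[OF B2 J(2)]
  have "is_fm_realization s \<R>"
    unfolding is_fm_realization_iff \<R>_def A_def[abs_def] B_def[abs_def] C_def
    using lins E C1 C2 J d1 by (auto intro!: linear_family_plus)
  moreover have "fm_val s Y \<R> m X (Ikron m E + (Ikron m ?C1 * (V1 * (fm_input s Y \<R>1 m X * Ikron m d2)) +
      Ikron m ?C1 * (V1 * (fm_input s Y \<R>1 m X * (Ikron m G * (V2 * fm_input s Y \<R>2 m X)))) +
      Ikron m d1 * (Ikron m ?C2 * (V2 * fm_input s Y \<R>2 m X))))"
    if V1: "fm_inv s Y \<R>1 m X V1" and V2: "fm_inv s Y \<R>2 m X V2" for m X V1 V2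
  proof -
    let ?Z = "displ m Y X"
    define a1 where "a1 = block_lin s ?L1 ?L1 m ?A1 ?Z"
    define a2 where "a2 = block_lin s ?L2 ?L2 m ?A2 ?Z"
    define b1 where "b1 = block_lin s ?L1 s m ?B1 ?Z"
    define b2 where "b2 = block_lin s ?L2 s m ?B2 ?Z"
    define j1 where "j1 = Ikron m J1"
    define j2 where "j2 = Ikron m J2"
    define k1 where "k1 = Ikron m K1"
    define k2 where "k2 = Ikron m K2"
    define g where "g = Ikron m G"
    define c1 where "c1 = Ikron m ?C1"
    define c2 where "c2 = Ikron m ?C2"
    define e1 where "e1 = Ikron m d1"
    define e2 where "e2 = Ikron m d2"
    note defs = a1_def a2_def b1_def b2_def j1_def j2_def k1_def k2_def g_def c1_def c2_def e1_def e2_def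
    have V1': "V1 \<in> carrier_mat (?L1 * m) (?L1 * m)" "V1 * (1\<^sub>m (?L1 * m) - a1) = 1\<^sub>m (?L1 * m)"
      and V2': "V2 \<in> carrier_mat (?L2 * m) (?L2 * m)" "V2 * (1\<^sub>m (?L2 * m) - a2) = 1\<^sub>m (?L2 * m)"
      using V1 V2 by (auto simp: fm_inv_def fm_pencil_block_lin a1_def a2_def)
    have dims: "dim_row a1 = ?L1 * m" "dim_col a1 = ?L1 * m" "dim_row a2 = ?L2 * m" "dim_col a2 = ?L2 * m"
      "dim_row b1 = ?L1 * m" "dim_col b1 = s * m" "dim_row b2 = ?L2 * m" "dim_col b2 = s * m"
      "dim_row j1 = ?L * m" "dim_col j1 = ?L1 * m" "dim_row j2 = ?L * m" "dim_col j2 = ?L2 * m"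
      "dim_row k1 = ?L1 * m" "dim_col k1 = ?L * m" "dim_row k2 = ?L2 * m" "dim_col k2 = ?L * m"
      "dim_row g = s * m" "dim_col g = ?L2 * m" "dim_row c1 = s * m" "dim_col c1 = ?L1 * m"
      "dim_row c2 = s * m" "dim_col c2 = ?L2 * m" "dim_row e1 = s * m" "dim_col e1 = s * m"
      "dim_row e2 = s * m" "dim_col e2 = s * m" "dim_row V1 = ?L1 * m" "dim_col V1 = ?L1 * m"
      "dim_row V2 = ?L2 * m" "dim_col V2 = ?L2 * m"
      using J G C1 C2 d1 d2 V1' V2' by (auto simp: defs)
    have kj0: "k1 * j1 = 1\<^sub>m (?L1 * m)" "k1 * j2 = 0\<^sub>m (?L1 * m) (?L2 * m)"
      "k2 * j1 = 0\<^sub>m (?L2 * m) (?L1 * m)" "k2 * j2 = 1\<^sub>m (?L2 * m)"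
      using J KJ by (auto simp: defs Ikron_mult)
    have kj: "k1 * (j1 * x) = x" "k2 * (j1 * x) = 0\<^sub>m (?L2 * m) (dim_col x)" if "dim_row x = ?L1 * m" for x
      using that dims kj0 by (simp_all add: assoc_mult_mat_dim[symmetric] left_one_mult_mat_dim
          left_zero_mult_mat_dim)
    have kj': "k1 * (j2 * x) = 0\<^sub>m (?L1 * m) (dim_col x)" "k2 * (j2 * x) = x" if "dim_row x = ?L2 * m" for x
      using that dims kj0 by (simp_all add: assoc_mult_mat_dim[symmetric] left_one_mult_mat_dim
          left_zero_mult_mat_dim)
    have jk: "j1 * k1 + j2 * k2 = 1\<^sub>m (?L * m)"
    proof -
      have "j1 * k1 + j2 * k2 = Ikron m (J1 * K1 + J2 * K2)"
        using J by (subst Ikron_add) (auto simp: defs Ikron_mult)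
      then show ?thesis by (simp add: JK)
    qed
    \<comment> \<open>V1 (1 - a1) = 1, oriented so that it removes a1 behind V1.\<close>
    have Va1: "V1 * (a1 * x) = V1 * x - x" if "dim_row x = ?L1 * m" for x
    proof -
      have "V1 * (1\<^sub>m (?L1 * m) - a1) * x = x" using that V1' by (simp add: left_one_mult_mat_dim)
      moreover have "V1 * (1\<^sub>m (?L1 * m) - a1) * x = V1 * x - V1 * (a1 * x)"
        using that dims by (simp add: mat_dim_simps)
      ultimately have "V1 * x - V1 * (a1 * x) = x" by simp
      then show ?thesis using that dims by (intro mat_minus_eq_swap) auto
    qed
    have Va2: "V2 * (a2 * x) = V2 * x - x" if "dim_row x = ?L2 * m" for x
    proof -
      have "V2 * (1\<^sub>m (?L2 * m) - a2) * x = x" using that V2' by (simp add: left_one_mult_mat_dim)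
      moreover have "V2 * (1\<^sub>m (?L2 * m) - a2) * x = V2 * x - V2 * (a2 * x)"
        using that dims by (simp add: mat_dim_simps)
      ultimately have "V2 * x - V2 * (a2 * x) = x" by simp
      then show ?thesis using that dims by (intro mat_minus_eq_swap) auto
    qed
    have a: "block_lin s ?L ?L m A ?Z = j1 * (a1 * k1) + (j1 * (b1 * (g * k2)) + j2 * (a2 * k2))"
      unfolding A_def[abs_def]
      using J G A1 A2 B1
      by (simp add: block_lin_plus[OF lins(1) linear_family_plus[OF lins(2,3)]] block_lin_plus[OF lins(2,3)]
        block_lin_mult_left[OF linear_family_mult_right[OF A1 J(3)] J(1)]
        block_lin_mult_left[OF linear_family_mult_right[OF B1 GK2] J(1)]
        block_lin_mult_left[OF linear_family_mult_right[OF A2 J(4)] J(2)]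
        block_lin_mult_right[OF A1 J(3)] block_lin_mult_right[OF B1 GK2] block_lin_mult_right[OF A2 J(4)]
        defs Ikron_mult)
    have b: "block_lin s ?L s m B ?Z = j1 * (b1 * e2) + j2 * b2"
      unfolding B_def[abs_def]
      by (simp add: block_lin_plus[OF lins(4,5)]
        block_lin_mult_left[OF linear_family_mult_right[OF B1 d2] J(1)]
        block_lin_mult_left[OF B2 J(2)] block_lin_mult_right[OF B1 d2] defs)
    have c: "Ikron m C = c1 * k1 + e1 * (c2 * k2)"
      using C1 C2 J d1 by (auto simp: C_def defs Ikron_add Ikron_mult)
    \<comment> \<open>Inverse of the block upper triangular pencil: diagonal blocks V1 and V2,
      corner V1 b1 g V2.\<close>
    define V where "V = j1 * (V1 * k1) + (j1 * (V1 * (b1 * (g * (V2 * k2)))) + j2 * (V2 * k2))"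
    have L: "fm_L \<R> = ?L" "fm_A \<R> = A" "fm_B \<R> = B" "fm_C \<R> = C" "fm_D \<R> = E" by (auto simp: \<R>_def)
    have dimL: "dim_row V = ?L * m" "dim_col V = ?L * m" using dims by (auto simp: V_def)
    show ?thesis
    proof (rule fm_valI_left)
      show "V \<in> carrier_mat (fm_L \<R> * m) (fm_L \<R> * m)" using dimL L by auto
      have "V * fm_pencil s Y \<R> m X = V - V * (j1 * (a1 * k1) + (j1 * (b1 * (g * k2)) + j2 * (a2 * k2)))"
        using dims dimL unfolding fm_pencil_block_lin L a
        by (simp add: mult_minus_distrib_mat_dim right_one_mult_mat_dim)
      also have "V * (j1 * (a1 * k1) + (j1 * (b1 * (g * k2)) + j2 * (a2 * k2))) = V - (j1 * k1 + j2 * k2)"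
        using dims unfolding V_def
        by (simp add: mat_dim_simps kj kj' Va1 Va2)
          (intro eq_matI, auto simp: algebra_simps simp del: index_mult_mat(1))
      also have "V - (V - (j1 * k1 + j2 * k2)) = 1\<^sub>m (?L * m)"
        using dimL unfolding jk by (intro eq_matI) auto
      finally show "V * fm_pencil s Y \<R> m X = 1\<^sub>m (fm_L \<R> * m)" by (simp add: L)
      show "fm_out s Y \<R> m X V = Ikron m E + (Ikron m ?C1 * (V1 * (fm_input s Y \<R>1 m X * Ikron m d2)) +
      Ikron m ?C1 * (V1 * (fm_input s Y \<R>1 m X * (Ikron m G * (V2 * fm_input s Y \<R>2 m X)))) +
      Ikron m d1 * (Ikron m ?C2 * (V2 * fm_input s Y \<R>2 m X)))"
        unfolding fm_out_def L b c defs[symmetric] V_def using dims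
        by (simp add: mat_dim_simps kj kj')
          (intro eq_matI, auto simp: algebra_simps simp del: index_mult_mat(1))
    qed
  qed
  ultimately show ?thesis by blast
qed

lemma fm_plus:
  fixes Y :: "'d::finite \<Rightarrow> 'a::field mat"
  assumes fm1: "is_fm_realization s \<R>1" and fm2: "is_fm_realization s \<R>2"
  shows "\<exists>\<R>. is_fm_realization s \<R> \<and> (\<forall>m X M N. fm_val s Y \<R>1 m X M \<longrightarrow> fm_val s Y \<R>2 m X N \<longrightarrow>
    fm_val s Y \<R> m X (M + N))"
proof -
  let ?L2 = "fm_L \<R>2"
  have D: "fm_D \<R>1 \<in> carrier_mat s s" "fm_D \<R>2 \<in> carrier_mat s s" 
    and C: "fm_C \<R>1 \<in> carrier_mat s (fm_L \<R>1)" "fm_C \<R>2 \<in> carrier_mat s ?L2"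
    using fm1 fm2 by (auto simp: is_fm_realization_iff)
  from fm_cascade[OF fm1 fm2, of "0\<^sub>m s ?L2" "1\<^sub>m s" "1\<^sub>m s" "fm_D \<R>1 + fm_D \<R>2" Y] D
  obtain \<R> where fm: "is_fm_realization s \<R>" and *: "\<And>m X V1 V2. fm_inv s Y \<R>1 m X V1 \<Longrightarrow> fm_inv s Y \<R>2 m X V2 \<Longrightarrow>
    fm_val s Y \<R> m X (Ikron m (fm_D \<R>1 + fm_D \<R>2) + (Ikron m (fm_C \<R>1) * (V1 * (fm_input s Y \<R>1 m X * Ikron m (1\<^sub>m s))) +
      Ikron m (fm_C \<R>1) * (V1 * (fm_input s Y \<R>1 m X * (Ikron m (0\<^sub>m s ?L2) * (V2 * fm_input s Y \<R>2 m X)))) +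
      Ikron m (1\<^sub>m s) * (Ikron m (fm_C \<R>2) * (V2 * fm_input s Y \<R>2 m X))))" by auto
  have "fm_val s Y \<R> m X (M + N)" if "fm_val s Y \<R>1 m X M" "fm_val s Y \<R>2 m X N" for m X M N
  proof -
    obtain V1 V2 where V: "fm_inv s Y \<R>1 m X V1" "fm_inv s Y \<R>2 m X V2"
      and M: "M = fm_out s Y \<R>1 m X V1" "N = fm_out s Y \<R>2 m X V2"
      using \<open>fm_val s Y \<R>1 m X M\<close> \<open>fm_val s Y \<R>2 m X N\<close> by (auto simp: fm_val_def)
    have dims: "dim_row V1 = fm_L \<R>1 * m" "dim_col V1 = fm_L \<R>1 * m" "dim_row V2 = ?L2 * m"
       "dim_col V2 = ?L2 * m" using V by (auto simp: fm_inv_def)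
    have "Ikron m (fm_D \<R>1 + fm_D \<R>2) + (Ikron m (fm_C \<R>1) * (V1 * (fm_input s Y \<R>1 m X * Ikron m (1\<^sub>m s))) +
      Ikron m (fm_C \<R>1) * (V1 * (fm_input s Y \<R>1 m X * (Ikron m (0\<^sub>m s ?L2) * (V2 * fm_input s Y \<R>2 m X)))) +
      Ikron m (1\<^sub>m s) * (Ikron m (fm_C \<R>2) * (V2 * fm_input s Y \<R>2 m X))) = M + N"
      using dims carrier_matD[OF D(1)] carrier_matD[OF D(2)] carrier_matD[OF C(1)] carrier_matD[OF C(2)]
      unfolding M fm_out_def
      by (simp add: Ikron_add mat_dim_simps) (intro eq_matI, auto simp del: index_mult_mat(1))
    with *[OF V] show ?thesis by simp
  qed
  with fm show ?thesis by blast
qed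

text \<open>Expanding (D1 + C1 V1 b1) (D2 + C2 V2 b2) produces exactly the four terms of the cascade
  with G = C2, d1 = D1, d2 = D2 and E = D1 D2.\<close>

lemma fm_times:
  fixes Y :: "'d::finite \<Rightarrow> 'a::field mat"
  assumes fm1: "is_fm_realization s \<R>1" and fm2: "is_fm_realization s \<R>2"
  shows "\<exists>\<R>. is_fm_realization s \<R> \<and> (\<forall>m X M N. fm_val s Y \<R>1 m X M \<longrightarrow> fm_val s Y \<R>2 m X N \<longrightarrow>
    fm_val s Y \<R> m X (M * N))"
proof -
  let ?L2 = "fm_L \<R>2" and ?D1 = "fm_D \<R>1" and ?D2 = "fm_D \<R>2"
  have D: "?D1 \<in> carrier_mat s s" "?D2 \<in> carrier_mat s s" 
    and C: "fm_C \<R>1 \<in> carrier_mat s (fm_L \<R>1)" "fm_C \<R>2 \<in> carrier_mat s ?L2"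
    using fm1 fm2 by (auto simp: is_fm_realization_iff)
  from fm_cascade[OF fm1 fm2, of "fm_C \<R>2" "?D1" "?D2" "?D1 * ?D2" Y] D C
  obtain \<R> where fm: "is_fm_realization s \<R>" and *: "\<And>m X V1 V2. fm_inv s Y \<R>1 m X V1 \<Longrightarrow> fm_inv s Y \<R>2 m X V2 \<Longrightarrow>
    fm_val s Y \<R> m X (Ikron m (?D1 * ?D2) + (Ikron m (fm_C \<R>1) * (V1 * (fm_input s Y \<R>1 m X * Ikron m ?D2)) +
      Ikron m (fm_C \<R>1) * (V1 * (fm_input s Y \<R>1 m X * (Ikron m (fm_C \<R>2) * (V2 * fm_input s Y \<R>2 m X)))) +
      Ikron m ?D1 * (Ikron m (fm_C \<R>2) * (V2 * fm_input s Y \<R>2 m X))))" by auto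
  have "fm_val s Y \<R> m X (M * N)" if "fm_val s Y \<R>1 m X M" "fm_val s Y \<R>2 m X N" for m X M N
  proof -
    obtain V1 V2 where V: "fm_inv s Y \<R>1 m X V1" "fm_inv s Y \<R>2 m X V2"
      and M: "M = fm_out s Y \<R>1 m X V1" "N = fm_out s Y \<R>2 m X V2"
      using \<open>fm_val s Y \<R>1 m X M\<close> \<open>fm_val s Y \<R>2 m X N\<close> by (auto simp: fm_val_def)
    have dims: "dim_row V1 = fm_L \<R>1 * m" "dim_col V1 = fm_L \<R>1 * m" "dim_row V2 = ?L2 * m"
       "dim_col V2 = ?L2 * m" using V by (auto simp: fm_inv_def)
    have "Ikron m (?D1 * ?D2) + (Ikron m (fm_C \<R>1) * (V1 * (fm_input s Y \<R>1 m X * Ikron m ?D2)) +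
      Ikron m (fm_C \<R>1) * (V1 * (fm_input s Y \<R>1 m X * (Ikron m (fm_C \<R>2) * (V2 * fm_input s Y \<R>2 m X)))) +
      Ikron m ?D1 * (Ikron m (fm_C \<R>2) * (V2 * fm_input s Y \<R>2 m X))) = M * N"
      using dims carrier_matD[OF D(1)] carrier_matD[OF D(2)] carrier_matD[OF C(1)] carrier_matD[OF C(2)]
      unfolding M fm_out_def
      by (simp add: Ikron_mult[symmetric] mat_dim_simps) (intro eq_matI, auto simp del: index_mult_mat(1))
    with *[OF V] show ?thesis by simp
  qed
  with fm show ?thesis by blast
qed

text \<open>A state space of dimension 0: the empty pencil is invertible everywhere and the output
  reduces to D.\<close>

lemma fm_const:
  fixes Y :: "'d::finite \<Rightarrow> 'a::field mat"
  assumes "E \<in> carrier_mat s s"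
  shows "\<exists>\<R>. is_fm_realization s \<R> \<and> (\<forall>m X. fm_val s Y \<R> m X (Ikron m E))"
proof -
  define \<R> :: "('d, 'a) fm_realization" where
    "\<R> = \<lparr>fm_L = 0, fm_D = E, fm_C = 0\<^sub>m s 0, fm_A = (\<lambda>_ _. 0\<^sub>m 0 0), fm_B = (\<lambda>_ _. 0\<^sub>m 0 s)\<rparr>"
  have "is_fm_realization s \<R>"
    using assms by (auto simp: \<R>_def is_fm_realization_iff linear_family_0)
  moreover have "fm_val s Y \<R> m X (Ikron m E)" for m X
  proof (rule fm_valI_left[of "1\<^sub>m 0"])
    show "fm_out s Y \<R> m X (1\<^sub>m 0) = Ikron m E"
      using assms by (intro eq_matI) (auto simp: fm_out_def \<R>_def scalar_prod_def)
  qed (auto simp: \<R>_def fm_pencil_block_lin)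
  ultimately show ?thesis by blast
qed

text \<open>X_l is its value at the centre plus its displacement. With A = 0 the pencil is 1, B
  selects the displacement of variable l and C = 1 returns it.\<close>

lemma fm_var:
  fixes Y :: "'d::finite \<Rightarrow> 'a::field mat"
  assumes Y: "\<And>k. Y k \<in> carrier_mat s s"
  shows "\<exists>\<R>. is_fm_realization s \<R> \<and>
    (\<forall>m X. (\<forall>k. X k \<in> carrier_mat (s * m) (s * m)) \<longrightarrow> fm_val s Y \<R> m X (X l))"
proof -
  define B :: "'d \<Rightarrow> 'a mat \<Rightarrow> 'a mat" where "B k M = (if k = l then M else 0\<^sub>m s s)" for k M
  define \<R> :: "('d, 'a) fm_realization" where
    "\<R> = \<lparr>fm_L = s, fm_D = Y l, fm_C = 1\<^sub>m s, fm_A = (\<lambda>_ _. 0\<^sub>m s s), fm_B = B\<rparr>"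
  have "linear_mat_map s s s (B k)" for k
    using linear_mat_map_id linear_mat_map_0 by (cases "k = l") (auto simp: B_def[abs_def])
  then have "is_fm_realization s \<R>"
    using Y by (auto simp: \<R>_def is_fm_realization_iff linear_family_0) (auto simp: linear_family_def)
  moreover have "fm_val s Y \<R> m X (X l)" if X: "\<forall>k. X k \<in> carrier_mat (s * m) (s * m)" for m X
  proof (rule fm_valI_left[of "1\<^sub>m (s * m)"])
    have "block_lin s s s m B (displ m Y X) = displ m Y X l"
    proof (rule eq_matI)
      fix i j assume "i < dim_row (displ m Y X l)" "j < dim_col (displ m Y X l)"
      then have i: "i < s * m" and j: "j < s * m" using Y[of l] by (auto simp: displ_def)
      have "block_lin s s s m B (displ m Y X) $$ (i, j) =
        (\<Sum>k\<in>UNIV. if k = l then displ m Y X k $$ (i, j) else 0)"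
      proof -
        have "i mod s < s" "j mod s < s" using i j by auto
        then show ?thesis
          unfolding block_lin_index[OF i j]
          by (intro sum.cong refl) (auto simp: B_def mat_block_def)
      qed
      then show "block_lin s s s m B (displ m Y X) $$ (i, j) = displ m Y X l $$ (i, j)"
        by (simp add: sum.delta)
    qed (use Y[of l] in \<open>auto simp: displ_def\<close>)
    then show "fm_out s Y \<R> m X (1\<^sub>m (s * m)) = X l"
      using X[rule_format, of l] Y[of l]
      by (intro eq_matI) (auto simp: fm_out_def \<R>_def left_one_mult_mat_dim displ_def simp del: index_mult_mat(1))
    show "1\<^sub>m (s * m) * fm_pencil s Y \<R> m X = 1\<^sub>m (fm_L \<R> * m)"
      by (auto simp: \<R>_def fm_pencil_block_lin block_lin_0 left_one_mult_mat_dim)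
  qed (auto simp: \<R>_def)
  ultimately show ?thesis by blast
qed

text \<open>Solving a system with invertible D for its input closes a feedback loop: with I the
  inverse of D, the data become A - B I C, B I and - I C. The pencil changes by the product b (I C),
  so its inverse comes from the Woodbury identity, whose inner inverse is N, the inverse of M = D +
  C V b.\<close>

lemma fm_inverse:
  fixes Y :: "'d::finite \<Rightarrow> 'a::field mat"
  assumes fm: "is_fm_realization s \<R>"
    and I: "I \<in> carrier_mat s s" "fm_D \<R> * I = 1\<^sub>m s" "I * fm_D \<R> = 1\<^sub>m s"
  shows "\<exists>\<R>'. is_fm_realization s \<R>' \<and> (\<forall>m X M N. fm_val s Y \<R> m X M \<longrightarrow>
    N \<in> carrier_mat (s * m) (s * m) \<longrightarrow> M * N = 1\<^sub>m (s * m) \<longrightarrow> N * M = 1\<^sub>m (s * m) \<longrightarrow> fm_val s Y \<R>' m X N)"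
proof -
  let ?L = "fm_L \<R>" and ?A = "fm_A \<R>" and ?B = "fm_B \<R>" and ?C = "fm_C \<R>" and ?D = "fm_D \<R>"
  have A: "linear_family s ?L ?L ?A" and B: "linear_family s ?L s ?B"
    and C: "?C \<in> carrier_mat s ?L" and D: "?D \<in> carrier_mat s s"
    using fm by (auto simp: is_fm_realization_iff)
  have IC: "I * ?C \<in> carrier_mat s ?L" using I C by auto
  define \<R>' where "\<R>' = \<lparr>fm_L = ?L, fm_D = I, fm_C = - (I * ?C),
    fm_A = (\<lambda>k M. ?A k M - ?B k M * (I * ?C)), fm_B = (\<lambda>k M. ?B k M * I)\<rparr>"
  have BIC: "linear_family s ?L ?L (\<lambda>k M. ?B k M * (I * ?C))"
    by (rule linear_family_mult_right[OF B IC])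
  have "is_fm_realization s \<R>'"
    using linear_family_minus[OF A BIC] linear_family_mult_right[OF B I(1)] I IC
    by (auto simp: is_fm_realization_iff \<R>'_def)
  moreover have "fm_val s Y \<R>' m X N" if valM: "fm_val s Y \<R> m X M"
    and N: "N \<in> carrier_mat (s * m) (s * m)" "M * N = 1\<^sub>m (s * m)" "N * M = 1\<^sub>m (s * m)" for m X M N
  proof -
    obtain V where V: "fm_inv s Y \<R> m X V" and M: "M = fm_out s Y \<R> m X V"
      using valM by (auto simp: fm_val_def)
    define a where "a = block_lin s ?L ?L m ?A (displ m Y X)"
    define b where "b = block_lin s ?L s m ?B (displ m Y X)"
    define c where "c = Ikron m ?C"
    define i where "i = Ikron m I"
    define e where "e = Ikron m ?D"
    define P where "P = fm_pencil s Y \<R> m X"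
    have P: "P = 1\<^sub>m (?L * m) - a" by (simp add: P_def fm_pencil_block_lin a_def)
    have dims: "dim_row a = ?L * m" "dim_col a = ?L * m" "dim_row b = ?L * m" "dim_col b = s * m"
      "dim_row c = s * m" "dim_col c = ?L * m" "dim_row i = s * m" "dim_col i = s * m"
      "dim_row e = s * m" "dim_col e = s * m" "dim_row P = ?L * m" "dim_col P = ?L * m"
      "dim_row V = ?L * m" "dim_col V = ?L * m" "dim_row N = s * m" "dim_col N = s * m"
      using I C D N V by (auto simp: a_def b_def c_def i_def e_def P_def fm_inv_def)
    have ie: "i * e = 1\<^sub>m (s * m)" "e * i = 1\<^sub>m (s * m)"
      using I D by (auto simp: i_def e_def Ikron_mult)
    have M_eq: "M = e + c * (V * b)" by (simp add: M fm_out_def e_def c_def b_def)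
    have VP: "P * V = 1\<^sub>m (?L * m)" using V by (simp add: fm_inv_def P_def)
    have cVb: "c * (V * (b * x)) = M * x - e * x" if "dim_row x = s * m" for x
      using that dims unfolding M_eq
      by (simp add: mat_dim_simps) (intro eq_matI, auto simp del: index_mult_mat(1))
    have PVx: "P * (V * x) = x" if "dim_row x = ?L * m" for x
      using that dims VP by (simp add: assoc_mult_mat_dim[symmetric] left_one_mult_mat_dim)
    have MNx: "M * (N * x) = x" if "dim_row x = s * m" for x
      using that dims N M_eq by (simp add: assoc_mult_mat_dim[symmetric] left_one_mult_mat_dim)
    have NM: "N * (e + c * (V * b)) = 1\<^sub>m (s * m)" using N M_eq by simp
    have iex: "i * (e * x) = x" if "dim_row x = s * m" for x
      using that dims ie by (simp add: assoc_mult_mat_dim[symmetric] left_one_mult_mat_dim)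
    have a': "block_lin s ?L ?L m (fm_A \<R>') (displ m Y X) = a - b * (i * c)"
      using I C block_lin_minus[OF A BIC, of m "displ m Y X"] block_lin_mult_right[OF B IC, of m "displ m Y X"]
      by (simp add: \<R>'_def a_def b_def i_def c_def Ikron_mult)
    have b': "block_lin s ?L s m (fm_B \<R>') (displ m Y X) = b * i"
      using block_lin_mult_right[OF B I(1)] by (simp add: \<R>'_def b_def i_def)
    have c': "Ikron m (- (I * ?C)) = - (i * c)"
      using I C by (simp add: Ikron_uminus i_def c_def Ikron_mult)
    have L: "fm_L \<R>' = ?L" "fm_D \<R>' = I" "fm_C \<R>' = - (I * ?C)" by (auto simp: \<R>'_def)
    \<comment> \<open>Woodbury: the inverse of P + b i c is V - V b N c V, where N inverts e + c V b
      and e inverts i.\<close>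
    define W where "W = V - V * (b * (N * (c * V)))"
    have P': "fm_pencil s Y \<R>' m X = P + b * (i * c)"
      unfolding fm_pencil_block_lin L a' P using dims by (intro eq_matI) (auto simp del: index_mult_mat(1))
    show ?thesis
    proof (rule fm_valI_right)
      show "W \<in> carrier_mat (fm_L \<R>' * m) (fm_L \<R>' * m)"
        unfolding L W_def using dims by (intro carrier_matI) auto
      have "(P + b * (i * c)) * W = P * V + b * (i * (c * V)) - b * (N * (c * V))
          - b * (i * (c * (V * (b * (N * (c * V))))))"
        unfolding W_def using dims
        by (simp add: mat_dim_simps PVx) (intro eq_matI, auto simp: algebra_simps simp del: index_mult_mat(1))
      also have "c * (V * (b * (N * (c * V)))) = c * V - e * (N * (c * V))"
        using dims by (simp add: cVb MNx)
      also have "i * \<dots> = i * (c * V) - N * (c * V)"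
        using dims by (simp add: mult_minus_distrib_mat_dim iex)
      also have "P * V + b * (i * (c * V)) - b * (N * (c * V)) - b * \<dots> = 1\<^sub>m (?L * m)"
        using dims unfolding VP
        by (simp add: mult_minus_distrib_mat_dim) (intro eq_matI, auto simp del: index_mult_mat(1))
      finally show "fm_pencil s Y \<R>' m X * W = 1\<^sub>m (fm_L \<R>' * m)"
        by (simp add: P' L)
      have "c * (W * (b * i)) = c * (V * (b * i)) - c * (V * (b * (N * (c * (V * (b * i))))))"
        unfolding W_def using dims by (simp add: mat_dim_simps)
      also have "c * (V * (b * (N * (c * (V * (b * i)))))) = c * (V * (b * i)) - e * (N * (c * (V * (b * i))))"
        using dims by (simp add: cVb[of "N * (c * (V * (b * i)))"] MNx)
      also have "c * (V * (b * i)) - (c * (V * (b * i)) - e * (N * (c * (V * (b * i))))) = e * (N * (c * (V * (b * i))))"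
        using dims by (intro eq_matI) (auto simp del: index_mult_mat(1))
      also have "c * (V * (b * i)) = M * i - 1\<^sub>m (s * m)"
        using cVb[of i] dims ie by simp
      also have "N * (M * i - 1\<^sub>m (s * m)) = i - N"
      proof -
        have "dim_row M = s * m" "dim_col M = s * m" using dims by (auto simp: M_eq)
        moreover have "N * (M * i) = i"
          using dims N calculation by (simp add: assoc_mult_mat_dim[symmetric] left_one_mult_mat_dim)
        ultimately show ?thesis
          using dims by (simp add: mult_minus_distrib_mat_dim right_one_mult_mat_dim)
      qed
      \<comment> \<open>Hence the output is i - i e (i - N) = N.\<close>
      finally have *: "c * (W * (b * i)) = e * (i - N)" .
      have "dim_row W = ?L * m" "dim_col W = ?L * m" using dims by (auto simp: W_def)
      then have "fm_out s Y \<R>' m X W = i - i * (c * (W * (b * i)))"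
        unfolding fm_out_def L b' c' i_def[symmetric] using dims
        by (simp add: assoc_mult_mat_dim) (intro eq_matI, auto simp del: index_mult_mat(1))
      also have "\<dots> = N"
        unfolding * using dims by (simp add: iex) (intro eq_matI, auto)
      finally show "fm_out s Y \<R>' m X W = N" .
    qed
  qed
  ultimately show ?thesis by blast
qed

section \<open>Realizations of polynomials and of rational expressions\<close>

lemma word_eval_Nil [simp]: "word_eval n X [] = 1\<^sub>m n"
  by (simp add: word_eval_def)

lemma word_eval_Cons [simp]: "word_eval n X (k # w) = X k * word_eval n X w"
  by (simp add: word_eval_def)

lemma word_eval_carrier:
  assumes "\<And>k. X k \<in> carrier_mat n n"
  shows "word_eval n X w \<in> carrier_mat n n"
  by (induction w) (use mult_carrier_mat[OF assms] in auto)

lemma mat_sum_empty: "mat_sum r c F {} = 0\<^sub>m r c"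
  by (rule eq_matI) (auto simp: mat_sum_def)

lemma mat_sum_insert:
  assumes "finite I" "x \<notin> I" "F x \<in> carrier_mat r c"
  shows "mat_sum r c F (insert x I) = F x + mat_sum r c F I"
  using assms by (intro eq_matI) (auto simp: mat_sum_def)

lemma nc_eval_carrier:
  assumes X: "\<And>k. X k \<in> carrier_mat n n"
  shows "nc_eval n X R = Some M \<Longrightarrow> M \<in> carrier_mat n n"
proof (induction R arbitrary: M)
  case (Inverse R)
  then obtain N where "N \<in> carrier_mat n n" "mat_inverse N = Some M"
    by (auto simp: bind_eq_Some_conv)
  then show ?case using mat_inverse(2)[of N n M] by simp
next
  case (Times R S)
  then obtain M1 M2 where "nc_eval n X R = Some M1" "nc_eval n X S = Some M2" "M = M1 * M2"
    by (auto simp: bind_eq_Some_conv)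
  with Times.IH show ?case using mult_carrier_mat by blast
qed (auto simp: poly_eval_def mat_sum_def bind_eq_Some_conv)

text \<open>Words are products of variables, coefficients are scalar constants, and the support is
  summed by finite induction; no condition on the point arises.\<close>

lemma poly_realization_exists:
  fixes Y :: "'d::finite \<Rightarrow> 'a::field mat"
  assumes Y: "\<And>k. Y k \<in> carrier_mat s s"
  shows "\<exists>\<R>. is_fm_realization s \<R> \<and>
    (\<forall>m X. (\<forall>k. X k \<in> carrier_mat (s * m) (s * m)) \<longrightarrow> fm_val s Y \<R> m X (poly_eval (s * m) X p))"
proof -
  have word: "\<exists>\<R>. is_fm_realization s \<R> \<and>
    (\<forall>m X. (\<forall>k. X k \<in> carrier_mat (s * m) (s * m)) \<longrightarrow> fm_val s Y \<R> m X (word_eval (s * m) X w))" for w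
  proof (induction w)
    case Nil
    then show ?case using fm_const[of "1\<^sub>m s" s Y] by auto
  next
    case (Cons k w)
    then obtain \<R>2 where 2: "is_fm_realization s \<R>2"
      "\<And>m X. (\<forall>k. X k \<in> carrier_mat (s * m) (s * m)) \<Longrightarrow> fm_val s Y \<R>2 m X (word_eval (s * m) X w)"
      by blast
    obtain \<R>1 where 1: "is_fm_realization s \<R>1"
      "\<And>m X. (\<forall>k. X k \<in> carrier_mat (s * m) (s * m)) \<Longrightarrow> fm_val s Y \<R>1 m X (X k)"
      using fm_var[where Y = Y and l = k, OF Y] by auto
    from fm_times[OF 1(1) 2(1), of Y] 1(2) 2(2) show ?case by auto
  qed
  have "\<exists>\<R>. is_fm_realization s \<R> \<and>
    (\<forall>m X. (\<forall>k. X k \<in> carrier_mat (s * m) (s * m)) \<longrightarrow> fm_val s Y \<R> m X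
      (mat_sum (s * m) (s * m) (\<lambda>w. f w \<cdot>\<^sub>m word_eval (s * m) X w) W))" if "finite W" for W f
    using that
  proof (induction W rule: finite_induct)
    case empty
    then show ?case using fm_const[of "0\<^sub>m s s" s Y] by (auto simp: mat_sum_empty)
  next
    case (insert w W)
    then obtain \<R>2 where 2: "is_fm_realization s \<R>2"
      "\<And>m X. (\<forall>k. X k \<in> carrier_mat (s * m) (s * m)) \<Longrightarrow>
         fm_val s Y \<R>2 m X (mat_sum (s * m) (s * m) (\<lambda>w. f w \<cdot>\<^sub>m word_eval (s * m) X w) W)"
      by blast
    obtain \<R>1 where 1: "is_fm_realization s \<R>1"
      "\<And>m X. (\<forall>k. X k \<in> carrier_mat (s * m) (s * m)) \<Longrightarrow> fm_val s Y \<R>1 m X (word_eval (s * m) X w)"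
      using word[of w] by auto
    obtain \<R>0 where 0: "is_fm_realization s \<R>0" "\<And>m X. fm_val s Y \<R>0 m X (Ikron m (f w \<cdot>\<^sub>m 1\<^sub>m s))"
      using fm_const[of "f w \<cdot>\<^sub>m 1\<^sub>m s" s Y] by auto
    obtain \<R>3 where 3: "is_fm_realization s \<R>3"
      "\<And>m X M N. fm_val s Y \<R>0 m X M \<Longrightarrow> fm_val s Y \<R>1 m X N \<Longrightarrow> fm_val s Y \<R>3 m X (M * N)"
      using fm_times[OF 0(1) 1(1), of Y] by auto
    obtain \<R>4 where 4: "is_fm_realization s \<R>4"
      "\<And>m X M N. fm_val s Y \<R>3 m X M \<Longrightarrow> fm_val s Y \<R>2 m X N \<Longrightarrow> fm_val s Y \<R>4 m X (M + N)"
      using fm_plus[OF 3(1) 2(1), of Y] by auto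
    have "fm_val s Y \<R>4 m X (mat_sum (s * m) (s * m) (\<lambda>w. f w \<cdot>\<^sub>m word_eval (s * m) X w) (insert w W))"
      if X: "\<forall>k. X k \<in> carrier_mat (s * m) (s * m)" for m X
    proof -
      have w: "word_eval (s * m) X w \<in> carrier_mat (s * m) (s * m)" using X word_eval_carrier by blast
      have "Ikron m (f w \<cdot>\<^sub>m 1\<^sub>m s) * word_eval (s * m) X w = f w \<cdot>\<^sub>m word_eval (s * m) X w"
        using w by (simp add: Ikron_smult mult_smult_assoc_mat[of _ "s * m" "s * m"])
      moreover have "mat_sum (s * m) (s * m) (\<lambda>w. f w \<cdot>\<^sub>m word_eval (s * m) X w) (insert w W) =
        f w \<cdot>\<^sub>m word_eval (s * m) X w + mat_sum (s * m) (s * m) (\<lambda>w. f w \<cdot>\<^sub>m word_eval (s * m) X w) W"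
        using insert.hyps w by (intro mat_sum_insert) auto
      ultimately show ?thesis
        using 4(2)[OF 3(2)[OF 0(2) 1(2)[OF X]] 2(2)[OF X]] by simp
    qed
    with 4(1) show ?case by blast
  qed
  from this[of "Poly_Mapping.keys p" "Poly_Mapping.lookup p"] show ?thesis
    by (simp add: poly_eval_def)
qed

text \<open>The displacement from Y vanishes at Y, hence so does the input. That D is the value at
  the centre is what makes D invertible when an inverse has to be realized.\<close>

lemma fm_val_at_centre:
  fixes Y :: "'d::finite \<Rightarrow> 'a::field mat"
  assumes fm: "is_fm_realization s \<R>" and Y: "\<And>k. Y k \<in> carrier_mat s s"
    and "fm_val s Y \<R> 1 Y M"
  shows "M = fm_D \<R>"
proof -
  obtain V where V: "fm_inv s Y \<R> 1 Y V" and M: "M = fm_out s Y \<R> 1 Y V"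
    using assms by (auto simp: fm_val_def)
  have C: "fm_C \<R> \<in> carrier_mat s (fm_L \<R>)" and D: "fm_D \<R> \<in> carrier_mat s s"
    and B: "linear_family s (fm_L \<R>) s (fm_B \<R>)"
    using fm by (auto simp: is_fm_realization_iff)
  have "displ 1 Y Y = (\<lambda>k. 0\<^sub>m s s)"
    using Y by (auto simp: displ_def fun_eq_iff)
  then have "fm_input s Y \<R> 1 Y = block_lin s (fm_L \<R>) s 1 (fm_B \<R>) (\<lambda>k. Ikron 1 (0\<^sub>m s s))"
    by simp
  also have "\<dots> = 0\<^sub>m (fm_L \<R>) s"
  proof -
    have "fm_B \<R> k (0\<^sub>m s s) = 0\<^sub>m (fm_L \<R>) s" for k
      using linear_mat_map_zero[of s "fm_L \<R>" s "fm_B \<R> k"] B by (simp add: linear_family_def)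
    moreover have "mat_block s (0\<^sub>m s s) 0 0 = (0\<^sub>m s s :: 'a mat)" by (intro eq_matI) (auto simp: mat_block_def)
    ultimately show ?thesis by (intro eq_matI) (auto simp: block_lin_index)
  qed
  finally have "fm_input s Y \<R> 1 Y = 0\<^sub>m (fm_L \<R>) s" .
  moreover have "dim_row V = fm_L \<R>" "dim_col V = fm_L \<R>" using V by (auto simp: fm_inv_def)
  ultimately show ?thesis
    using C D by (simp add: M fm_out_def right_zero_mult_mat_dim)
qed

text \<open>Every subexpression is defined at Y, so the induction reaches all of them; at an
  inverse, the value at Y is invertible and equals D. Only points where the expression has a value
  are tracked, so the realization may have the larger domain.\<close>

lemma fm_realization_exists:
  fixes R :: "('d::finite, 'a::field) nc_rat"
  assumes Y: "Y \<in> nc_dom s R"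
  shows "\<exists>\<R>. fm_realizes s Y \<R> R"
proof -
  have Yc: "Y k \<in> carrier_mat s s" for k using Y by (auto simp: nc_dom_def)
  obtain M0 where "nc_eval s Y R = Some M0" using Y by (auto simp: nc_dom_def)
  then have "\<exists>\<R>. is_fm_realization s \<R> \<and> (\<forall>m X M. (\<forall>k. X k \<in> carrier_mat (s * m) (s * m)) \<longrightarrow>
    nc_eval (s * m) X R = Some M \<longrightarrow> fm_val s Y \<R> m X M)"
  proof (induction R arbitrary: M0)
    case (Poly p)
    then show ?case using poly_realization_exists[where Y = Y, OF Yc] by auto
  next
    case (Plus R S)
    then obtain M N where "nc_eval s Y R = Some M" "nc_eval s Y S = Some N" by (auto simp: bind_eq_Some_conv)
    with Plus.IH obtain \<R>1 \<R>2 where 1: "is_fm_realization s \<R>1" "\<forall>m X M. (\<forall>k. X k \<in> carrier_mat (s * m) (s * m)) \<longrightarrow>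
      nc_eval (s * m) X R = Some M \<longrightarrow> fm_val s Y \<R>1 m X M"
      and 2: "is_fm_realization s \<R>2" "\<forall>m X M. (\<forall>k. X k \<in> carrier_mat (s * m) (s * m)) \<longrightarrow>
      nc_eval (s * m) X S = Some M \<longrightarrow> fm_val s Y \<R>2 m X M" by metis
    from fm_plus[OF 1(1) 2(1), of Y] obtain \<R> where 3: "is_fm_realization s \<R>"
      "\<And>m X M N. fm_val s Y \<R>1 m X M \<Longrightarrow> fm_val s Y \<R>2 m X N \<Longrightarrow> fm_val s Y \<R> m X (M + N)" by auto
    show ?case
      by (rule exI[of _ \<R>]) (use 1(2) 2(2) 3 in \<open>auto simp: bind_eq_Some_conv\<close>)
  next
    case (Times R S)
    then obtain M N where "nc_eval s Y R = Some M" "nc_eval s Y S = Some N" by (auto simp: bind_eq_Some_conv)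
    with Times.IH obtain \<R>1 \<R>2 where 1: "is_fm_realization s \<R>1" "\<forall>m X M. (\<forall>k. X k \<in> carrier_mat (s * m) (s * m)) \<longrightarrow>
      nc_eval (s * m) X R = Some M \<longrightarrow> fm_val s Y \<R>1 m X M"
      and 2: "is_fm_realization s \<R>2" "\<forall>m X M. (\<forall>k. X k \<in> carrier_mat (s * m) (s * m)) \<longrightarrow>
      nc_eval (s * m) X S = Some M \<longrightarrow> fm_val s Y \<R>2 m X M" by metis
    from fm_times[OF 1(1) 2(1), of Y] obtain \<R> where 3: "is_fm_realization s \<R>"
      "\<And>m X M N. fm_val s Y \<R>1 m X M \<Longrightarrow> fm_val s Y \<R>2 m X N \<Longrightarrow> fm_val s Y \<R> m X (M * N)" by auto
    show ?case
      by (rule exI[of _ \<R>]) (use 1(2) 2(2) 3 in \<open>auto simp: bind_eq_Some_conv\<close>)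
  next
    case (Inverse R)
    then obtain M where M: "nc_eval s Y R = Some M" and "mat_inverse M = Some M0" by (auto simp: bind_eq_Some_conv)
    with mat_inverse(2)[OF nc_eval_carrier[where X = Y, OF Yc M]]
    have M0: "M * M0 = 1\<^sub>m s" "M0 * M = 1\<^sub>m s" "M0 \<in> carrier_mat s s" by auto
    from Inverse.IH[OF M] obtain \<R>1 where 1: "is_fm_realization s \<R>1"
      "\<And>m X M. (\<forall>k. X k \<in> carrier_mat (s * m) (s * m)) \<Longrightarrow> nc_eval (s * m) X R = Some M \<Longrightarrow> fm_val s Y \<R>1 m X M"
      by blast
    have "M = fm_D \<R>1"
      using 1(2)[of Y 1 M] M Yc by (intro fm_val_at_centre[where Y = Y, OF 1(1) Yc]) auto
    with fm_inverse[OF 1(1) M0(3), of Y] M0 obtain \<R> where 2: "is_fm_realization s \<R>"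
      "\<And>m X M N. fm_val s Y \<R>1 m X M \<Longrightarrow> N \<in> carrier_mat (s * m) (s * m) \<Longrightarrow>
        M * N = 1\<^sub>m (s * m) \<Longrightarrow> N * M = 1\<^sub>m (s * m) \<Longrightarrow> fm_val s Y \<R> m X N" by auto
    have "fm_val s Y \<R> m X N" if X: "\<forall>k. X k \<in> carrier_mat (s * m) (s * m)"
      and N: "nc_eval (s * m) X (Inverse R) = Some N" for m X N
    proof -
      obtain M where M: "nc_eval (s * m) X R = Some M" "mat_inverse M = Some N"
        using N by (auto simp: bind_eq_Some_conv)
      with mat_inverse(2)[OF nc_eval_carrier[where X = X, OF X[rule_format] M(1)] M(2)] 1(2)[OF X M(1)] 2(2)
      show ?thesis by blast
    qed
    with 2(1) show ?case by blast
  qed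
  then show ?thesis unfolding fm_realizes_iff by blast
qed

section \<open>Block upper triangular points\<close>

lemma word_eval_block_upper:
  fixes X1 X2 U :: "'d \<Rightarrow> 'a::field mat"
  assumes X1: "\<And>k. X1 k \<in> carrier_mat n1 n1" and X2: "\<And>k. X2 k \<in> carrier_mat n2 n2"
    and U: "\<And>k. U k \<in> carrier_mat n1 n2"
  shows "\<exists>V\<in>carrier_mat n1 n2. word_eval (n1 + n2) (\<lambda>k. four_block_mat (X1 k) (U k) (0\<^sub>m n2 n1) (X2 k)) w =
    four_block_mat (word_eval n1 X1 w) V (0\<^sub>m n2 n1) (word_eval n2 X2 w)"
proof (induction w)
  case Nil
  have "1\<^sub>m (n1 + n2) = four_block_mat (1\<^sub>m n1) (0\<^sub>m n1 n2) (0\<^sub>m n2 n1) (1\<^sub>m n2 :: 'a mat)"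
    by (rule eq_matI) auto
  then show ?case by (intro bexI[of _ "0\<^sub>m n1 n2"]) auto
next
  case (Cons k w)
  then obtain V where V: "V \<in> carrier_mat n1 n2"
    "word_eval (n1 + n2) (\<lambda>k. four_block_mat (X1 k) (U k) (0\<^sub>m n2 n1) (X2 k)) w =
    four_block_mat (word_eval n1 X1 w) V (0\<^sub>m n2 n1) (word_eval n2 X2 w)" by blast
  have w1: "word_eval n1 X1 w \<in> carrier_mat n1 n1" and w2: "word_eval n2 X2 w \<in> carrier_mat n2 n2"
    using word_eval_carrier[where X = X1, OF X1] word_eval_carrier[where X = X2, OF X2] by auto
  have "word_eval (n1 + n2) (\<lambda>k. four_block_mat (X1 k) (U k) (0\<^sub>m n2 n1) (X2 k)) (k # w) =
      four_block_mat (X1 k * word_eval n1 X1 w + U k * 0\<^sub>m n2 n1) (X1 k * V + U k * word_eval n2 X2 w)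
       (0\<^sub>m n2 n1 * word_eval n1 X1 w + X2 k * 0\<^sub>m n2 n1) (0\<^sub>m n2 n1 * V + X2 k * word_eval n2 X2 w)"
    unfolding word_eval_Cons V(2)
    by (rule mult_four_block_mat[OF X1 U zero_carrier_mat X2 w1 V(1) zero_carrier_mat w2])
  also have "X1 k * word_eval n1 X1 w + U k * 0\<^sub>m n2 n1 = word_eval n1 X1 (k # w)"
    using X1[of k] U[of k] w1 mult_carrier_mat[OF X1[of k] w1] by simp
  also have "0\<^sub>m n2 n1 * word_eval n1 X1 w + X2 k * 0\<^sub>m n2 n1 = 0\<^sub>m n2 n1"
    using X2[of k] w1 by simp
  also have "0\<^sub>m n2 n1 * V + X2 k * word_eval n2 X2 w = word_eval n2 X2 (k # w)"
    using X2[of k] V w2 mult_carrier_mat[OF X2[of k] w2] by simp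
  finally show ?case
    using mult_carrier_mat[OF X1[of k] V(1)] mult_carrier_mat[OF U[of k] w2]
    by (intro bexI[of _ "X1 k * V + U k * word_eval n2 X2 w"]) auto
qed

text \<open>The diagonal blocks are evaluated independently of U, and a block triangular matrix with
  invertible diagonal blocks is invertible. So U imposes no condition of its own; this is the
  freedom from which bidiagonal points are built.\<close>

lemma nc_eval_block_upper:
  fixes X1 X2 U :: "'d \<Rightarrow> 'a::field mat"
  assumes X1: "\<And>k. X1 k \<in> carrier_mat n1 n1" and X2: "\<And>k. X2 k \<in> carrier_mat n2 n2"
    and U: "\<And>k. U k \<in> carrier_mat n1 n2"
  shows "nc_eval n1 X1 R = Some M1 \<Longrightarrow> nc_eval n2 X2 R = Some M2 \<Longrightarrow>
    \<exists>V\<in>carrier_mat n1 n2. nc_eval (n1 + n2) (\<lambda>k. four_block_mat (X1 k) (U k) (0\<^sub>m n2 n1) (X2 k)) R =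
      Some (four_block_mat M1 V (0\<^sub>m n2 n1) M2)"
proof (induction R arbitrary: M1 M2)
  let ?X = "\<lambda>k. four_block_mat (X1 k) (U k) (0\<^sub>m n2 n1) (X2 k)"
  note c1 = nc_eval_carrier[where X = X1, OF X1] and c2 = nc_eval_carrier[where X = X2, OF X2]
  {
    case (Poly p)
    obtain V where V: "\<And>w. V w \<in> carrier_mat n1 n2"
      "\<And>w. word_eval (n1 + n2) ?X w =
        four_block_mat (word_eval n1 X1 w) (V w) (0\<^sub>m n2 n1) (word_eval n2 X2 w)"
      using word_eval_block_upper[where ?X1.0 = X1 and ?X2.0 = X2 and U = U, OF X1 X2 U] by metis
    have w1: "word_eval n1 X1 w \<in> carrier_mat n1 n1" and w2: "word_eval n2 X2 w \<in> carrier_mat n2 n2" for w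
      using word_eval_carrier[where X = X1, OF X1] word_eval_carrier[where X = X2, OF X2] by auto
    have "poly_eval (n1 + n2) ?X p = four_block_mat (poly_eval n1 X1 p)
        (mat_sum n1 n2 (\<lambda>w. Poly_Mapping.lookup p w \<cdot>\<^sub>m V w) (Poly_Mapping.keys p)) (0\<^sub>m n2 n1) (poly_eval n2 X2 p)"
      using carrier_matD[OF V(1)] carrier_matD[OF w1] carrier_matD[OF w2]
      by (intro eq_matI) (auto simp: poly_eval_def mat_sum_def V(2))
    then show ?case using Poly
      by (intro bexI[of _ "mat_sum n1 n2 (\<lambda>w. Poly_Mapping.lookup p w \<cdot>\<^sub>m V w) (Poly_Mapping.keys p)"])
        (auto simp: mat_sum_def)
  next
    case (Plus R S)
    then obtain A1 B1 A2 B2 where 1: "nc_eval n1 X1 R = Some A1" "nc_eval n1 X1 S = Some B1" "M1 = A1 + B1"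
      and 2: "nc_eval n2 X2 R = Some A2" "nc_eval n2 X2 S = Some B2" "M2 = A2 + B2"
      by (auto simp: bind_eq_Some_conv)
    from Plus.IH(1)[OF 1(1) 2(1)] Plus.IH(2)[OF 1(2) 2(2)] obtain V W
      where VW: "V \<in> carrier_mat n1 n2" "W \<in> carrier_mat n1 n2"
        "nc_eval (n1 + n2) ?X R = Some (four_block_mat A1 V (0\<^sub>m n2 n1) A2)"
        "nc_eval (n1 + n2) ?X S = Some (four_block_mat B1 W (0\<^sub>m n2 n1) B2)" by blast
    have "four_block_mat A1 V (0\<^sub>m n2 n1) A2 + four_block_mat B1 W (0\<^sub>m n2 n1) B2 =
        four_block_mat M1 (V + W) (0\<^sub>m n2 n1) M2"
      using c1[OF 1(1)] c1[OF 1(2)] c2[OF 2(1)] c2[OF 2(2)] VW(1,2) 1(3) 2(3)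
      by (intro eq_matI) auto
    then show ?case using VW by (intro bexI[of _ "V + W"]) auto
  next
    case (Times R S)
    then obtain A1 B1 A2 B2 where 1: "nc_eval n1 X1 R = Some A1" "nc_eval n1 X1 S = Some B1" "M1 = A1 * B1"
      and 2: "nc_eval n2 X2 R = Some A2" "nc_eval n2 X2 S = Some B2" "M2 = A2 * B2"
      by (auto simp: bind_eq_Some_conv)
    from Times.IH(1)[OF 1(1) 2(1)] Times.IH(2)[OF 1(2) 2(2)] obtain V W
      where VW: "V \<in> carrier_mat n1 n2" "W \<in> carrier_mat n1 n2"
        "nc_eval (n1 + n2) ?X R = Some (four_block_mat A1 V (0\<^sub>m n2 n1) A2)"
        "nc_eval (n1 + n2) ?X S = Some (four_block_mat B1 W (0\<^sub>m n2 n1) B2)" by blast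
    note A1 = c1[OF 1(1)] and B1 = c1[OF 1(2)] and A2 = c2[OF 2(1)] and B2 = c2[OF 2(2)]
    have "four_block_mat A1 V (0\<^sub>m n2 n1) A2 * four_block_mat B1 W (0\<^sub>m n2 n1) B2 =
        four_block_mat (A1 * B1 + V * 0\<^sub>m n2 n1) (A1 * W + V * B2)
          (0\<^sub>m n2 n1 * B1 + A2 * 0\<^sub>m n2 n1) (0\<^sub>m n2 n1 * W + A2 * B2)"
      by (rule mult_four_block_mat[OF A1 VW(1) zero_carrier_mat A2 B1 VW(2) zero_carrier_mat B2])
    also have "A1 * B1 + V * 0\<^sub>m n2 n1 = M1"
      using mult_carrier_mat[OF A1 B1] VW(1) by (simp add: 1(3))
    also have "0\<^sub>m n2 n1 * B1 + A2 * 0\<^sub>m n2 n1 = 0\<^sub>m n2 n1" using A2 B1 by simp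
    also have "0\<^sub>m n2 n1 * W + A2 * B2 = M2"
      using mult_carrier_mat[OF A2 B2] VW(2) by (simp add: 2(3))
    finally show ?case using VW mult_carrier_mat[OF A1 VW(2)] mult_carrier_mat[OF VW(1) B2]
      by (intro bexI[of _ "A1 * W + V * B2"]) auto
  next
    case (Inverse R)
    then obtain A1 A2 where 1: "nc_eval n1 X1 R = Some A1" "mat_inverse A1 = Some M1"
      and 2: "nc_eval n2 X2 R = Some A2" "mat_inverse A2 = Some M2"
      by (auto simp: bind_eq_Some_conv)
    note A1 = c1[OF 1(1)] and A2 = c2[OF 2(1)]
    have M1: "A1 * M1 = 1\<^sub>m n1" "M1 \<in> carrier_mat n1 n1" using mat_inverse(2)[OF A1 1(2)] by auto
    have M2: "A2 * M2 = 1\<^sub>m n2" "M2 \<in> carrier_mat n2 n2" using mat_inverse(2)[OF A2 2(2)] by auto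
    from Inverse.IH[OF 1(1) 2(1)] obtain V where V: "V \<in> carrier_mat n1 n2"
      "nc_eval (n1 + n2) ?X R = Some (four_block_mat A1 V (0\<^sub>m n2 n1) A2)" by blast
    \<comment> \<open>The corner of the inverse, from A1 W + V M2 = 0.\<close>
    define W where "W = - (M1 * (V * M2))"
    have W: "W \<in> carrier_mat n1 n2" using M1 V M2 by (auto simp: W_def)
    have "four_block_mat A1 V (0\<^sub>m n2 n1) A2 * four_block_mat M1 W (0\<^sub>m n2 n1) M2 =
        four_block_mat (A1 * M1 + V * 0\<^sub>m n2 n1) (A1 * W + V * M2)
          (0\<^sub>m n2 n1 * M1 + A2 * 0\<^sub>m n2 n1) (0\<^sub>m n2 n1 * W + A2 * M2)"
      by (rule mult_four_block_mat[OF A1 V(1) zero_carrier_mat A2 M1(2) W zero_carrier_mat M2(2)])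
    also have "A1 * M1 + V * 0\<^sub>m n2 n1 = 1\<^sub>m n1" using V M1 by simp
    also have "0\<^sub>m n2 n1 * M1 + A2 * 0\<^sub>m n2 n1 = 0\<^sub>m n2 n1" using A2 M1 by simp
    also have "0\<^sub>m n2 n1 * W + A2 * M2 = 1\<^sub>m n2" using W M2 by simp
    also have "A1 * W + V * M2 = 0\<^sub>m n1 n2"
    proof -
      have VM: "V * M2 \<in> carrier_mat n1 n2" using V M2 by auto
      have "A1 * W = - (A1 * (M1 * (V * M2)))" using A1 M1 V M2 by (simp add: W_def)
      also have "A1 * (M1 * (V * M2)) = V * M2"
        using assoc_mult_mat[OF A1 M1(2) VM] left_mult_one_mat[OF VM] unfolding M1(1) by simp
      finally show ?thesis using VM by (intro eq_matI) auto
    qed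
    also have "four_block_mat (1\<^sub>m n1) (0\<^sub>m n1 n2) (0\<^sub>m n2 n1) (1\<^sub>m n2) = (1\<^sub>m (n1 + n2) :: 'a mat)"
      by (rule eq_matI) auto
    finally have "mat_inverse (four_block_mat A1 V (0\<^sub>m n2 n1) A2) = Some (four_block_mat M1 W (0\<^sub>m n2 n1) M2)"
      using A1 A2 M1 M2 by (intro mat_inverse_eqI[of _ "n1 + n2"]) auto
    then show ?case using V W by (intro bexI[of _ W]) auto
  }
qed

lemma block_upper_in_nc_dom:
  fixes X1 X2 U :: "'d \<Rightarrow> 'a::field mat"
  assumes "X1 \<in> nc_dom n1 R" "X2 \<in> nc_dom n2 R" "\<And>k. U k \<in> carrier_mat n1 n2"
  shows "(\<lambda>k. four_block_mat (X1 k) (U k) (0\<^sub>m n2 n1) (X2 k)) \<in> nc_dom (n1 + n2) R"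
proof -
  have c: "\<And>k. X1 k \<in> carrier_mat n1 n1" "\<And>k. X2 k \<in> carrier_mat n2 n2"
    using assms by (auto simp: nc_dom_def)
  obtain M1 M2 where "nc_eval n1 X1 R = Some M1" "nc_eval n2 X2 R = Some M2"
    using assms by (auto simp: nc_dom_def)
  from nc_eval_block_upper[where ?X1.0 = X1 and ?X2.0 = X2 and U = U, OF c assms(3) this] c
  show ?thesis by (auto simp: nc_dom_def)
qed

text \<open>Peeling off the first diagonal block presents I \<otimes> Y as a block triangular point
  with corner 0.\<close>

lemma ampl_in_nc_dom:
  assumes Y: "Y \<in> nc_dom s R" and "n \<ge> 1"
  shows "ampl n Y \<in> nc_dom (s * n) R"
  using \<open>n \<ge> 1\<close>
proof (induction n rule: nat_induct_at_least)
  case base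
  then show ?case using Y by (simp add: ampl_def)
next
  case (Suc n)
  have Yc: "Y k \<in> carrier_mat s s" for k using Y by (auto simp: nc_dom_def)
  have "ampl (Suc n) Y = (\<lambda>k. four_block_mat (Y k) (0\<^sub>m s (s * n)) (0\<^sub>m (s * n) s) (ampl n Y k))"
  proof (intro ext eq_matI)
    fix k i j
    let ?M = "four_block_mat (Y k) (0\<^sub>m s (s * n)) (0\<^sub>m (s * n) s) (ampl n Y k)"
    assume "i < dim_row ?M" "j < dim_col ?M"
    then have i: "i < s * Suc n" and j: "j < s * Suc n" using Yc[of k] by (auto simp: ampl_def)
    have s: "s > 0" using i by (auto intro: gr0I)
    have "i div s = (if i < s then 0 else Suc ((i - s) div s))" "i mod s = (if i < s then i else (i - s) mod s)"
      "j div s = (if j < s then 0 else Suc ((j - s) div s))" "j mod s = (if j < s then j else (j - s) mod s)"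
      using s by (auto simp: le_div_geq le_mod_geq)
    then show "ampl (Suc n) Y k $$ (i, j) = ?M $$ (i, j)"
      using i j Yc[of k] by (auto simp: ampl_def Ikron_index)
  qed (use Yc in \<open>auto simp: ampl_def\<close>)
  moreover have "(\<lambda>k. four_block_mat (Y k) (0\<^sub>m s (s * n)) (0\<^sub>m (s * n) s) (ampl n Y k)) \<in> nc_dom (s + s * n) R"
    by (rule block_upper_in_nc_dom[OF Y Suc.IH]) auto
  ultimately show ?case by simp
qed

section \<open>Taylor coefficients\<close>

text \<open>The displacement from I \<otimes> Y has only superdiagonal blocks, the b-th of them in a
  single variable. It is therefore nilpotent, and a path from the first to the last block runs
  through the letters of \<open>ps\<close> once each, in order.\<close>

definition bidiag :: "nat \<Rightarrow> ('d \<Rightarrow> 'a::field mat) \<Rightarrow> ('d \<times> 'a mat) list \<Rightarrow> 'd \<Rightarrow> 'a mat" where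
  "bidiag s Y ps k = mat (s * Suc (length ps)) (s * Suc (length ps)) (\<lambda>(i, j).
     if i div s = j div s then Y k $$ (i mod s, j mod s)
     else if j div s = Suc (i div s) \<and> fst (ps ! (i div s)) = k
     then snd (ps ! (i div s)) $$ (i mod s, j mod s) else 0)"

lemma bidiag_in_nc_dom:
  assumes Y: "Y \<in> nc_dom s R" and s: "s \<ge> 1"
  shows "bidiag s Y ps \<in> nc_dom (s * Suc (length ps)) R"
proof (induction ps)
  have Yc: "Y k \<in> carrier_mat s s" for k using Y by (auto simp: nc_dom_def)
  {
    case Nil
    have "bidiag s Y [] = Y"
      by (intro ext eq_matI) (auto simp: bidiag_def carrier_matD[OF Yc])
    then show ?case using Y by simp
  next
    case (Cons p ps)
    let ?N = "s * Suc (length ps)"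
    \<comment> \<open>The corner couples the first block only to the next one, hence the condition j
      < s.\<close>
    define U where "U k = mat s ?N (\<lambda>(i, j). if j < s \<and> fst p = k then snd p $$ (i, j) else 0)" for k
    have "bidiag s Y (p # ps) = (\<lambda>k. four_block_mat (Y k) (U k) (0\<^sub>m ?N s) (bidiag s Y ps k))"
    proof (intro ext eq_matI)
      fix k i j
      let ?M = "four_block_mat (Y k) (U k) (0\<^sub>m ?N s) (bidiag s Y ps k)"
      assume "i < dim_row ?M" "j < dim_col ?M"
      then have i: "i < s + ?N" and j: "j < s + ?N" using Yc[of k] by (auto simp: bidiag_def)
      have d: "i div s = (if i < s then 0 else Suc ((i - s) div s))" "i mod s = (if i < s then i else (i - s) mod s)"
        "j div s = (if j < s then 0 else Suc ((j - s) div s))" "j mod s = (if j < s then j else (j - s) mod s)"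
        using s by (auto simp: le_div_geq le_mod_geq)
      have e: "(j - s) div s = 0 \<longleftrightarrow> j - s < s" using s by (auto simp: div_eq_0_iff)
      show "bidiag s Y (p # ps) k $$ (i, j) = ?M $$ (i, j)"
      proof (cases "i < s")
        case True
        then show ?thesis using i j Yc[of k] s e
          by (auto simp: bidiag_def U_def d)
      next
        case False
        then show ?thesis using i j Yc[of k] s
          by (auto simp: bidiag_def U_def d)
      qed
    qed (auto simp: bidiag_def carrier_matD[OF Yc])
    moreover have "(\<lambda>k. four_block_mat (Y k) (U k) (0\<^sub>m ?N s) (bidiag s Y ps k)) \<in> nc_dom (s + ?N) R"
      by (rule block_upper_in_nc_dom[OF Y Cons.IH]) (auto simp: U_def)
    ultimately show ?case by simp
  }
qed

text \<open>Folding from the left puts a letter appended to the word at the right end of the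
  product. This fits the prefixes \<open>take (Suc t) qs\<close> as well as states, to which the
  last letter is applied first.\<close>

definition word_prod :: "nat \<Rightarrow> ('d \<Rightarrow> 'a mat \<Rightarrow> 'a::field mat) \<Rightarrow> ('d \<times> 'a mat) list \<Rightarrow> 'a mat" where
  "word_prod L A ps = foldl (\<lambda>M p. M * A (fst p) (snd p)) (1\<^sub>m L) ps"

lemma word_prod_Nil [simp]: "word_prod L A [] = 1\<^sub>m L"
  by (simp add: word_prod_def)

lemma word_prod_snoc [simp]: "word_prod L A (ps @ [p]) = word_prod L A ps * A (fst p) (snd p)"
  by (simp add: word_prod_def)

lemma word_prod_carrier:
  assumes A: "linear_family s L L A" and "\<forall>p\<in>set ps. snd p \<in> carrier_mat s s"
  shows "word_prod L A ps \<in> carrier_mat L L"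
  using assms(2)
proof (induction ps rule: rev_induct)
  case (snoc p ps)
  then show ?case using mult_carrier_mat[OF _ linear_family_carrier[OF A]] by auto
qed auto

text \<open>The diagonal cancels against I \<otimes> Y and one superdiagonal remains; there is one
  block more than there are letters.\<close>

lemma mat_block_displ_bidiag:
  assumes Y: "\<And>k. Y k \<in> carrier_mat s s" and ps: "\<forall>p\<in>set ps. snd p \<in> carrier_mat s s"
    and m: "m = Suc (length ps)" and ij: "i < m" "j < m"
  shows "mat_block s (displ m Y (bidiag s Y ps) k) i j =
    (if j = Suc i \<and> fst (ps ! i) = k then snd (ps ! i) else 0\<^sub>m s s)"
proof -
  have c: "snd (ps ! i) \<in> carrier_mat s s" if "j = Suc i"
    using that ij m ps by auto
  have d: "displ m Y (bidiag s Y ps) k $$ (s * i + x, s * j + y) =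
    (if j = Suc i \<and> fst (ps ! i) = k then snd (ps ! i) $$ (x, y) else 0)" if xy: "x < s" "y < s" for x y
  proof -
    have lt: "s * i + x < s * m" "s * j + y < s * m" using xy ij by auto
    have "bidiag s Y ps k $$ (s * i + x, s * j + y) = (if i = j then Y k $$ (x, y)
       else if j = Suc i \<and> fst (ps ! i) = k then snd (ps ! i) $$ (x, y) else 0)"
      using lt xy unfolding bidiag_def m by (simp del: mult_Suc_right)
    moreover have "Ikron m (Y k) $$ (s * i + x, s * j + y) = (if i = j then Y k $$ (x, y) else 0)"
      using lt xy Y[of k] by (simp add: Ikron_index)
    ultimately show ?thesis
      using lt Y[of k] by (auto simp: displ_def)
  qed
  show ?thesis
    using d c by (intro eq_matI) (auto simp: mat_block_def)
qed

lemma block_lin_displ_bidiag: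
  assumes Y: "\<And>k. Y k \<in> carrier_mat s s" and ps: "\<forall>p\<in>set ps. snd p \<in> carrier_mat s s"
    and m: "m = Suc (length ps)" and F: "linear_family s r c F" and i: "i < r * m" and j: "j < c * m"
  shows "block_lin s r c m F (displ m Y (bidiag s Y ps)) $$ (i, j) =
    (if j div c = Suc (i div r) then F (fst (ps ! (i div r))) (snd (ps ! (i div r))) $$ (i mod r, j mod c) else 0)"
proof -
  have 0: "F k (0\<^sub>m s s) = 0\<^sub>m r c" for k
    using linear_mat_map_zero[of s r c "F k"] F by (simp add: linear_family_def)
  have r: "i mod r < r" "j mod c < c" using i j by auto
  have "block_lin s r c m F (displ m Y (bidiag s Y ps)) $$ (i, j) =
    (\<Sum>k\<in>UNIV. if fst (ps ! (i div r)) = k then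
       (if j div c = Suc (i div r) then F k (snd (ps ! (i div r))) $$ (i mod r, j mod c) else 0) else 0)"
    unfolding block_lin_index[OF i j]
    using i j r by (intro sum.cong refl) (auto simp: mat_block_displ_bidiag[OF Y ps m] 0)
  then show ?thesis by (simp add: sum.delta')
qed

text \<open>The row \<open>[1, A(Z1), A(Z1) A(Z2), \<dots>]\<close> is the first block row of the inverse pencil at a
  bidiagonal point: right multiplication by \<open>block_lin\<close> of \<open>A\<close> shifts it by one block.\<close>

lemma prefix_row_mult_block_lin:
  fixes A :: "'d::finite \<Rightarrow> 'a::field mat \<Rightarrow> 'a mat"
  assumes Y: "\<And>k. Y k \<in> carrier_mat s s" and ps: "\<forall>p\<in>set ps. snd p \<in> carrier_mat s s"
    and m: "m = Suc (length ps)" and A: "linear_family s L L A" and F: "linear_family s L c F"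
    and i: "i < L" and j: "j < c * m"
  shows "(mat L (L * m) (\<lambda>(i, j). word_prod L A (take (j div L) ps) $$ (i, j mod L)) *
      block_lin s L c m F (displ m Y (bidiag s Y ps))) $$ (i, j) =
    (if j div c = 0 then 0 else (word_prod L A (take (j div c - 1) ps) *
      F (fst (ps ! (j div c - 1))) (snd (ps ! (j div c - 1)))) $$ (i, j mod c))"
proof -
  let ?W = "\<lambda>b. word_prod L A (take b ps)" and ?F = "\<lambda>b. F (fst (ps ! b)) (snd (ps ! b))"
  have W: "?W b \<in> carrier_mat L L" for b
    using word_prod_carrier[OF A, of "take b ps"] ps by (auto dest: in_set_takeD)
  have jc: "j div c < m" "j mod c < c" using j by auto
  have "(mat L (L * m) (\<lambda>(i, j). ?W (j div L) $$ (i, j mod L)) *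
      block_lin s L c m F (displ m Y (bidiag s Y ps))) $$ (i, j) =
      (\<Sum>t<L * m. ?W (t div L) $$ (i, t mod L) *
        (if j div c = Suc (t div L) then ?F (t div L) $$ (t mod L, j mod c) else 0))"
    using i j by (subst index_mult_mat_sum) (auto simp: block_lin_displ_bidiag[OF Y ps m F] intro!: sum.cong)
  also have "\<dots> = (\<Sum>b<m. \<Sum>p<L. ?W b $$ (i, p) * (if j div c = Suc b then ?F b $$ (p, j mod c) else 0))"
    unfolding sum_lessThan_mult by (intro sum.cong) auto
  also have "\<dots> = (\<Sum>b<m. if j div c = Suc b then (\<Sum>p<L. ?W b $$ (i, p) * ?F b $$ (p, j mod c)) else 0)"
    by (intro sum.cong) auto
  also have "\<dots> = (if j div c = 0 then 0 else (\<Sum>p<L. ?W (j div c - 1) $$ (i, p) * ?F (j div c - 1) $$ (p, j mod c)))"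
  proof (cases "j div c")
    case (Suc b)
    then have "b < m" using jc by auto
    then show ?thesis unfolding Suc by (simp add: sum.delta')
  qed simp
  also have "\<dots> = (if j div c = 0 then 0 else (?W (j div c - 1) * ?F (j div c - 1)) $$ (i, j mod c))"
  proof (cases "j div c")
    case (Suc b)
    then have "snd (ps ! b) \<in> carrier_mat s s" using jc ps m by auto
    from linear_family_carrier[OF F this, of "fst (ps ! b)"] W[of b] i jc Suc
    show ?thesis by (simp add: index_mult_mat_sum del: index_mult_mat(1))
  qed simp
  finally show ?thesis .
qed

text \<open>The coefficient is the top right block of M. The inverse pencil is not expanded: its
  first block row is guessed as the row r of prefix products and confirmed by r (1 - a) = e, which
  forces r = e V.\<close>

lemma taylor_coefficient:
  fixes Y :: "'d::finite \<Rightarrow> 'a::field mat"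
  assumes fm: "is_fm_realization s \<R>" and Y: "\<And>k. Y k \<in> carrier_mat s s"
    and ps: "\<forall>p\<in>set ps. snd p \<in> carrier_mat s s" and Z: "Z \<in> carrier_mat s s"
    and qs: "qs = ps @ [(k, Z)]" and val: "fm_val s Y \<R> (Suc (length qs)) (bidiag s Y qs) M"
    and pq: "p < s" "q < s"
  shows "(fm_C \<R> * (word_prod (fm_L \<R>) (fm_A \<R>) ps * fm_B \<R> k Z)) $$ (p, q) =
    M $$ (p, s * length qs + q)"
proof -
  let ?L = "fm_L \<R>" and ?C = "fm_C \<R>" and ?D = "fm_D \<R>" and ?N = "length qs"
  define m where "m = Suc ?N"
  have A: "linear_family s ?L ?L (fm_A \<R>)" and B: "linear_family s ?L s (fm_B \<R>)"
    and C: "?C \<in> carrier_mat s ?L" and D: "?D \<in> carrier_mat s s"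
    using fm by (auto simp: is_fm_realization_iff)
  have qs': "\<forall>p\<in>set qs. snd p \<in> carrier_mat s s" using ps Z by (auto simp: qs)
  obtain V where V: "fm_inv s Y \<R> m (bidiag s Y qs) V" and M: "M = fm_out s Y \<R> m (bidiag s Y qs) V"
    using val by (auto simp: fm_val_def m_def)
  define a where "a = block_lin s ?L ?L m (fm_A \<R>) (displ m Y (bidiag s Y qs))"
  define b where "b = block_lin s ?L s m (fm_B \<R>) (displ m Y (bidiag s Y qs))"
  have dims: "dim_row a = ?L * m" "dim_col a = ?L * m" "dim_row b = ?L * m" "dim_col b = s * m"
    "dim_row V = ?L * m" "dim_col V = ?L * m"
    using V by (auto simp: a_def b_def fm_inv_def)
  have PV: "(1\<^sub>m (?L * m) - a) * V = 1\<^sub>m (?L * m)"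
    using V by (simp add: fm_inv_def fm_pencil_block_lin a_def)
  let ?W = "\<lambda>b. word_prod ?L (fm_A \<R>) (take b qs)"
  define r where "r = mat ?L (?L * m) (\<lambda>(i, j). ?W (j div ?L) $$ (i, j mod ?L))"
  define e where "e = mat ?L (?L * m) (\<lambda>(i, j). if i = j then 1 else (0::'a))"
  have dr: "dim_row r = ?L" "dim_col r = ?L * m" "dim_row e = ?L" "dim_col e = ?L * m"
    by (auto simp: r_def e_def)
  \<comment> \<open>The shift by one block turns r a into r without its first block.\<close>
  have "r - r * a = e"
  proof (rule eq_matI)
    fix i j assume "i < dim_row e" "j < dim_col e"
    then have i: "i < ?L" and j: "j < ?L * m" by (auto simp: e_def)
    have "(r * a) $$ (i, j) = (if j div ?L = 0 then 0 else ?W (j div ?L) $$ (i, j mod ?L))"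
    proof (cases "j div ?L")
      case (Suc t)
      then have "t < ?N" using j by (metis div_lt_mult m_def Suc_less_eq)
      then have "?W (Suc t) = ?W t * fm_A \<R> (fst (qs ! t)) (snd (qs ! t))"
        by (simp add: take_Suc_conv_app_nth)
      then show ?thesis
        unfolding r_def a_def prefix_row_mult_block_lin[where Y = Y, OF Y qs' m_def A A i j] Suc by simp
    next
      case 0
      then show ?thesis
        unfolding r_def a_def prefix_row_mult_block_lin[where Y = Y, OF Y qs' m_def A A i j] by simp
    qed
    moreover have "j div ?L = 0 \<longleftrightarrow> j < ?L" using i by (auto simp: div_eq_0_iff)
    ultimately show "(r - r * a) $$ (i, j) = e $$ (i, j)"
      using i j dims dr by (auto simp: r_def e_def simp del: index_mult_mat(1))
  qed (use dr dims in auto)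
  then have "r * (1\<^sub>m (?L * m) - a) = e"
    using dims dr by (simp add: mat_dim_simps)
  then have "r = e * V"
    using PV dims dr by (metis assoc_mult_mat_dim index_minus_mat(2,3) right_one_mult_mat_dim)
  then have eVb: "e * (V * b) = r * b"
    using dims dr by (simp add: assoc_mult_mat_dim)
  \<comment> \<open>Column q of the last block. There r b multiplies B for the last letter by the
    product over all earlier letters, which are exactly those of \<open>ps\<close>.\<close>
  define j where "j = s * ?N + q"
  have j: "j < s * m" "j div s = ?N" "j mod s = q" using pq by (auto simp: j_def m_def)
  have N: "?N > 0" "?N - 1 = length ps" by (auto simp: qs)
  have WB: "word_prod ?L (fm_A \<R>) ps * fm_B \<R> k Z \<in> carrier_mat ?L s"
    using mult_carrier_mat[OF word_prod_carrier[OF A ps] linear_family_carrier[OF B Z]] .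
  have Vb: "(V * b) $$ (t, j) = (word_prod ?L (fm_A \<R>) ps * fm_B \<R> k Z) $$ (t, q)" if t: "t < ?L" for t
  proof -
    have tm: "t < ?L * m" using t by (auto simp: m_def)
    have "(e * (V * b)) $$ (t, j) = (\<Sum>u<?L * m. (if t = u then 1 else 0) * (V * b) $$ (u, j))"
      using t j(1) dims by (subst index_mult_mat_sum) (simp_all add: e_def del: index_mult_mat(1))
    also have "\<dots> = (\<Sum>u<?L * m. if t = u then (V * b) $$ (u, j) else 0)"
      by (intro sum.cong) auto
    also have "\<dots> = (V * b) $$ (t, j)" using tm by (simp add: sum.delta' del: index_mult_mat(1))
    finally have "(V * b) $$ (t, j) = (r * b) $$ (t, j)" by (simp add: eVb)
    also have "\<dots> = (word_prod ?L (fm_A \<R>) ps * fm_B \<R> k Z) $$ (t, q)"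
      unfolding r_def b_def prefix_row_mult_block_lin[where Y = Y, OF Y qs' m_def A B t j(1)]
      using j N by (simp add: qs del: index_mult_mat(1))
    finally show ?thesis .
  qed
  have pm: "p < s * m" using pq by (auto simp: m_def)
  have "M $$ (p, j) = Ikron m ?D $$ (p, j) + (Ikron m ?C * (V * b)) $$ (p, j)"
    unfolding M fm_out_def b_def[symmetric]
    using dims C D j pm by (simp del: index_mult_mat(1))
  \<comment> \<open>Row block 0 and column block \<open>length qs\<close> > 0 lie off the
    diagonal.\<close>
  also have "Ikron m ?D $$ (p, j) = 0"
    using D j pm pq N by (simp add: Ikron_index)
  also have "(Ikron m ?C * (V * b)) $$ (p, j) = (\<Sum>t<?L * m. Ikron m ?C $$ (p, t) * (V * b) $$ (t, j))"
    using dims C j pm by (subst index_mult_mat_sum) (auto simp del: index_mult_mat(1))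
  also have "\<dots> = (\<Sum>t<?L. ?C $$ (p, t) * (V * b) $$ (t, j))"
    using Ikron_sum_left[of p ?C m "\<lambda>t. (V * b) $$ (t, j)"] C pm pq by (simp del: index_mult_mat(1))
  also have "\<dots> = (\<Sum>t<?L. ?C $$ (p, t) * (word_prod ?L (fm_A \<R>) ps * fm_B \<R> k Z) $$ (t, q))"
    by (intro sum.cong refl) (simp add: Vb del: index_mult_mat(1))
  also have "\<dots> = (?C * (word_prod ?L (fm_A \<R>) ps * fm_B \<R> k Z)) $$ (p, q)"
    using carrier_matD[OF C] carrier_matD[OF WB] pq by (subst index_mult_mat_sum) (auto simp del: index_mult_mat(1))
  finally show ?thesis by (simp add: j_def)
qed

section \<open>Ampliation of a realization\<close>

lemma linear_mat_map_block_apply: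
  assumes T: "linear_mat_map s r c T"
  shows "linear_mat_map (s * n) (r * n) (c * n) (block_apply s r c n T)"
  unfolding linear_mat_map_def
proof (intro conjI ballI allI)
  fix M :: "'a mat" assume M: "M \<in> carrier_mat (s * n) (s * n)"
  show "block_apply s r c n T M \<in> carrier_mat (r * n) (c * n)" by (simp add: block_apply_def)
  have d: "dim_row (T (mat_block s M i j)) = r" "dim_col (T (mat_block s M i j)) = c" for M i j
    using linear_mat_map_carrier[OF T, of "mat_block s M i j"] by auto
  show "block_apply s r c n T (a \<cdot>\<^sub>m M) = a \<cdot>\<^sub>m block_apply s r c n T M" for a
  proof (rule eq_matI)
    fix i j assume "i < dim_row (a \<cdot>\<^sub>m block_apply s r c n T M)" "j < dim_col (a \<cdot>\<^sub>m block_apply s r c n T M)"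
    then have i: "i < r * n" and j: "j < c * n" by (auto simp: block_apply_def)
    have "mat_block s (a \<cdot>\<^sub>m M) (i div r) (j div c) = a \<cdot>\<^sub>m mat_block s M (i div r) (j div c)"
      using M i j by (intro eq_matI) (auto simp: mat_block_def)
    then show "block_apply s r c n T (a \<cdot>\<^sub>m M) $$ (i, j) = (a \<cdot>\<^sub>m block_apply s r c n T M) $$ (i, j)"
      using i j d by (simp add: block_apply_def linear_mat_map_smult[OF T])
  qed (auto simp: block_apply_def)
  fix N :: "'a mat" assume N: "N \<in> carrier_mat (s * n) (s * n)"
  show "block_apply s r c n T (M + N) = block_apply s r c n T M + block_apply s r c n T N"
  proof (rule eq_matI)
    fix i j assume "i < dim_row (block_apply s r c n T M + block_apply s r c n T N)"
      "j < dim_col (block_apply s r c n T M + block_apply s r c n T N)"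
    then have i: "i < r * n" and j: "j < c * n" by (auto simp: block_apply_def)
    then show "block_apply s r c n T (M + N) $$ (i, j) =
        (block_apply s r c n T M + block_apply s r c n T N) $$ (i, j)"
      using d by (simp add: block_apply_def mat_block_add[OF M N] linear_mat_map_add[OF T])
  qed (auto simp: block_apply_def)
qed

text \<open>Cutting a matrix into blocks of size s * n and each of these into blocks of size s
  yields the same pieces as cutting it into blocks of size s at once; the proof matches the
  indices.\<close>

lemma block_lin_block_apply:
  "block_lin (s * n) (r * n) (c * n) m (\<lambda>k. block_apply s r c n (F k)) Z = block_lin s r c (n * m) F Z"
proof (rule eq_matI)
  fix i j assume "i < dim_row (block_lin s r c (n * m) F Z)" "j < dim_col (block_lin s r c (n * m) F Z)"
  then have i: "i < r * (n * m)" and j: "j < c * (n * m)" by auto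
  have pos: "0 < r" "0 < c" "0 < n" using i j by (auto intro: gr0I)
  have i': "i < r * n * m" "i mod (r * n) < r * n" and j': "j < c * n * m" "j mod (c * n) < c * n"
    using i j pos by (auto simp: mult.assoc)
  have m: "i mod (r * n) mod r = i mod r" "j mod (c * n) mod c = j mod c"
    by (auto simp: mod_mult2_eq)
  have d: "i mod (r * n) div r = i div r mod n" "j mod (c * n) div c = j div c mod n"
    using pos by (auto simp: mod_mult2_eq)
  have e: "n * (i div (r * n)) + i div r mod n = i div r" "n * (j div (c * n)) + j div c mod n = j div c"
    by (auto simp: div_mult2_eq)
  have "mat_block s (mat_block (s * n) (Z k) (i div (r * n)) (j div (c * n)))
      (i mod (r * n) div r) (j mod (c * n) div c) = mat_block s (Z k) (i div r) (j div c)" for k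
  proof -
    have lt: "s * (i mod (r * n) div r) + p < s * n" "s * (j mod (c * n) div c) + p < s * n" if "p < s" for p
      using that pos by (auto simp: d)
    have "s * n * (i div (r * n)) + (s * (i mod (r * n) div r) + p) = s * (i div r) + p"
      "s * n * (j div (c * n)) + (s * (j mod (c * n) div c) + p) = s * (j div c) + p" for p
      unfolding d using arg_cong[OF e(1), of "\<lambda>x. s * x"] arg_cong[OF e(2), of "\<lambda>x. s * x"]
      by (simp_all add: distrib_left mult.assoc)
    then show ?thesis
      using lt by (intro eq_matI) (auto simp: mat_block_def add.assoc[symmetric])
  qed
  then show "block_lin (s * n) (r * n) (c * n) m (\<lambda>k. block_apply s r c n (F k)) Z $$ (i, j) =
      block_lin s r c (n * m) F Z $$ (i, j)"
    unfolding block_lin_index[OF i'(1) j'(1)] block_lin_index[OF i j]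
    using i'(2) j'(2) by (simp add: block_apply_def m)
qed (auto simp: mult.assoc)

definition fm_ampl :: "nat \<Rightarrow> nat \<Rightarrow> ('d, 'a::field) fm_realization \<Rightarrow> ('d, 'a) fm_realization" where
  "fm_ampl s n \<R> = \<lparr>fm_L = fm_L \<R> * n, fm_D = Ikron n (fm_D \<R>), fm_C = Ikron n (fm_C \<R>),
     fm_A = (\<lambda>k. block_apply s (fm_L \<R>) (fm_L \<R>) n (fm_A \<R> k)),
     fm_B = (\<lambda>k. block_apply s (fm_L \<R>) s n (fm_B \<R> k))\<rparr>"

lemma is_fm_realization_fm_ampl:
  "is_fm_realization s \<R> \<Longrightarrow> is_fm_realization (s * n) (fm_ampl s n \<R>)"
  by (auto simp: is_fm_realization_def fm_ampl_def intro: linear_mat_map_block_apply)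

text \<open>Nothing is recomputed: displacement, pencil, input and output of the ampliation at block
  size m coincide with those of \<open>\<R>\<close> at block size n * m.\<close>

lemma fm_val_fm_ampl:
  "fm_val (s * n) (ampl n Y) (fm_ampl s n \<R>) m X M \<longleftrightarrow> fm_val s Y \<R> (n * m) X M"
proof -
  have "displ m (ampl n Y) X = displ (n * m) Y X"
    by (simp add: displ_def[abs_def] ampl_def Ikron_Ikron)
  then show ?thesis
    by (simp add: fm_val_def fm_inv_def fm_out_def fm_pencil_block_lin fm_ampl_def
        block_lin_block_apply Ikron_Ikron mult.assoc)
qed

lemma fm_realizes_fm_ampl:
  assumes "fm_realizes s Y \<R> R" "n \<ge> 1"
  shows "fm_realizes (s * n) (ampl n Y) (fm_ampl s n \<R>) R"
proof -
  have "1 \<le> n * m" if "1 \<le> m" for m using that \<open>n \<ge> 1\<close> by simp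
  with assms show ?thesis
    unfolding fm_realizes_iff fm_val_fm_ampl
    by (auto simp: is_fm_realization_fm_ampl mult.assoc)
qed

section \<open>Compression of a realization\<close>

lemma block_lin_cong:
  assumes "\<And>k M. M \<in> carrier_mat s s \<Longrightarrow> F k M = G k M"
  shows "block_lin s r c m F Z = block_lin s r c m G Z"
  by (rule eq_matI) (auto simp: block_lin_index assms)

text \<open>Meant for P Q = 1: Q embeds a smaller state space and P retracts onto it. An invariant
  range of Q gives a restriction, an invariant kernel of P a quotient.\<close>

definition fm_compress ::
  "'a mat \<Rightarrow> 'a mat \<Rightarrow> ('d, 'a::field) fm_realization \<Rightarrow> ('d, 'a) fm_realization" where
  "fm_compress P Q \<R> = \<lparr>fm_L = dim_col Q, fm_D = fm_D \<R>, fm_C = fm_C \<R> * Q,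
     fm_A = (\<lambda>k M. P * (fm_A \<R> k M * Q)), fm_B = (\<lambda>k M. P * fm_B \<R> k M)\<rparr>"

lemma is_fm_realization_fm_compress:
  assumes "is_fm_realization s \<R>" "P \<in> carrier_mat r (fm_L \<R>)" "Q \<in> carrier_mat (fm_L \<R>) r"
  shows "is_fm_realization s (fm_compress P Q \<R>)"
  using assms by (auto simp: is_fm_realization_iff fm_compress_def
      intro!: linear_family_mult_left linear_family_mult_right)

text \<open>\<open>QA\<close> and \<open>QB\<close> say that the range of Q is invariant under every
  A(M) and contains the range of every B(M). Hence q T = (1 - a) q for the new pencil T, and W = p V
  q inverts T wherever V exists, so no point of the domain is lost.\<close>

lemma fm_val_fm_compress_controllable:
  fixes Y :: "'d::finite \<Rightarrow> 'a::field mat"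
  assumes fm: "is_fm_realization s \<R>"
    and P: "P \<in> carrier_mat r (fm_L \<R>)" and Q: "Q \<in> carrier_mat (fm_L \<R>) r" and PQ: "P * Q = 1\<^sub>m r"
    and QA: "\<And>k M. M \<in> carrier_mat s s \<Longrightarrow> Q * (P * (fm_A \<R> k M * Q)) = fm_A \<R> k M * Q"
    and QB: "\<And>k M. M \<in> carrier_mat s s \<Longrightarrow> Q * (P * fm_B \<R> k M) = fm_B \<R> k M"
    and val: "fm_val s Y \<R> m X M"
  shows "fm_val s Y (fm_compress P Q \<R>) m X M"
proof -
  let ?L = "fm_L \<R>" and ?\<R>' = "fm_compress P Q \<R>"
  have A: "linear_family s ?L ?L (fm_A \<R>)" and B: "linear_family s ?L s (fm_B \<R>)"
    and C: "fm_C \<R> \<in> carrier_mat s ?L" and D: "fm_D \<R> \<in> carrier_mat s s"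
    using fm by (auto simp: is_fm_realization_iff)
  note AQ = linear_family_mult_right[OF A Q] and PAQ = linear_family_mult_left[OF linear_family_mult_right[OF A Q] P]
    and PB = linear_family_mult_left[OF B P]
  obtain V where V: "fm_inv s Y \<R> m X V" and M: "M = fm_out s Y \<R> m X V"
    using val by (auto simp: fm_val_def)
  define a where "a = block_lin s ?L ?L m (fm_A \<R>) (displ m Y X)"
  define b where "b = block_lin s ?L s m (fm_B \<R>) (displ m Y X)"
  define p where "p = Ikron m P"
  define q where "q = Ikron m Q"
  define c where "c = Ikron m (fm_C \<R>)"
  have dims: "dim_row a = ?L * m" "dim_col a = ?L * m" "dim_row b = ?L * m" "dim_col b = s * m"
    "dim_row V = ?L * m" "dim_col V = ?L * m" "dim_row p = r * m" "dim_col p = ?L * m"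
    "dim_row q = ?L * m" "dim_col q = r * m" "dim_row c = s * m" "dim_col c = ?L * m"
    using V P Q C by (auto simp: a_def b_def fm_inv_def p_def q_def c_def)
  have pq: "p * q = 1\<^sub>m (r * m)" using P Q PQ by (simp add: p_def q_def Ikron_mult)
  have a': "block_lin s r r m (fm_A ?\<R>') (displ m Y X) = p * (a * q)"
    by (simp add: fm_compress_def block_lin_mult_left[OF AQ P] block_lin_mult_right[OF A Q] a_def p_def q_def)
  have b': "block_lin s r s m (fm_B ?\<R>') (displ m Y X) = p * b"
    by (simp add: fm_compress_def block_lin_mult_left[OF B P] b_def p_def)
  have L': "fm_L ?\<R>' = r" using Q by (simp add: fm_compress_def)
  have qa: "q * (p * (a * q)) = a * q"
    using block_lin_cong[of s "\<lambda>k M. Q * (P * (fm_A \<R> k M * Q))" "\<lambda>k M. fm_A \<R> k M * Q", OF QA,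
        where r = "?L" and c = r and m = m and Z = "displ m Y X"]
    by (simp add: block_lin_mult_left[OF PAQ Q] block_lin_mult_left[OF AQ P] block_lin_mult_right[OF A Q]
        a_def p_def q_def)
  have qb: "q * (p * b) = b"
    using block_lin_cong[of s "\<lambda>k M. Q * (P * fm_B \<R> k M)" "fm_B \<R>", OF QB,
        where r = "?L" and c = s and m = m and Z = "displ m Y X"]
    by (simp add: block_lin_mult_left[OF PB Q] block_lin_mult_left[OF B P] b_def p_def q_def)
  have VP: "V * (1\<^sub>m (?L * m) - a) = 1\<^sub>m (?L * m)"
    using V by (simp add: fm_inv_def fm_pencil_block_lin a_def)
  define T where "T = 1\<^sub>m (r * m) - p * (a * q)"
  have T: "T \<in> carrier_mat (r * m) (r * m)" using dims by (auto simp: T_def)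
  have T': "fm_pencil s Y ?\<R>' m X = T" by (simp add: fm_pencil_block_lin L' a' T_def)
  have qT: "q * T = (1\<^sub>m (?L * m) - a) * q"
    using dims by (simp add: T_def mult_minus_distrib_mat_dim minus_mult_distrib_mat_dim
        right_one_mult_mat_dim left_one_mult_mat_dim qa)
  define W where "W = p * (V * q)"
  have W: "W \<in> carrier_mat (r * m) (r * m)" using dims by (auto simp: W_def)
  have VPx: "V * ((1\<^sub>m (?L * m) - a) * x) = x" if "dim_row x = ?L * m" for x
    using that dims VP by (simp add: assoc_mult_mat_dim[symmetric] left_one_mult_mat_dim)
  have WT: "W * T = 1\<^sub>m (r * m)"
  proof -
    have "W * T = p * (V * (q * T))" using dims T by (simp add: W_def assoc_mult_mat_dim)
    then show ?thesis using dims by (simp add: qT VPx pq)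
  qed
  have TW: "T * W = 1\<^sub>m (r * m)" by (rule mat_mult_left_right_inverse[OF W T WT])
  show ?thesis
  proof (rule fm_valI_left)
    show "W \<in> carrier_mat (fm_L ?\<R>' * m) (fm_L ?\<R>' * m)" using W by (simp add: L')
    show "W * fm_pencil s Y ?\<R>' m X = 1\<^sub>m (fm_L ?\<R>' * m)" by (simp add: T' L' WT)
    \<comment> \<open>Applying V afterwards shows that the old state V b is the image under q of the
      new state W p b.\<close>
    have "(1\<^sub>m (?L * m) - a) * (q * (W * (p * b))) = q * ((T * W) * (p * b))"
      using dims W T by (simp add: assoc_mult_mat_dim[symmetric] qT[symmetric])
    also have "\<dots> = b" unfolding TW using dims by (simp add: left_one_mult_mat_dim qb)
    finally have "V * b = V * ((1\<^sub>m (?L * m) - a) * (q * (W * (p * b))))" by simp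
    then have Vb: "V * b = q * (W * (p * b))" using dims by (simp add: VPx)
    have "Ikron m (fm_C \<R> * Q) = c * q" using C Q by (simp add: c_def q_def Ikron_mult)
    then have "fm_out s Y ?\<R>' m X W = Ikron m (fm_D \<R>) + c * q * (W * (p * b))"
      unfolding fm_out_def L' b' by (simp add: fm_compress_def)
    also have "\<dots> = M"
      unfolding M fm_out_def using dims W Vb by (simp add: c_def[symmetric] b_def[symmetric] assoc_mult_mat_dim)
    finally show "fm_out s Y ?\<R>' m X W = M" .
  qed
qed

text \<open>\<open>AP\<close> and \<open>CP\<close> say that the kernel of P is invariant and
  annihilated by C. So T p = p (1 - a), and W = p V q is a right inverse of T. Transposing the
  restriction argument does not give this one, because B depends on the point while C is
  constant.\<close>

lemma fm_val_fm_compress_observable: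
  fixes Y :: "'d::finite \<Rightarrow> 'a::field mat"
  assumes fm: "is_fm_realization s \<R>"
    and P: "P \<in> carrier_mat r (fm_L \<R>)" and Q: "Q \<in> carrier_mat (fm_L \<R>) r" and PQ: "P * Q = 1\<^sub>m r"
    and AP: "\<And>k M. M \<in> carrier_mat s s \<Longrightarrow> P * (fm_A \<R> k M * Q) * P = P * fm_A \<R> k M"
    and CP: "fm_C \<R> * Q * P = fm_C \<R>"
    and val: "fm_val s Y \<R> m X M"
  shows "fm_val s Y (fm_compress P Q \<R>) m X M"
proof -
  let ?L = "fm_L \<R>" and ?\<R>' = "fm_compress P Q \<R>"
  have A: "linear_family s ?L ?L (fm_A \<R>)" and B: "linear_family s ?L s (fm_B \<R>)"
    and C: "fm_C \<R> \<in> carrier_mat s ?L" and D: "fm_D \<R> \<in> carrier_mat s s"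
    using fm by (auto simp: is_fm_realization_iff)
  note AQ = linear_family_mult_right[OF A Q] and PAQ = linear_family_mult_left[OF linear_family_mult_right[OF A Q] P]
  obtain V where V: "fm_inv s Y \<R> m X V" and M: "M = fm_out s Y \<R> m X V"
    using val by (auto simp: fm_val_def)
  define a where "a = block_lin s ?L ?L m (fm_A \<R>) (displ m Y X)"
  define b where "b = block_lin s ?L s m (fm_B \<R>) (displ m Y X)"
  define p where "p = Ikron m P"
  define q where "q = Ikron m Q"
  define c where "c = Ikron m (fm_C \<R>)"
  have dims: "dim_row a = ?L * m" "dim_col a = ?L * m" "dim_row b = ?L * m" "dim_col b = s * m"
    "dim_row V = ?L * m" "dim_col V = ?L * m" "dim_row p = r * m" "dim_col p = ?L * m"
    "dim_row q = ?L * m" "dim_col q = r * m" "dim_row c = s * m" "dim_col c = ?L * m"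
    using V P Q C by (auto simp: a_def b_def fm_inv_def p_def q_def c_def)
  have pq: "p * q = 1\<^sub>m (r * m)" using P Q PQ by (simp add: p_def q_def Ikron_mult)
  have a': "block_lin s r r m (fm_A ?\<R>') (displ m Y X) = p * (a * q)"
    by (simp add: fm_compress_def block_lin_mult_left[OF AQ P] block_lin_mult_right[OF A Q] a_def p_def q_def)
  have b': "block_lin s r s m (fm_B ?\<R>') (displ m Y X) = p * b"
    by (simp add: fm_compress_def block_lin_mult_left[OF B P] b_def p_def)
  have L': "fm_L ?\<R>' = r" using Q by (simp add: fm_compress_def)
  have ap: "p * (a * q) * p = p * a"
    using block_lin_cong[of s "\<lambda>k M. P * (fm_A \<R> k M * Q) * P" "\<lambda>k M. P * fm_A \<R> k M", OF AP,
        where r = r and c = "?L" and m = m and Z = "displ m Y X"]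
    by (simp add: block_lin_mult_right[OF PAQ P] block_lin_mult_left[OF AQ P] block_lin_mult_right[OF A Q]
        block_lin_mult_left[OF A P] a_def p_def q_def)
  have cqp: "c * q * p = c"
  proof -
    have "c * q * p = Ikron m (fm_C \<R> * Q * P)"
      using C Q P by (simp add: c_def q_def p_def Ikron_mult)
    then show ?thesis by (simp add: CP c_def)
  qed
  have PV: "(1\<^sub>m (?L * m) - a) * V = 1\<^sub>m (?L * m)"
    using V by (simp add: fm_inv_def fm_pencil_block_lin a_def)
  define T where "T = 1\<^sub>m (r * m) - p * (a * q)"
  have T: "T \<in> carrier_mat (r * m) (r * m)" using dims by (auto simp: T_def)
  have T': "fm_pencil s Y ?\<R>' m X = T" by (simp add: fm_pencil_block_lin L' a' T_def)
  have Tp: "T * p = p * (1\<^sub>m (?L * m) - a)"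
    using dims ap by (simp add: T_def mult_minus_distrib_mat_dim minus_mult_distrib_mat_dim
        right_one_mult_mat_dim left_one_mult_mat_dim)
  define W where "W = p * (V * q)"
  have W: "W \<in> carrier_mat (r * m) (r * m)" using dims by (auto simp: W_def)
  have PVx: "(1\<^sub>m (?L * m) - a) * (V * x) = x" if "dim_row x = ?L * m" for x
    using that dims PV by (simp add: assoc_mult_mat_dim[symmetric] left_one_mult_mat_dim)
  have TW: "T * W = 1\<^sub>m (r * m)"
  proof -
    have "T * W = (T * p) * (V * q)" using dims T by (simp add: W_def assoc_mult_mat_dim)
    also have "\<dots> = p * ((1\<^sub>m (?L * m) - a) * (V * q))"
      unfolding Tp using dims by (simp add: assoc_mult_mat_dim)
    finally show ?thesis using dims by (simp add: PVx pq)
  qed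
  have WT: "W * T = 1\<^sub>m (r * m)" by (rule mat_mult_left_right_inverse[OF T W TW])
  show ?thesis
  proof (rule fm_valI_right)
    show "W \<in> carrier_mat (fm_L ?\<R>' * m) (fm_L ?\<R>' * m)" using W by (simp add: L')
    show "fm_pencil s Y ?\<R>' m X * W = 1\<^sub>m (fm_L ?\<R>' * m)" by (simp add: T' L' TW)
    \<comment> \<open>Inserting (1 - a) V = 1 and moving T next to W cancels W: the new state W p b
      is the image p V b of the old one.\<close>
    have "W * p = W * (p * ((1\<^sub>m (?L * m) - a) * V))"
      unfolding PV using dims by (simp add: right_one_mult_mat_dim)
    also have "\<dots> = W * ((T * p) * V)" unfolding Tp using dims by (simp add: assoc_mult_mat_dim)
    also have "\<dots> = (W * T) * (p * V)" using dims T W by (simp add: assoc_mult_mat_dim)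
    finally have Wp: "W * p = p * V" unfolding WT using dims by (simp add: left_one_mult_mat_dim)
    have "Ikron m (fm_C \<R> * Q) = c * q" using C Q by (simp add: c_def q_def Ikron_mult)
    then have "fm_out s Y ?\<R>' m X W = Ikron m (fm_D \<R>) + c * q * (W * (p * b))"
      unfolding fm_out_def L' b' by (simp add: fm_compress_def)
    also have "c * q * (W * (p * b)) = c * q * ((W * p) * b)"
      using dims W by (simp add: assoc_mult_mat_dim)
    also have "\<dots> = (c * q * p) * (V * b)"
      unfolding Wp using dims by (simp add: assoc_mult_mat_dim)
    also have "Ikron m (fm_D \<R>) + \<dots> = M"
      unfolding M fm_out_def cqp by (simp add: c_def[symmetric] b_def[symmetric])
    finally show "fm_out s Y ?\<R>' m X W = M" .
  qed
qed

section \<open>Controllability and observability\<close>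

lemma mat_eqI_mult_vec:
  fixes A B :: "'a::semiring_1 mat"
  assumes A: "A \<in> carrier_mat n m" and B: "B \<in> carrier_mat n m"
    and eq: "\<And>x. x \<in> carrier_vec m \<Longrightarrow> A *\<^sub>v x = B *\<^sub>v x"
  shows "A = B"
proof (rule eq_matI)
  fix i j assume "i < dim_row B" "j < dim_col B"
  then have i: "i < n" and j: "j < m" using B by auto
  have "(A *\<^sub>v unit_vec m j) $ i = (B *\<^sub>v unit_vec m j) $ i" using eq by simp
  then show "A $$ (i, j) = B $$ (i, j)"
    using A B i j by (simp add: scalar_prod_right_unit)
qed (use A B in auto)

text \<open>Filling up with zero rows gives a square matrix whose transpose annihilates a unit
  vector, hence with determinant 0.\<close>

lemma wide_mat_kernel:
  fixes A :: "'a::field mat"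
  assumes A: "A \<in> carrier_mat a b" and ab: "a < b"
  obtains x where "x \<in> carrier_vec b" "x \<noteq> 0\<^sub>v b" "A *\<^sub>v x = 0\<^sub>v a"
proof -
  define B where "B = mat b b (\<lambda>(i, j). if i < a then A $$ (i, j) else 0)"
  have B: "B \<in> carrier_mat b b" by (simp add: B_def)
  have "B\<^sup>T *\<^sub>v unit_vec b a = 0\<^sub>v b"
    using ab B by (intro eq_vecI) (auto simp: scalar_prod_right_unit B_def)
  then have "det B\<^sup>T = 0"
    using ab B det_0_iff_vec_prod_zero_field[of "B\<^sup>T" b] unit_vec_nonzero[of a b]
    by (auto intro!: exI[of _ "unit_vec b a"])
  then have "det B = 0" using det_transpose[OF B] by simp
  then obtain x where x: "x \<in> carrier_vec b" "x \<noteq> 0\<^sub>v b" "B *\<^sub>v x = 0\<^sub>v b"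
    using det_0_iff_vec_prod_zero_field[OF B] by auto
  have "A *\<^sub>v x = 0\<^sub>v a"
  proof (rule eq_vecI)
    fix i assume "i < dim_vec (0\<^sub>v a)"
    then have i: "i < a" by simp
    have "row B i = row A i" using i ab A by (intro eq_vecI) (auto simp: B_def)
    moreover have "(B *\<^sub>v x) $ i = 0" using x i ab by simp
    ultimately show "(A *\<^sub>v x) $ i = 0\<^sub>v a $ i" using i ab A B by simp
  qed (use A in auto)
  with x that show ?thesis by blast
qed

definition vec_subspace :: "nat \<Rightarrow> 'a::field vec set \<Rightarrow> bool" where
  "vec_subspace n W \<longleftrightarrow> W \<subseteq> carrier_vec n \<and> 0\<^sub>v n \<in> W \<and> (\<forall>v\<in>W. \<forall>w\<in>W. v + w \<in> W) \<and>
    (\<forall>a. \<forall>v\<in>W. a \<cdot>\<^sub>v v \<in> W)"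

text \<open>\<open>Q\<close> is a basis of a subspace of \<open>W\<close> with left inverse \<open>P\<close>; a vector of \<open>W\<close> not fixed by the
  projection \<open>Q * P\<close> yields one more column for \<open>Q\<close>, so a \<open>Q\<close> of maximal width spans \<open>W\<close>.\<close>

lemma vec_subspace_projection:
  fixes W :: "'a::field vec set"
  assumes W: "vec_subspace n W"
  obtains r P Q where "r \<le> n" "P \<in> carrier_mat r n" "Q \<in> carrier_mat n r" "P * Q = 1\<^sub>m r"
    "\<And>v. v \<in> W \<Longrightarrow> Q *\<^sub>v (P *\<^sub>v v) = v" "\<And>x. x \<in> carrier_vec r \<Longrightarrow> Q *\<^sub>v x \<in> W"
proof -
  define good where "good r P Q \<longleftrightarrow> P \<in> carrier_mat r n \<and> Q \<in> carrier_mat n r \<and> P * Q = 1\<^sub>m r \<and>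
    (\<forall>x\<in>carrier_vec r. Q *\<^sub>v x \<in> W)" for r :: nat and P Q :: "'a mat"
  have Wc: "v \<in> carrier_vec n" if "v \<in> W" for v using that W by (auto simp: vec_subspace_def)
  \<comment> \<open>P Q = 1 makes Q injective, so it has at most n columns; this bound gives
    \<open>GREATEST\<close> its meaning.\<close>
  have bound: "r \<le> n" if g: "good r P Q" for r P Q
  proof (rule ccontr)
    assume "\<not> r \<le> n"
    then obtain x where x: "x \<in> carrier_vec r" "x \<noteq> 0\<^sub>v r" "Q *\<^sub>v x = 0\<^sub>v n"
      using g wide_mat_kernel[of Q n r] by (auto simp: good_def)
    have PQ: "P * Q = 1\<^sub>m r" using g by (simp add: good_def)
    have "x = (P * Q) *\<^sub>v x" unfolding PQ using x by simp
    also have "\<dots> = P *\<^sub>v (Q *\<^sub>v x)"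
      by (rule assoc_mult_mat_vec) (use g x in \<open>auto simp: good_def\<close>)
    also have "\<dots> = 0\<^sub>v r" unfolding x(3) using that by (intro eq_vecI) (auto simp: good_def)
    finally show False using x by simp
  qed
  have good0: "good 0 (0\<^sub>m 0 n) (0\<^sub>m n 0)"
  proof -
    have "0\<^sub>m n 0 *\<^sub>v x = 0\<^sub>v n" if "x \<in> carrier_vec 0" for x :: "'a vec"
      using that by (intro eq_vecI) (auto simp: scalar_prod_def)
    then show ?thesis using W by (auto simp: good_def vec_subspace_def)
  qed
  define r where "r = (GREATEST r. \<exists>P Q. good r P Q)"
  have "\<exists>P Q. good r P Q"
    unfolding r_def by (rule GreatestI_nat[of _ 0 n]) (use good0 bound in blast)+
  then obtain P Q where PQ: "good r P Q" by blast
  have max: "k \<le> r" if "good k P Q" for k P Q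
    unfolding r_def by (rule Greatest_le_nat[of _ _ n]) (use that bound in blast)+
  have P: "P \<in> carrier_mat r n" and Q: "Q \<in> carrier_mat n r" and PQ1: "P * Q = 1\<^sub>m r"
    and QW: "\<And>x. x \<in> carrier_vec r \<Longrightarrow> Q *\<^sub>v x \<in> W"
    using PQ by (auto simp: good_def)
  have "Q *\<^sub>v (P *\<^sub>v v) = v" if v: "v \<in> W" for v
  proof (rule ccontr)
    assume ne: "Q *\<^sub>v (P *\<^sub>v v) \<noteq> v"
    have vc: "v \<in> carrier_vec n" by (rule Wc[OF v])
    \<comment> \<open>The defect of v lies in W, is annihilated by P and is nonzero, so it is
      independent of the columns of Q.\<close>
    define u where "u = v - Q *\<^sub>v (P *\<^sub>v v)"
    have uc: "u \<in> carrier_vec n" using Q vc by (intro carrier_vecI) (simp add: u_def)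
    have u: "u \<in> W"
    proof -
      have "u = v + (- 1) \<cdot>\<^sub>v (Q *\<^sub>v (P *\<^sub>v v))"
        using vc Q by (intro eq_vecI) (auto simp: u_def)
      moreover have "Q *\<^sub>v (P *\<^sub>v v) \<in> W" using P vc by (intro QW) auto
      ultimately show ?thesis using W v by (auto simp: vec_subspace_def)
    qed
    have Pu: "P *\<^sub>v u = 0\<^sub>v r"
    proof -
      have "P *\<^sub>v u = P *\<^sub>v v - P *\<^sub>v (Q *\<^sub>v (P *\<^sub>v v))"
        unfolding u_def using P Q vc by (intro mult_minus_distrib_mat_vec) auto
      also have "P *\<^sub>v (Q *\<^sub>v (P *\<^sub>v v)) = (P * Q) *\<^sub>v (P *\<^sub>v v)"
        using P Q vc by (intro assoc_mult_mat_vec[symmetric]) auto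
      finally show ?thesis using P vc by (simp add: PQ1)
    qed
    obtain i0 where i0: "i0 < n" "u $ i0 \<noteq> 0"
    proof -
      have "\<exists>i<n. u $ i \<noteq> 0"
      proof (rule ccontr)
        assume "\<not> (\<exists>i<n. u $ i \<noteq> 0)"
        then have "(v - Q *\<^sub>v (P *\<^sub>v v)) $ i = 0" if "i < n" for i using that by (simp add: u_def)
        then have "Q *\<^sub>v (P *\<^sub>v v) = v" using vc Q by (intro eq_vecI) (auto simp del: index_mult_mat_vec)
        with ne show False by simp
      qed
      with that show ?thesis by blast
    qed
    define E where "E = 1\<^sub>m n - Q * P"
    have E: "E \<in> carrier_mat n n" using P Q by (auto simp: E_def)
    have "Q * P * Q = Q" using P Q PQ1 by (simp add: assoc_mult_mat_dim)
    then have EQ: "E * Q = 0\<^sub>m n r"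
      using P Q by (simp add: E_def minus_mult_distrib_mat_dim)
    have Eu: "E *\<^sub>v u = u"
    proof -
      have "E *\<^sub>v u = 1\<^sub>m n *\<^sub>v u - (Q * P) *\<^sub>v u"
        unfolding E_def using P Q uc by (intro minus_mult_distrib_mat_vec) auto
      also have "(Q * P) *\<^sub>v u = Q *\<^sub>v (P *\<^sub>v u)" using P Q uc by simp
      also have "Q *\<^sub>v (P *\<^sub>v u) = 0\<^sub>v n" unfolding Pu using Q by (intro eq_vecI) auto
      finally show ?thesis using uc by simp
    qed
    \<comment> \<open>Row i0 of E, divided by u $ i0, vanishes on the columns of Q and is 1 at u,
      because E Q = 0 and E u = u. As an additional row of P it therefore extends the left
      inverse.\<close>
    define P' where "P' = mat (Suc r) n (\<lambda>(i, j). if i < r then P $$ (i, j) else E $$ (i0, j) / u $ i0)"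
    define Q' where "Q' = mat n (Suc r) (\<lambda>(i, j). if j < r then Q $$ (i, j) else u $ i)"
    have "good (Suc r) P' Q'"
      unfolding good_def
    proof (intro conjI ballI)
      show "P' * Q' = 1\<^sub>m (Suc r)"
      proof (rule eq_matI)
        fix i j assume "i < dim_row (1\<^sub>m (Suc r))" "j < dim_col (1\<^sub>m (Suc r))"
        then have ij: "i < Suc r" "j < Suc r" by auto
        have sum: "(P' * Q') $$ (i, j) = (\<Sum>t<n. (if i < r then P $$ (i, t) else E $$ (i0, t) / u $ i0) *
           (if j < r then Q $$ (t, j) else u $ t))"
          using ij by (subst index_mult_mat_sum) (auto simp: P'_def Q'_def intro!: sum.cong)
        have vs: "(M *\<^sub>v u) $ k = (\<Sum>t<n. M $$ (k, t) * u $ t)" if "M \<in> carrier_mat h n" "k < h" for M h k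
          using that uc by (auto simp: scalar_prod_def atLeast0LessThan intro!: sum.cong)
        consider "i < r" "j < r" | "i < r" "j = r" | "i = r" "j < r" | "i = r" "j = r"
          using ij by linarith
        then show "(P' * Q') $$ (i, j) = 1\<^sub>m (Suc r) $$ (i, j)"
        proof cases
          case 1
          then have "(P' * Q') $$ (i, j) = (P * Q) $$ (i, j)"
            unfolding sum using P Q by (subst index_mult_mat_sum) auto
          then show ?thesis using 1 by (simp add: PQ1)
        next
          case 2
          then have "(P' * Q') $$ (i, j) = (P *\<^sub>v u) $ i"
            unfolding sum using vs[OF P] by simp
          then show ?thesis using 2 by (simp add: Pu)
        next
          case 3
          then have "(P' * Q') $$ (i, j) = (E * Q) $$ (i0, j) / u $ i0"
            unfolding sum using i0 E Q by (subst index_mult_mat_sum) (auto simp: sum_divide_distrib)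
          then show ?thesis using 3 i0 by (simp add: EQ)
        next
          case 4
          then have "(P' * Q') $$ (i, j) = (E *\<^sub>v u) $ i0 / u $ i0"
            unfolding sum using vs[OF E i0(1)] by (simp add: sum_divide_distrib)
          then show ?thesis using 4 i0 by (simp add: Eu)
        qed
      qed (auto simp: P'_def Q'_def)
      fix x :: "'a vec" assume x: "x \<in> carrier_vec (Suc r)"
      define x' where "x' = vec r (\<lambda>i. x $ i)"
      have "Q' *\<^sub>v x = Q *\<^sub>v x' + x $ r \<cdot>\<^sub>v u"
        using x Q uc by (intro eq_vecI)
          (auto simp: Q'_def scalar_prod_def x'_def atLeast0LessThan mult.commute intro!: sum.cong)
      moreover have "Q *\<^sub>v x' \<in> W" by (rule QW) (simp add: x'_def)
      ultimately show "Q' *\<^sub>v x \<in> W" using W u by (auto simp: vec_subspace_def)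
    qed (auto simp: P'_def Q'_def)
    from max[OF this] show False by simp
  qed
  with P Q PQ1 QW bound[OF PQ] that show ?thesis by blast
qed

text \<open>A square Q with a left inverse is invertible, so its range is everything. Minimality of
  a realization leads to this case.\<close>

lemma square_projection_carrier:
  fixes P Q :: "'a::field mat"
  assumes P: "P \<in> carrier_mat n n" and Q: "Q \<in> carrier_mat n n" and "P * Q = 1\<^sub>m n"
    and "\<And>x. x \<in> carrier_vec n \<Longrightarrow> Q *\<^sub>v x \<in> W"
  shows "carrier_vec n \<subseteq> W"
proof
  fix v :: "'a vec" assume v: "v \<in> carrier_vec n"
  have "Q *\<^sub>v (P *\<^sub>v v) = (Q * P) *\<^sub>v v" using P Q v by simp
  also have "\<dots> = v" using mat_mult_left_right_inverse[OF P Q assms(3)] v by simp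
  finally show "v \<in> W" using assms(4)[of "P *\<^sub>v v"] P v by auto
qed

text \<open>The least subspace containing S and invariant under \<open>\<A>\<close>, given by
  closure rules instead of a span of words: the transfer to ampliations, the pairing of states and
  the orthogonality argument all become rule inductions.\<close>

inductive_set krylov :: "nat \<Rightarrow> 'a::field mat set \<Rightarrow> 'a vec set \<Rightarrow> 'a vec set"
  for n :: nat and \<A> :: "'a mat set" and S :: "'a vec set" where
  krylov_zero: "0\<^sub>v n \<in> krylov n \<A> S"
| krylov_base: "v \<in> S \<Longrightarrow> v \<in> krylov n \<A> S"
| krylov_add: "v \<in> krylov n \<A> S \<Longrightarrow> w \<in> krylov n \<A> S \<Longrightarrow> v + w \<in> krylov n \<A> S"
| krylov_smult: "v \<in> krylov n \<A> S \<Longrightarrow> a \<cdot>\<^sub>v v \<in> krylov n \<A> S"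
| krylov_step: "v \<in> krylov n \<A> S \<Longrightarrow> A \<in> \<A> \<Longrightarrow> A *\<^sub>v v \<in> krylov n \<A> S"

lemma krylov_carrier:
  assumes "\<A> \<subseteq> carrier_mat n n" "S \<subseteq> carrier_vec n"
  shows "krylov n \<A> S \<subseteq> carrier_vec n"
proof
  fix v assume "v \<in> krylov n \<A> S"
  then show "v \<in> carrier_vec n"
    by induction (use assms in auto)
qed

lemma krylov_subspace:
  "\<A> \<subseteq> carrier_mat n n \<Longrightarrow> S \<subseteq> carrier_vec n \<Longrightarrow> vec_subspace n (krylov n \<A> S)"
  using krylov_carrier[of \<A> n S]
  by (auto simp: vec_subspace_def intro: krylov.intros)

definition controllable :: "nat \<Rightarrow> ('d, 'a::field) fm_realization \<Rightarrow> bool" where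
  "controllable s \<R> \<longleftrightarrow> carrier_vec (fm_L \<R>) \<subseteq>
     krylov (fm_L \<R>) {fm_A \<R> k M | k M. M \<in> carrier_mat s s}
       {fm_B \<R> k M *\<^sub>v x | k M x. M \<in> carrier_mat s s \<and> x \<in> carrier_vec s}"

text \<open>Dual to the absence of nonzero states with all outputs zero: the transposed data reach
  the whole space. In this form the projection and ampliation arguments are shared with
  controllability.\<close>

definition observable :: "nat \<Rightarrow> ('d, 'a::field) fm_realization \<Rightarrow> bool" where
  "observable s \<R> \<longleftrightarrow> carrier_vec (fm_L \<R>) \<subseteq>
     krylov (fm_L \<R>) {(fm_A \<R> k M)\<^sup>T | k M. M \<in> carrier_mat s s}
       {(fm_C \<R>)\<^sup>T *\<^sub>v x | x. x \<in> carrier_vec s}"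

lemma minimal_controllable:
  assumes real: "fm_realizes s Y \<R> R" and min: "\<And>\<R>'. fm_realizes s Y \<R>' R \<Longrightarrow> fm_L \<R> \<le> fm_L \<R>'"
  shows "controllable s \<R>"
proof -
  let ?L = "fm_L \<R>"
  have fm: "is_fm_realization s \<R>" using real by (simp add: fm_realizes_iff)
  have A: "linear_family s ?L ?L (fm_A \<R>)" and B: "linear_family s ?L s (fm_B \<R>)"
    using fm by (auto simp: is_fm_realization_iff)
  define \<A> where "\<A> = {fm_A \<R> k M | k M. M \<in> carrier_mat s s}"
  define S where "S = {fm_B \<R> k M *\<^sub>v x | k M x. M \<in> carrier_mat s s \<and> x \<in> carrier_vec s}"
  have "\<A> \<subseteq> carrier_mat ?L ?L" using linear_family_carrier[OF A] by (auto simp: \<A>_def)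
  moreover have "S \<subseteq> carrier_vec ?L"
    using mult_mat_vec_carrier[OF linear_family_carrier[OF B]] by (auto simp: S_def)
  ultimately have "vec_subspace ?L (krylov ?L \<A> S)" by (rule krylov_subspace)
  then obtain r P Q where r: "r \<le> ?L" and P: "P \<in> carrier_mat r ?L" and Q: "Q \<in> carrier_mat ?L r"
    and PQ: "P * Q = 1\<^sub>m r" and fixed: "\<And>v. v \<in> krylov ?L \<A> S \<Longrightarrow> Q *\<^sub>v (P *\<^sub>v v) = v"
    and QW: "\<And>x. x \<in> carrier_vec r \<Longrightarrow> Q *\<^sub>v x \<in> krylov ?L \<A> S"
    by (rule vec_subspace_projection) blast
  \<comment> \<open>Q P fixes every matrix whose range lies in the reachable space; this covers both
    A(M) Q and B(M).\<close>
  have proj: "Q * (P * N) = N" if N: "N \<in> carrier_mat ?L c"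
    and NW: "\<And>x. x \<in> carrier_vec c \<Longrightarrow> N *\<^sub>v x \<in> krylov ?L \<A> S" for N c
  proof (rule mat_eqI_mult_vec)
    fix x :: "'b vec" assume x: "x \<in> carrier_vec c"
    have "(Q * (P * N)) *\<^sub>v x = Q *\<^sub>v (P *\<^sub>v (N *\<^sub>v x))"
      using P Q N x by (simp add: assoc_mult_mat_vec[of _ ?L r _ c] assoc_mult_mat_vec[of _ r ?L _ c])
    then show "(Q * (P * N)) *\<^sub>v x = N *\<^sub>v x" using fixed[OF NW[OF x]] by simp
  qed (use P Q N in auto)
  have QA: "Q * (P * (fm_A \<R> k M * Q)) = fm_A \<R> k M * Q" if M: "M \<in> carrier_mat s s" for k M
  proof (rule proj)
    note Ac = linear_family_carrier[OF A M, of k]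
    show "fm_A \<R> k M * Q \<in> carrier_mat ?L r" using Ac Q by auto
    fix x :: "'b vec" assume x: "x \<in> carrier_vec r"
    have "(fm_A \<R> k M * Q) *\<^sub>v x = fm_A \<R> k M *\<^sub>v (Q *\<^sub>v x)" using Ac Q x by simp
    then show "(fm_A \<R> k M * Q) *\<^sub>v x \<in> krylov ?L \<A> S"
      using QW[OF x] M by (auto simp: \<A>_def intro!: krylov_step)
  qed
  have QB: "Q * (P * fm_B \<R> k M) = fm_B \<R> k M" if M: "M \<in> carrier_mat s s" for k M
  proof (rule proj)
    show "fm_B \<R> k M \<in> carrier_mat ?L s" by (rule linear_family_carrier[OF B M])
    show "fm_B \<R> k M *\<^sub>v x \<in> krylov ?L \<A> S" if "x \<in> carrier_vec s" for x
      using that M by (intro krylov_base) (auto simp: S_def)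
  qed
  have "fm_realizes s Y (fm_compress P Q \<R>) R"
    using real unfolding fm_realizes_iff
    using fm_val_fm_compress_controllable[OF fm P Q PQ QA QB] is_fm_realization_fm_compress[OF fm P Q]
    by blast
  \<comment> \<open>Without a drop in dimension Q is square, so the reachable space is
    everything.\<close>
  from min[OF this] Q have "?L \<le> r" by (simp add: fm_compress_def)
  with r have "r = ?L" by simp
  then show ?thesis
    using square_projection_carrier[of P ?L Q "krylov ?L \<A> S"] P Q PQ QW
    by (simp add: controllable_def \<A>_def S_def)
qed

text \<open>Here Q spans the Krylov space of the transposed data. The kernel of
  \<open>Q\<^sup>T\<close> is the annihilator of that space, that is, the unobservable space, so
  \<open>Q\<^sup>T\<close> is the quotient map and \<open>P\<^sup>T\<close> a section of it.\<close>

lemma minimal_observable: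
  assumes real: "fm_realizes s Y \<R> R" and min: "\<And>\<R>'. fm_realizes s Y \<R>' R \<Longrightarrow> fm_L \<R> \<le> fm_L \<R>'"
  shows "observable s \<R>"
proof -
  let ?L = "fm_L \<R>"
  have fm: "is_fm_realization s \<R>" using real by (simp add: fm_realizes_iff)
  have A: "linear_family s ?L ?L (fm_A \<R>)" and C: "fm_C \<R> \<in> carrier_mat s ?L"
    using fm by (auto simp: is_fm_realization_iff)
  define \<A> where "\<A> = {(fm_A \<R> k M)\<^sup>T | k M. M \<in> carrier_mat s s}"
  define S where "S = {(fm_C \<R>)\<^sup>T *\<^sub>v x | x. x \<in> carrier_vec s}"
  have "\<A> \<subseteq> carrier_mat ?L ?L" using linear_family_carrier[OF A] by (auto simp: \<A>_def)
  moreover have "S \<subseteq> carrier_vec ?L" using C by (auto simp: S_def)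
  ultimately have "vec_subspace ?L (krylov ?L \<A> S)" by (rule krylov_subspace)
  then obtain r P Q where r: "r \<le> ?L" and P: "P \<in> carrier_mat r ?L" and Q: "Q \<in> carrier_mat ?L r"
    and PQ: "P * Q = 1\<^sub>m r" and fixed: "\<And>v. v \<in> krylov ?L \<A> S \<Longrightarrow> Q *\<^sub>v (P *\<^sub>v v) = v"
    and QW: "\<And>x. x \<in> carrier_vec r \<Longrightarrow> Q *\<^sub>v x \<in> krylov ?L \<A> S"
    by (rule vec_subspace_projection) blast
  have PT: "P\<^sup>T \<in> carrier_mat ?L r" and QT: "Q\<^sup>T \<in> carrier_mat r ?L" using P Q by auto
  have QPT: "Q\<^sup>T * P\<^sup>T = 1\<^sub>m r" using transpose_mult[OF P Q] PQ by simp
  have proj: "N * P\<^sup>T * Q\<^sup>T = N" if N: "N \<in> carrier_mat c ?L"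
    and NW: "\<And>x. x \<in> carrier_vec c \<Longrightarrow> N\<^sup>T *\<^sub>v x \<in> krylov ?L \<A> S" for N c
  proof -
    have NT: "N\<^sup>T \<in> carrier_mat ?L c" using N by auto
    have "Q * (P * N\<^sup>T) = N\<^sup>T"
    proof (rule mat_eqI_mult_vec)
      fix x :: "'b vec" assume x: "x \<in> carrier_vec c"
      have "(Q * (P * N\<^sup>T)) *\<^sub>v x = Q *\<^sub>v (P *\<^sub>v (N\<^sup>T *\<^sub>v x))"
        using P Q NT x by (simp add: assoc_mult_mat_vec[of _ ?L r _ c] assoc_mult_mat_vec[of _ r ?L _ c])
      then show "(Q * (P * N\<^sup>T)) *\<^sub>v x = N\<^sup>T *\<^sub>v x" using fixed[OF NW[OF x]] by simp
    qed (use P Q NT in auto)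
    then have "(Q * (P * N\<^sup>T))\<^sup>T = N" by simp
    moreover have "(Q * (P * N\<^sup>T))\<^sup>T = N * P\<^sup>T * Q\<^sup>T"
      using P Q NT transpose_mult[of Q ?L r "P * N\<^sup>T" c] transpose_mult[OF P NT] by simp
    ultimately show ?thesis by simp
  qed
  have AP: "Q\<^sup>T * (fm_A \<R> k M * P\<^sup>T) * Q\<^sup>T = Q\<^sup>T * fm_A \<R> k M" if M: "M \<in> carrier_mat s s" for k M
  proof -
    note Ac = linear_family_carrier[OF A M, of k]
    have "Q\<^sup>T * fm_A \<R> k M * P\<^sup>T * Q\<^sup>T = Q\<^sup>T * fm_A \<R> k M"
    proof (rule proj)
      show "Q\<^sup>T * fm_A \<R> k M \<in> carrier_mat r ?L" using Ac QT by auto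
      fix x :: "'b vec" assume x: "x \<in> carrier_vec r"
      have "(Q\<^sup>T * fm_A \<R> k M)\<^sup>T *\<^sub>v x = (fm_A \<R> k M)\<^sup>T *\<^sub>v (Q *\<^sub>v x)"
        using Ac Q x transpose_mult[OF QT Ac] by simp
      then show "(Q\<^sup>T * fm_A \<R> k M)\<^sup>T *\<^sub>v x \<in> krylov ?L \<A> S"
        using QW[OF x] M by (auto simp: \<A>_def intro!: krylov_step)
    qed
    then show ?thesis using assoc_mult_mat[OF QT Ac PT] by simp
  qed
  have CP: "fm_C \<R> * P\<^sup>T * Q\<^sup>T = fm_C \<R>"
    by (rule proj[OF C], rule krylov_base) (auto simp: S_def)
  have "fm_realizes s Y (fm_compress Q\<^sup>T P\<^sup>T \<R>) R"
    using real unfolding fm_realizes_iff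
    using fm_val_fm_compress_observable[OF fm QT PT QPT AP CP] is_fm_realization_fm_compress[OF fm QT PT]
    by blast
  from min[OF this] P have "?L \<le> r" by (simp add: fm_compress_def)
  with r have "r = ?L" by simp
  then show ?thesis
    using square_projection_carrier[of P ?L Q "krylov ?L \<A> S"] P Q PQ QW
    by (simp add: observable_def \<A>_def S_def)
qed

section \<open>Steering single blocks of an ampliation\<close>

definition block_vec :: "nat \<Rightarrow> nat \<Rightarrow> nat \<Rightarrow> 'a::zero vec \<Rightarrow> 'a vec" where
  "block_vec r n l v = vec (r * n) (\<lambda>t. if t div r = l then v $ (t mod r) else 0)"

lemma block_vec_carrier [simp]: "block_vec r n l v \<in> carrier_vec (r * n)"
  by (simp add: block_vec_def)

lemma dim_block_vec [simp]: "dim_vec (block_vec r n l v) = r * n"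
  by (simp add: block_vec_def)

text \<open>The matrix E_ll \<otimes> Z, in the same convention in which \<open>block_vec\<close> is
  e_l \<otimes> v. Testing the ampliated maps at these matrices isolates block l.\<close>

definition block_unit :: "nat \<Rightarrow> nat \<Rightarrow> nat \<Rightarrow> 'a::zero mat \<Rightarrow> 'a mat" where
  "block_unit s n l Z = mat (s * n) (s * n)
     (\<lambda>(i, j). if i div s = l \<and> j div s = l then Z $$ (i mod s, j mod s) else 0)"

lemma block_unit_carrier [simp]: "block_unit s n l Z \<in> carrier_mat (s * n) (s * n)"
  by (simp add: block_unit_def)

lemma index_mult_mat_vec_sum:
  "i < dim_row M \<Longrightarrow> dim_col M = dim_vec x \<Longrightarrow> (M *\<^sub>v x) $ i = (\<Sum>t<dim_vec x. M $$ (i, t) * x $ t)"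
  by (simp add: scalar_prod_def atLeast0LessThan)

lemma sum_block_vec:
  fixes f :: "nat \<Rightarrow> 'a::semiring_0"
  assumes "l < n"
  shows "(\<Sum>t<c * n. f t * block_vec c n l x $ t) = (\<Sum>p<c. f (c * l + p) * x $ p)"
proof -
  have "(\<Sum>t<c * n. f t * block_vec c n l x $ t) =
      (\<Sum>b<n. if b = l then (\<Sum>p<c. f (c * b + p) * x $ p) else 0)"
    unfolding sum_lessThan_mult by (intro sum.cong refl) (auto simp: block_vec_def)
  then show ?thesis using assms by (simp add: sum.delta)
qed

text \<open>Only block column l of M meets a vector supported in block l. One calculation thus
  serves the maps of an ampliation, their transposes and the Kronecker product with C.\<close>

lemma block_corner_mult_vec:
  fixes M N :: "'a::field mat"
  assumes M: "M \<in> carrier_mat (r * n) (c * n)" and N: "N \<in> carrier_mat r c"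
    and x: "x \<in> carrier_vec c" and l: "l < n"
    and col: "\<And>i p. i < r * n \<Longrightarrow> p < c \<Longrightarrow>
      M $$ (i, c * l + p) = (if i div r = l then N $$ (i mod r, p) else 0)"
  shows "M *\<^sub>v block_vec c n l x = block_vec r n l (N *\<^sub>v x)"
proof (rule eq_vecI)
  fix i assume "i < dim_vec (block_vec r n l (N *\<^sub>v x))"
  then have i: "i < r * n" by (simp add: block_vec_def)
  have "(M *\<^sub>v block_vec c n l x) $ i = (\<Sum>p<c. M $$ (i, c * l + p) * x $ p)"
    using i M by (subst index_mult_mat_vec_sum) (auto simp: sum_block_vec[OF l])
  also have "\<dots> = (if i div r = l then (\<Sum>p<c. N $$ (i mod r, p) * x $ p) else 0)"
    using i by (simp add: col)
  also have "\<dots> = block_vec r n l (N *\<^sub>v x) $ i"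
    using i N x by (auto simp: block_vec_def index_mult_mat_vec_sum simp del: index_mult_mat_vec)
  finally show "(M *\<^sub>v block_vec c n l x) $ i = block_vec r n l (N *\<^sub>v x) $ i" .
qed (use M in \<open>auto simp: block_vec_def\<close>)

text \<open>T sends zero blocks to zero, so E_ll \<otimes> Z is mapped to E_ll \<otimes>
  T(Z).\<close>

lemma block_apply_block_unit_index:
  assumes T: "linear_mat_map s r c T" and Z: "Z \<in> carrier_mat s s"
    and i: "i < r * n" and j: "j < c * n"
  shows "block_apply s r c n T (block_unit s n l Z) $$ (i, j) =
    (if i div r = l \<and> j div c = l then T Z $$ (i mod r, j mod c) else 0)"
proof -
  have lt: "i div r < n" "j div c < n" using i j by auto
  have "mat_block s (block_unit s n l Z) (i div r) (j div c) =
      (if i div r = l \<and> j div c = l then Z else 0\<^sub>m s s)"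
    using Z lt by (intro eq_matI) (auto simp: mat_block_def block_unit_def)
  then show ?thesis
    using i j by (simp add: block_apply_def linear_mat_map_zero[OF T])
qed

lemma block_apply_block_unit_mult_vec:
  fixes T :: "'a::field mat \<Rightarrow> 'a mat"
  assumes T: "linear_mat_map s r c T" and Z: "Z \<in> carrier_mat s s" and l: "l < n"
    and x: "x \<in> carrier_vec c"
  shows "block_apply s r c n T (block_unit s n l Z) *\<^sub>v block_vec c n l x = block_vec r n l (T Z *\<^sub>v x)"
proof (rule block_corner_mult_vec[OF _ linear_mat_map_carrier[OF T Z] x l])
  show "block_apply s r c n T (block_unit s n l Z) $$ (i, c * l + p) =
      (if i div r = l then T Z $$ (i mod r, p) else 0)" if "i < r * n" "p < c" for i p
    using that l by (subst block_apply_block_unit_index[OF T Z]) auto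
qed (simp add: block_apply_def)

lemma transpose_block_apply_block_unit_mult_vec:
  fixes T :: "'a::field mat \<Rightarrow> 'a mat"
  assumes T: "linear_mat_map s r c T" and Z: "Z \<in> carrier_mat s s" and l: "l < n"
    and x: "x \<in> carrier_vec r"
  shows "(block_apply s r c n T (block_unit s n l Z))\<^sup>T *\<^sub>v block_vec r n l x =
    block_vec c n l ((T Z)\<^sup>T *\<^sub>v x)"
proof (rule block_corner_mult_vec[OF _ _ x l])
  show "(block_apply s r c n T (block_unit s n l Z))\<^sup>T $$ (i, r * l + p) =
      (if i div c = l then (T Z)\<^sup>T $$ (i mod c, p) else 0)" if "i < c * n" "p < r" for i p
  proof -
    have "(block_apply s r c n T (block_unit s n l Z))\<^sup>T $$ (i, r * l + p) =
      block_apply s r c n T (block_unit s n l Z) $$ (r * l + p, i)"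
      using that l by (subst index_transpose_mat) (auto simp: block_apply_def)
    then show ?thesis
      using that l linear_mat_map_carrier[OF T Z]
      by (subst (asm) block_apply_block_unit_index[OF T Z]) auto
  qed
qed (use linear_mat_map_carrier[OF T Z] in \<open>auto simp: block_apply_def\<close>)

lemma Ikron_transpose: "(Ikron n D)\<^sup>T = Ikron n (D\<^sup>T)"
  by (rule eq_matI) (auto simp: Ikron_index)

lemma Ikron_mult_block_vec:
  fixes D :: "'a::field mat"
  assumes D: "D \<in> carrier_mat r c" and x: "x \<in> carrier_vec c" and l: "l < n"
  shows "Ikron n D *\<^sub>v block_vec c n l x = block_vec r n l (D *\<^sub>v x)"
  by (rule block_corner_mult_vec[OF _ D x l]) (use D l in \<open>auto simp: Ikron_index\<close>)

text \<open>A vector is the sum of its blocks; the induction adds them one at a time.\<close>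

lemma krylov_block_vec_generate:
  assumes "\<And>l v. l < n \<Longrightarrow> v \<in> carrier_vec r \<Longrightarrow> block_vec r n l v \<in> krylov (r * n) \<A> S"
  shows "carrier_vec (r * n) \<subseteq> krylov (r * n) \<A> S"
proof
  fix v :: "'a vec" assume v: "v \<in> carrier_vec (r * n)"
  have "vec (r * n) (\<lambda>t. if t div r < N then v $ t else 0) \<in> krylov (r * n) \<A> S" if "N \<le> n" for N
    using that
  proof (induction N)
    case 0
    have "vec (r * n) (\<lambda>t. if t div r < 0 then v $ t else 0) = 0\<^sub>v (r * n)" by (intro eq_vecI) auto
    then show ?case by (simp add: krylov_zero)
  next
    case (Suc N)
    define w where "w = vec r (\<lambda>p. v $ (r * N + p))"
    have "vec (r * n) (\<lambda>t. if t div r < Suc N then v $ t else 0) =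
        vec (r * n) (\<lambda>t. if t div r < N then v $ t else 0) + block_vec r n N w"
      by (intro eq_vecI) (auto simp: block_vec_def w_def less_Suc_eq)
    moreover have "block_vec r n N w \<in> krylov (r * n) \<A> S"
      using Suc by (intro assms) (auto simp: w_def)
    ultimately show ?case using Suc by (simp add: krylov_add)
  qed
  from this[of n] have "vec (r * n) (\<lambda>t. if t div r < n then v $ t else 0) \<in> krylov (r * n) \<A> S" by simp
  moreover have "vec (r * n) (\<lambda>t. if t div r < n then v $ t else 0) = v"
    using v by (intro eq_vecI) auto
  ultimately show "v \<in> krylov (r * n) \<A> S" by simp
qed

text \<open>The embedding of v as e_l \<otimes> v intertwines the generators, so it carries one
  Krylov space into the other.\<close>

lemma krylov_block_vec:
  fixes v :: "'a::field vec"
  assumes v: "v \<in> krylov r \<A> S" and c: "\<A> \<subseteq> carrier_mat r r" "S \<subseteq> carrier_vec r"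
    and base: "\<And>x. x \<in> S \<Longrightarrow> block_vec r n l x \<in> S'"
    and step: "\<And>A. A \<in> \<A> \<Longrightarrow> \<exists>A'\<in>\<A>'. \<forall>x\<in>carrier_vec r. A' *\<^sub>v block_vec r n l x = block_vec r n l (A *\<^sub>v x)"
  shows "block_vec r n l v \<in> krylov (r * n) \<A>' S'"
  using v
proof induction
  case krylov_zero
  have "block_vec r n l (0\<^sub>v r) = (0\<^sub>v (r * n) :: 'a vec)" by (intro eq_vecI) (auto simp: block_vec_def)
  then show ?case by (simp add: krylov.krylov_zero)
next
  case (krylov_base v)
  then show ?case by (intro krylov.krylov_base base)
next
  case (krylov_add v w)
  then have "v \<in> carrier_vec r" "w \<in> carrier_vec r" using krylov_carrier[OF c] by auto
  then have "block_vec r n l (v + w) = block_vec r n l v + block_vec r n l w"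
    by (intro eq_vecI) (auto simp: block_vec_def)
  then show ?case using krylov_add.IH by (simp add: krylov.krylov_add)
next
  case (krylov_smult v a)
  then have "v \<in> carrier_vec r" using krylov_carrier[OF c] by auto
  then have "block_vec r n l (a \<cdot>\<^sub>v v) = a \<cdot>\<^sub>v block_vec r n l v"
    by (intro eq_vecI) (auto simp: block_vec_def)
  then show ?case using krylov_smult.IH by (simp add: krylov.krylov_smult)
next
  case (krylov_step v A)
  then have v: "v \<in> carrier_vec r" using krylov_carrier[OF c] by auto
  obtain A' where "A' \<in> \<A>'" "A' *\<^sub>v block_vec r n l v = block_vec r n l (A *\<^sub>v v)"
    using step[OF krylov_step.hyps(2)] v by blast
  then show ?case using krylov.krylov_step[OF krylov_step.IH, of A'] by simp
qed

text \<open>The ampliated A and B accept arbitrary matrices of size s * n. At block units they act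
  as A and B on block l and as zero elsewhere, so each of the n copies of the state space is reached
  on its own.\<close>

lemma controllable_fm_ampl:
  assumes fm: "is_fm_realization s \<R>" and ctrl: "controllable s \<R>"
  shows "controllable (s * n) (fm_ampl s n \<R>)"
proof -
  let ?L = "fm_L \<R>"
  define \<A> where "\<A> = {fm_A \<R> k M | k M. M \<in> carrier_mat s s}"
  define S where "S = {fm_B \<R> k M *\<^sub>v x | k M x. M \<in> carrier_mat s s \<and> x \<in> carrier_vec s}"
  define \<A>' where "\<A>' = {fm_A (fm_ampl s n \<R>) k M | k M. M \<in> carrier_mat (s * n) (s * n)}"
  define S' where "S' = {fm_B (fm_ampl s n \<R>) k M *\<^sub>v x | k M x.
    M \<in> carrier_mat (s * n) (s * n) \<and> x \<in> carrier_vec (s * n)}"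
  have A: "linear_mat_map s ?L ?L (fm_A \<R> k)" and B: "linear_mat_map s ?L s (fm_B \<R> k)" for k
    using fm by (auto simp: is_fm_realization_def)
  have c: "\<A> \<subseteq> carrier_mat ?L ?L" "S \<subseteq> carrier_vec ?L"
    using linear_mat_map_carrier[OF A] mult_mat_vec_carrier[OF linear_mat_map_carrier[OF B]]
    by (auto simp: \<A>_def S_def)
  have "block_vec ?L n l v \<in> krylov (?L * n) \<A>' S'" if l: "l < n" and v: "v \<in> carrier_vec ?L" for l v
  proof (rule krylov_block_vec[OF _ c])
    show "v \<in> krylov ?L \<A> S" using v ctrl by (auto simp: controllable_def \<A>_def S_def)
    show "block_vec ?L n l x \<in> S'" if xS: "x \<in> S" for x
    proof -
      obtain k M y where "x = fm_B \<R> k M *\<^sub>v y" "M \<in> carrier_mat s s" "y \<in> carrier_vec s"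
        using xS by (auto simp: S_def)
      then have "block_vec ?L n l x = fm_B (fm_ampl s n \<R>) k (block_unit s n l M) *\<^sub>v block_vec s n l y"
        using block_apply_block_unit_mult_vec[OF B _ l] by (simp add: fm_ampl_def)
      then show ?thesis unfolding S'_def using block_unit_carrier block_vec_carrier by blast
    qed
    show "\<exists>A'\<in>\<A>'. \<forall>x\<in>carrier_vec ?L. A' *\<^sub>v block_vec ?L n l x = block_vec ?L n l (A *\<^sub>v x)"
      if "A \<in> \<A>" for A
    proof -
      obtain k M where "A = fm_A \<R> k M" "M \<in> carrier_mat s s" using \<open>A \<in> \<A>\<close> by (auto simp: \<A>_def)
      then have "fm_A (fm_ampl s n \<R>) k (block_unit s n l M) *\<^sub>v block_vec ?L n l x = block_vec ?L n l (A *\<^sub>v x)"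
        if "x \<in> carrier_vec ?L" for x
        using block_apply_block_unit_mult_vec[OF \<open>\<And>k. linear_mat_map s ?L ?L (fm_A \<R> k)\<close> _ l that] by (simp add: fm_ampl_def)
      moreover have "fm_A (fm_ampl s n \<R>) k (block_unit s n l M) \<in> \<A>'"
        unfolding \<A>'_def using block_unit_carrier by blast
      ultimately show ?thesis by blast
    qed
  qed
  from krylov_block_vec_generate[OF this]
  show ?thesis by (simp add: controllable_def \<A>'_def S'_def fm_ampl_def)
qed

text \<open>The same with transposed maps; the base vectors now come from the Kronecker product with
  the transpose of C, which respects the blocks.\<close>

lemma observable_fm_ampl:
  assumes fm: "is_fm_realization s \<R>" and obs: "observable s \<R>"
  shows "observable (s * n) (fm_ampl s n \<R>)"
proof -
  let ?L = "fm_L \<R>"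
  define \<A> where "\<A> = {(fm_A \<R> k M)\<^sup>T | k M. M \<in> carrier_mat s s}"
  define S where "S = {(fm_C \<R>)\<^sup>T *\<^sub>v x | x. x \<in> carrier_vec s}"
  define \<A>' where "\<A>' = {(fm_A (fm_ampl s n \<R>) k M)\<^sup>T | k M. M \<in> carrier_mat (s * n) (s * n)}"
  define S' where "S' = {(fm_C (fm_ampl s n \<R>))\<^sup>T *\<^sub>v x | x. x \<in> carrier_vec (s * n)}"
  have A: "linear_mat_map s ?L ?L (fm_A \<R> k)" and C: "fm_C \<R> \<in> carrier_mat s ?L" for k
    using fm by (auto simp: is_fm_realization_def)
  have CT: "(fm_C \<R>)\<^sup>T \<in> carrier_mat ?L s" using C by simp
  have c: "\<A> \<subseteq> carrier_mat ?L ?L" "S \<subseteq> carrier_vec ?L"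
    using linear_mat_map_carrier[OF A] C by (auto simp: \<A>_def S_def)
  have "block_vec ?L n l v \<in> krylov (?L * n) \<A>' S'" if l: "l < n" and v: "v \<in> carrier_vec ?L" for l v
  proof (rule krylov_block_vec[OF _ c])
    show "v \<in> krylov ?L \<A> S" using v obs by (auto simp: observable_def \<A>_def S_def)
    show "block_vec ?L n l x \<in> S'" if xS: "x \<in> S" for x
    proof -
      obtain y where "x = (fm_C \<R>)\<^sup>T *\<^sub>v y" "y \<in> carrier_vec s" using xS by (auto simp: S_def)
      then have "block_vec ?L n l x = (fm_C (fm_ampl s n \<R>))\<^sup>T *\<^sub>v block_vec s n l y"
        using Ikron_mult_block_vec[OF CT _ l] by (simp add: fm_ampl_def Ikron_transpose)
      then show ?thesis unfolding S'_def using block_vec_carrier by blast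
    qed
    show "\<exists>A'\<in>\<A>'. \<forall>x\<in>carrier_vec ?L. A' *\<^sub>v block_vec ?L n l x = block_vec ?L n l (A *\<^sub>v x)"
      if "A \<in> \<A>" for A
    proof -
      obtain k M where "A = (fm_A \<R> k M)\<^sup>T" "M \<in> carrier_mat s s" using \<open>A \<in> \<A>\<close> by (auto simp: \<A>_def)
      then have "(fm_A (fm_ampl s n \<R>) k (block_unit s n l M))\<^sup>T *\<^sub>v block_vec ?L n l x = block_vec ?L n l (A *\<^sub>v x)"
        if "x \<in> carrier_vec ?L" for x
        using transpose_block_apply_block_unit_mult_vec[OF \<open>\<And>k. linear_mat_map s ?L ?L (fm_A \<R> k)\<close> _ l that]
        by (simp add: fm_ampl_def)
      moreover have "(fm_A (fm_ampl s n \<R>) k (block_unit s n l M))\<^sup>T \<in> \<A>'"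
        unfolding \<A>'_def using block_unit_carrier by blast
      ultimately show ?thesis by blast
    qed
  qed
  from krylov_block_vec_generate[OF this]
  show ?thesis by (simp add: observable_def \<A>'_def S'_def fm_ampl_def)
qed

section \<open>Comparison of two realizations\<close>

text \<open>Pairs of states steered by the same inputs, that is, the reachable space of the direct
  sum. A relation and not a map, because w need not be determined by v when \<open>\<R>2\<close> is
  not observable.\<close>

inductive joint_reach ::
  "nat \<Rightarrow> ('d, 'a::field) fm_realization \<Rightarrow> ('d, 'a) fm_realization \<Rightarrow> 'a vec \<Rightarrow> 'a vec \<Rightarrow> bool"
  for s \<R>1 \<R>2 where
  joint_zero: "joint_reach s \<R>1 \<R>2 (0\<^sub>v (fm_L \<R>1)) (0\<^sub>v (fm_L \<R>2))"
| joint_base: "M \<in> carrier_mat s s \<Longrightarrow> x \<in> carrier_vec s \<Longrightarrow>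
    joint_reach s \<R>1 \<R>2 (fm_B \<R>1 k M *\<^sub>v x) (fm_B \<R>2 k M *\<^sub>v x)"
| joint_add: "joint_reach s \<R>1 \<R>2 v w \<Longrightarrow> joint_reach s \<R>1 \<R>2 v' w' \<Longrightarrow>
    joint_reach s \<R>1 \<R>2 (v + v') (w + w')"
| joint_smult: "joint_reach s \<R>1 \<R>2 v w \<Longrightarrow> joint_reach s \<R>1 \<R>2 (a \<cdot>\<^sub>v v) (a \<cdot>\<^sub>v w)"
| joint_step: "joint_reach s \<R>1 \<R>2 v w \<Longrightarrow> M \<in> carrier_mat s s \<Longrightarrow>
    joint_reach s \<R>1 \<R>2 (fm_A \<R>1 k M *\<^sub>v v) (fm_A \<R>2 k M *\<^sub>v w)"

lemma joint_reach_carrier: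
  assumes fm1: "is_fm_realization s \<R>1" and fm2: "is_fm_realization s \<R>2"
    and "joint_reach s \<R>1 \<R>2 v w"
  shows "v \<in> carrier_vec (fm_L \<R>1) \<and> w \<in> carrier_vec (fm_L \<R>2)"
proof -
  have l: "linear_family s (fm_L \<R>1) (fm_L \<R>1) (fm_A \<R>1)" "linear_family s (fm_L \<R>1) s (fm_B \<R>1)"
    "linear_family s (fm_L \<R>2) (fm_L \<R>2) (fm_A \<R>2)" "linear_family s (fm_L \<R>2) s (fm_B \<R>2)"
    using fm1 fm2 by (auto simp: is_fm_realization_iff)
  show ?thesis
    using assms(3)
    by induction (auto intro: mult_mat_vec_carrier linear_family_carrier[OF l(1)] linear_family_carrier[OF l(2)]
      linear_family_carrier[OF l(3)] linear_family_carrier[OF l(4)])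
qed

text \<open>Equal Taylor coefficients are the base case. A step with (k, M) is absorbed by appending
  (k, M) to the word, which is why the word stays arbitrary in the induction.\<close>

lemma joint_reach_output:
  assumes fm1: "is_fm_realization s \<R>1" and fm2: "is_fm_realization s \<R>2"
    and taylor: "\<And>ps k M. \<forall>p\<in>set ps. snd p \<in> carrier_mat s s \<Longrightarrow> M \<in> carrier_mat s s \<Longrightarrow>
      fm_C \<R>1 * (word_prod (fm_L \<R>1) (fm_A \<R>1) ps * fm_B \<R>1 k M) =
      fm_C \<R>2 * (word_prod (fm_L \<R>2) (fm_A \<R>2) ps * fm_B \<R>2 k M)"
    and "joint_reach s \<R>1 \<R>2 v w" and "\<forall>p\<in>set ps. snd p \<in> carrier_mat s s"
  shows "fm_C \<R>1 *\<^sub>v (word_prod (fm_L \<R>1) (fm_A \<R>1) ps *\<^sub>v v) =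
    fm_C \<R>2 *\<^sub>v (word_prod (fm_L \<R>2) (fm_A \<R>2) ps *\<^sub>v w)"
  using assms(4,5)
proof (induction arbitrary: ps)
  let ?W1 = "word_prod (fm_L \<R>1) (fm_A \<R>1)" and ?W2 = "word_prod (fm_L \<R>2) (fm_A \<R>2)"
  have l: "linear_family s (fm_L \<R>1) (fm_L \<R>1) (fm_A \<R>1)" "linear_family s (fm_L \<R>1) s (fm_B \<R>1)"
    "linear_family s (fm_L \<R>2) (fm_L \<R>2) (fm_A \<R>2)" "linear_family s (fm_L \<R>2) s (fm_B \<R>2)"
    and C1: "fm_C \<R>1 \<in> carrier_mat s (fm_L \<R>1)" and C2: "fm_C \<R>2 \<in> carrier_mat s (fm_L \<R>2)"
    using fm1 fm2 by (auto simp: is_fm_realization_iff)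
  note W1 = word_prod_carrier[OF l(1)] and W2 = word_prod_carrier[OF l(3)]
  note cv = joint_reach_carrier[OF fm1 fm2]
  {
    case joint_zero
    have "M *\<^sub>v 0\<^sub>v c = 0\<^sub>v r" if "M \<in> carrier_mat r c" for M :: "'b mat" and r c
      using that by (intro eq_vecI) auto
    then show ?case using W1[OF joint_zero] W2[OF joint_zero] C1 C2 by metis
  next
    case (joint_base M x k)
    note w1 = W1[OF joint_base(3)] and w2 = W2[OF joint_base(3)]
      and B1 = linear_family_carrier[OF l(2) joint_base(1), of k]
      and B2 = linear_family_carrier[OF l(4) joint_base(1), of k]
    have "(fm_C \<R>1 * (?W1 ps * fm_B \<R>1 k M)) *\<^sub>v x = fm_C \<R>1 *\<^sub>v (?W1 ps *\<^sub>v (fm_B \<R>1 k M *\<^sub>v x))"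
      using assoc_mult_mat_vec[OF C1 mult_carrier_mat[OF w1 B1] joint_base(2)]
        assoc_mult_mat_vec[OF w1 B1 joint_base(2)] by simp
    moreover have "(fm_C \<R>2 * (?W2 ps * fm_B \<R>2 k M)) *\<^sub>v x = fm_C \<R>2 *\<^sub>v (?W2 ps *\<^sub>v (fm_B \<R>2 k M *\<^sub>v x))"
      using assoc_mult_mat_vec[OF C2 mult_carrier_mat[OF w2 B2] joint_base(2)]
        assoc_mult_mat_vec[OF w2 B2 joint_base(2)] by simp
    ultimately show ?case using taylor[OF joint_base(3,1), of k] by simp
  next
    case (joint_add v w v' w')
    note c = cv[OF joint_add(1)] cv[OF joint_add(2)]
    note w1 = W1[OF joint_add.prems] and w2 = W2[OF joint_add.prems]
    have "fm_C \<R>1 *\<^sub>v (?W1 ps *\<^sub>v (v + v')) = fm_C \<R>1 *\<^sub>v (?W1 ps *\<^sub>v v) + fm_C \<R>1 *\<^sub>v (?W1 ps *\<^sub>v v')"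
      using c w1 C1 by (simp add: mult_add_distrib_mat_vec[of _ "fm_L \<R>1" "fm_L \<R>1"] mult_add_distrib_mat_vec[of _ s "fm_L \<R>1"])
    moreover have "fm_C \<R>2 *\<^sub>v (?W2 ps *\<^sub>v (w + w')) = fm_C \<R>2 *\<^sub>v (?W2 ps *\<^sub>v w) + fm_C \<R>2 *\<^sub>v (?W2 ps *\<^sub>v w')"
      using c w2 C2 by (simp add: mult_add_distrib_mat_vec[of _ "fm_L \<R>2" "fm_L \<R>2"] mult_add_distrib_mat_vec[of _ s "fm_L \<R>2"])
    ultimately show ?case using joint_add.IH joint_add.prems by simp
  next
    case (joint_smult v w a)
    note c = cv[OF joint_smult(1)]
    note w1 = W1[OF joint_smult.prems] and w2 = W2[OF joint_smult.prems]
    have "fm_C \<R>1 *\<^sub>v (?W1 ps *\<^sub>v (a \<cdot>\<^sub>v v)) = a \<cdot>\<^sub>v (fm_C \<R>1 *\<^sub>v (?W1 ps *\<^sub>v v))"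
      using c w1 C1 by (simp add: mult_mat_vec[of _ "fm_L \<R>1" "fm_L \<R>1"] mult_mat_vec[of _ s "fm_L \<R>1"])
    moreover have "fm_C \<R>2 *\<^sub>v (?W2 ps *\<^sub>v (a \<cdot>\<^sub>v w)) = a \<cdot>\<^sub>v (fm_C \<R>2 *\<^sub>v (?W2 ps *\<^sub>v w))"
      using c w2 C2 by (simp add: mult_mat_vec[of _ "fm_L \<R>2" "fm_L \<R>2"] mult_mat_vec[of _ s "fm_L \<R>2"])
    ultimately show ?case using joint_smult.IH joint_smult.prems by simp
  next
    case (joint_step v w M k)
    note c = cv[OF joint_step(1)]
    note w1 = W1[OF joint_step.prems] and w2 = W2[OF joint_step.prems]
    have "\<forall>p\<in>set (ps @ [(k, M)]). snd p \<in> carrier_mat s s" using joint_step by auto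
    from joint_step.IH[OF this] show ?case
      using c assoc_mult_mat_vec[OF w1 linear_family_carrier[OF l(1) joint_step.hyps(2), of k], of v]
        assoc_mult_mat_vec[OF w2 linear_family_carrier[OF l(3) joint_step.hyps(2), of k], of w] by simp
  }
qed

text \<open>Such a state is orthogonal to the Krylov space of the transposed data, and observability
  puts the unit vectors into that space. Moving a transpose across the scalar product replaces v by
  A(M) v, so the orthogonality claim is proved for all such v at once.\<close>

lemma observable_zero:
  assumes fm: "is_fm_realization s \<R>" and obs: "observable s \<R>" and v: "v \<in> carrier_vec (fm_L \<R>)"
    and zero: "\<And>ps. \<forall>p\<in>set ps. snd p \<in> carrier_mat s s \<Longrightarrow>
      fm_C \<R> *\<^sub>v (word_prod (fm_L \<R>) (fm_A \<R>) ps *\<^sub>v v) = 0\<^sub>v s"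
  shows "v = 0\<^sub>v (fm_L \<R>)"
proof -
  let ?L = "fm_L \<R>" and ?W = "word_prod (fm_L \<R>) (fm_A \<R>)"
  have A: "linear_family s ?L ?L (fm_A \<R>)" and C: "fm_C \<R> \<in> carrier_mat s ?L"
    using fm by (auto simp: is_fm_realization_iff)
  define \<A> where "\<A> = {(fm_A \<R> k M)\<^sup>T | k M. M \<in> carrier_mat s s}"
  define S where "S = {(fm_C \<R>)\<^sup>T *\<^sub>v x | x. x \<in> carrier_vec s}"
  have c: "\<A> \<subseteq> carrier_mat ?L ?L" "S \<subseteq> carrier_vec ?L"
    using linear_family_carrier[OF A] C by (auto simp: \<A>_def S_def)
  have orth: "u \<bullet> v = 0" if "u \<in> krylov ?L \<A> S" "v \<in> carrier_vec ?L"
    "\<And>ps. \<forall>p\<in>set ps. snd p \<in> carrier_mat s s \<Longrightarrow> fm_C \<R> *\<^sub>v (?W ps *\<^sub>v v) = 0\<^sub>v s" for u v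
    using that
  proof (induction arbitrary: v)
    case krylov_zero
    then show ?case by simp
  next
    case (krylov_base u)
    then obtain x where x: "u = (fm_C \<R>)\<^sup>T *\<^sub>v x" "x \<in> carrier_vec s" by (auto simp: S_def)
    have "fm_C \<R> *\<^sub>v v = 0\<^sub>v s" using krylov_base(3)[of "[]"] krylov_base(2) by simp
    then show ?case
      using transpose_vec_mult_scalar[OF C krylov_base(2) x(2)] x by simp
  next
    case (krylov_add u u')
    have "u \<in> carrier_vec ?L" "u' \<in> carrier_vec ?L" using krylov_add.hyps krylov_carrier[OF c] by auto
    then show ?case
      using krylov_add.IH(1)[OF krylov_add.prems] krylov_add.IH(2)[OF krylov_add.prems] krylov_add.prems(1)
      by (simp add: add_scalar_prod_distrib[of _ ?L])
  next
    case (krylov_smult u a)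
    have "u \<in> carrier_vec ?L" using krylov_smult.hyps krylov_carrier[OF c] by auto
    then show ?case using krylov_smult.IH[OF krylov_smult.prems] krylov_smult.prems(1) by simp
  next
    case (krylov_step u B)
    then obtain k M where B: "B = (fm_A \<R> k M)\<^sup>T" and M: "M \<in> carrier_mat s s" by (auto simp: \<A>_def)
    note Ac = linear_family_carrier[OF A M, of k]
    have u: "u \<in> carrier_vec ?L" using krylov_step.hyps krylov_carrier[OF c] by auto
    have "u \<bullet> (fm_A \<R> k M *\<^sub>v v) = 0"
    proof (rule krylov_step.IH)
      show "fm_A \<R> k M *\<^sub>v v \<in> carrier_vec ?L" using Ac krylov_step.prems(1) by auto
      fix ps :: "('a \<times> 'b mat) list" assume ps: "\<forall>p\<in>set ps. snd p \<in> carrier_mat s s"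
      have "fm_C \<R> *\<^sub>v (?W (ps @ [(k, M)]) *\<^sub>v v) = 0\<^sub>v s"
        using ps M by (intro krylov_step.prems) auto
      then show "fm_C \<R> *\<^sub>v (?W ps *\<^sub>v (fm_A \<R> k M *\<^sub>v v)) = 0\<^sub>v s"
        using assoc_mult_mat_vec[OF word_prod_carrier[OF A ps] Ac krylov_step.prems(1)] by simp
    qed
    then show ?case
      using transpose_vec_mult_scalar[OF Ac krylov_step.prems(1) u] by (simp add: B)
  qed
  show ?thesis
  proof (rule eq_vecI)
    fix i assume "i < dim_vec (0\<^sub>v ?L)"
    then have i: "i < ?L" by simp
    have "unit_vec ?L i \<in> krylov ?L \<A> S" using obs by (auto simp: observable_def \<A>_def S_def)
    from orth[OF this v zero] show "v $ i = 0\<^sub>v ?L $ i"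
      using v i by (simp add: scalar_prod_left_unit)
  qed (use v in auto)
qed

text \<open>If L2 < L1, a linear choice of partners has a kernel: some nonzero x is paired with the
  state 0 of \<open>\<R>2\<close>. All outputs of x then vanish, which observability
  forbids.\<close>

lemma controllable_observable_minimal:
  fixes R :: "('d::finite, 'a::field) nc_rat"
  assumes s: "s \<ge> 1" and Y: "Y \<in> nc_dom s R"
    and real1: "fm_realizes s Y \<R>1 R" and real2: "fm_realizes s Y \<R>2 R"
    and ctrl: "controllable s \<R>1" and obs: "observable s \<R>1"
  shows "fm_L \<R>1 \<le> fm_L \<R>2"
proof (rule ccontr)
  let ?L1 = "fm_L \<R>1" and ?L2 = "fm_L \<R>2"
  assume "\<not> ?L1 \<le> ?L2"
  then have less: "?L2 < ?L1" by simp
  have fm1: "is_fm_realization s \<R>1" and fm2: "is_fm_realization s \<R>2"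
    using real1 real2 by (auto simp: fm_realizes_iff)
  have l: "linear_family s ?L1 ?L1 (fm_A \<R>1)" "linear_family s ?L1 s (fm_B \<R>1)"
    "linear_family s ?L2 ?L2 (fm_A \<R>2)" "linear_family s ?L2 s (fm_B \<R>2)"
    and C1: "fm_C \<R>1 \<in> carrier_mat s ?L1" and C2: "fm_C \<R>2 \<in> carrier_mat s ?L2"
    using fm1 fm2 by (auto simp: is_fm_realization_iff)
  have Yc: "Y k \<in> carrier_mat s s" for k using Y by (auto simp: nc_dom_def)
  \<comment> \<open>Both realizations take the value of R at the bidiagonal point, so both sides are
    read off from the same block of it.\<close>
  have taylor: "fm_C \<R>1 * (word_prod ?L1 (fm_A \<R>1) ps * fm_B \<R>1 k M) =
      fm_C \<R>2 * (word_prod ?L2 (fm_A \<R>2) ps * fm_B \<R>2 k M)"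
    if ps: "\<forall>p\<in>set ps. snd p \<in> carrier_mat s s" and M: "M \<in> carrier_mat s s" for ps k M
  proof -
    define qs where "qs = ps @ [(k, M)]"
    have dom: "bidiag s Y qs \<in> nc_dom (s * Suc (length qs)) R" by (rule bidiag_in_nc_dom[OF Y s])
    then obtain N where N: "nc_eval (s * Suc (length qs)) (bidiag s Y qs) R = Some N"
      and X: "\<forall>k. bidiag s Y qs k \<in> carrier_mat (s * Suc (length qs)) (s * Suc (length qs))"
      by (auto simp: nc_dom_def)
    have val: "fm_val s Y \<R>1 (Suc (length qs)) (bidiag s Y qs) N" "fm_val s Y \<R>2 (Suc (length qs)) (bidiag s Y qs) N"
      using real1 real2 N X unfolding fm_realizes_iff by auto
    note t1 = taylor_coefficient[where Y = Y, OF fm1 Yc ps M qs_def val(1)]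
      and t2 = taylor_coefficient[where Y = Y, OF fm2 Yc ps M qs_def val(2)]
    have c1: "word_prod ?L1 (fm_A \<R>1) ps * fm_B \<R>1 k M \<in> carrier_mat ?L1 s"
      by (rule mult_carrier_mat[OF word_prod_carrier[OF l(1) ps] linear_family_carrier[OF l(2) M]])
    have c2: "word_prod ?L2 (fm_A \<R>2) ps * fm_B \<R>2 k M \<in> carrier_mat ?L2 s"
      by (rule mult_carrier_mat[OF word_prod_carrier[OF l(3) ps] linear_family_carrier[OF l(4) M]])
    show ?thesis
    proof (rule eq_matI)
      fix i j assume "i < dim_row (fm_C \<R>2 * (word_prod ?L2 (fm_A \<R>2) ps * fm_B \<R>2 k M))"
        "j < dim_col (fm_C \<R>2 * (word_prod ?L2 (fm_A \<R>2) ps * fm_B \<R>2 k M))"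
      then have "i < s" "j < s"
        using carrier_matD[OF mult_carrier_mat[OF C2 c2]] by auto
      then show "(fm_C \<R>1 * (word_prod ?L1 (fm_A \<R>1) ps * fm_B \<R>1 k M)) $$ (i, j) =
        (fm_C \<R>2 * (word_prod ?L2 (fm_A \<R>2) ps * fm_B \<R>2 k M)) $$ (i, j)"
        using t1 t2 by metis
    qed (use carrier_matD[OF mult_carrier_mat[OF C1 c1]] carrier_matD[OF mult_carrier_mat[OF C2 c2]] in auto)
  qed
  have "\<exists>w. joint_reach s \<R>1 \<R>2 v w" if "v \<in> carrier_vec ?L1" for v
  proof -
    have "v \<in> krylov ?L1 {fm_A \<R>1 k M | k M. M \<in> carrier_mat s s}
       {fm_B \<R>1 k M *\<^sub>v x | k M x. M \<in> carrier_mat s s \<and> x \<in> carrier_vec s}"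
      using that ctrl by (auto simp: controllable_def)
    then show ?thesis
      by induction (auto intro: joint_reach.intros)
  qed
  then have "\<exists>w. joint_reach s \<R>1 \<R>2 (unit_vec ?L1 i) w" for i
    by simp
  \<comment> \<open>Partners of the unit vectors, provided by controllability; they become the
    columns of T.\<close>
  then obtain g where g: "\<And>i. joint_reach s \<R>1 \<R>2 (unit_vec ?L1 i) (g i)"
    by metis
  have gc: "g i \<in> carrier_vec ?L2" for i using joint_reach_carrier[OF fm1 fm2 g] by simp
  define T where "T = mat ?L2 ?L1 (\<lambda>(j, i). g i $ j)"
  have T: "T \<in> carrier_mat ?L2 ?L1" by (simp add: T_def)
  obtain x where x: "x \<in> carrier_vec ?L1" "x \<noteq> 0\<^sub>v ?L1" "T *\<^sub>v x = 0\<^sub>v ?L2"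
    by (rule wide_mat_kernel[OF T less])
  \<comment> \<open>Pairs are closed under linear combinations: accumulating one coordinate of x at
    a time pairs x with T x = 0.\<close>
  have "joint_reach s \<R>1 \<R>2 (vec ?L1 (\<lambda>i. if i < n then x $ i else 0)) (vec ?L2 (\<lambda>j. \<Sum>i<n. x $ i * g i $ j))"
    if "n \<le> ?L1" for n
    using that
  proof (induction n)
    case 0
    have "vec ?L1 (\<lambda>i. if i < 0 then x $ i else 0) = 0\<^sub>v ?L1" "vec ?L2 (\<lambda>j. \<Sum>i<0. x $ i * g i $ j) = 0\<^sub>v ?L2"
      by (intro eq_vecI; simp)+
    then show ?case using joint_zero by metis
  next
    case (Suc n)
    have "vec ?L1 (\<lambda>i. if i < Suc n then x $ i else 0) =
        vec ?L1 (\<lambda>i. if i < n then x $ i else 0) + x $ n \<cdot>\<^sub>v unit_vec ?L1 n"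
      using Suc.prems by (intro eq_vecI) (auto simp: less_Suc_eq)
    moreover have "vec ?L2 (\<lambda>j. \<Sum>i<Suc n. x $ i * g i $ j) =
        vec ?L2 (\<lambda>j. \<Sum>i<n. x $ i * g i $ j) + x $ n \<cdot>\<^sub>v g n"
      using carrier_vecD[OF gc[of n]] by (intro eq_vecI) auto
    ultimately show ?case
      using Suc by (auto intro!: joint_add joint_smult g)
  qed
  from this[of ?L1] have "joint_reach s \<R>1 \<R>2 (vec ?L1 (\<lambda>i. if i < ?L1 then x $ i else 0))
    (vec ?L2 (\<lambda>j. \<Sum>i<?L1. x $ i * g i $ j))" by simp
  moreover have "vec ?L1 (\<lambda>i. if i < ?L1 then x $ i else 0) = x" using x by (intro eq_vecI) auto
  moreover have "vec ?L2 (\<lambda>j. \<Sum>i<?L1. x $ i * g i $ j) = T *\<^sub>v x"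
    using x(1) by (intro eq_vecI) (auto simp: T_def index_mult_mat_vec_sum mult.commute simp del: index_mult_mat_vec)
  ultimately have joint: "joint_reach s \<R>1 \<R>2 x (0\<^sub>v ?L2)" using x(3) by simp
  have "x = 0\<^sub>v ?L1"
  proof (rule observable_zero[OF fm1 obs x(1)])
    fix ps :: "('d \<times> 'a mat) list" assume ps: "\<forall>p\<in>set ps. snd p \<in> carrier_mat s s"
    have "M *\<^sub>v 0\<^sub>v c = 0\<^sub>v r" if "M \<in> carrier_mat r c" for M :: "'a mat" and r c
      using that by (intro eq_vecI) auto
    then have "fm_C \<R>2 *\<^sub>v (word_prod ?L2 (fm_A \<R>2) ps *\<^sub>v 0\<^sub>v ?L2) = 0\<^sub>v s"
      using word_prod_carrier[OF l(3) ps] C2 by metis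
    with joint_reach_output[OF fm1 fm2 taylor joint ps]
    show "fm_C \<R>1 *\<^sub>v (word_prod ?L1 (fm_A \<R>1) ps *\<^sub>v x) = 0\<^sub>v s" by simp
  qed
  with x(2) show False by simp
qed

section \<open>Minimal dimensions\<close>

lemma fm_min_dim_attained:
  assumes "Y \<in> nc_dom s R"
  obtains \<R> where "fm_realizes s Y \<R> R" "fm_L \<R> = fm_min_dim s R Y"
  using LeastI_ex[of "\<lambda>L. \<exists>\<R>. fm_realizes s Y \<R> R \<and> fm_L \<R> = L"] fm_realization_exists[OF assms]
  unfolding fm_min_dim_def by metis

lemma fm_min_dim_le: "fm_realizes s Y \<R> R \<Longrightarrow> fm_min_dim s R Y \<le> fm_L \<R>"
  unfolding fm_min_dim_def by (rule Least_le) blast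

text \<open>As Y' lies in the domain of R, the realization centred at Y has a value there, which is
  the invertibility demanded by \<open>fm_recentre\<close>.\<close>

lemma fm_min_dim_recentre_le:
  assumes Y: "Y \<in> nc_dom s R" and Y': "Y' \<in> nc_dom s R"
  shows "fm_min_dim s R Y' \<le> fm_min_dim s R Y"
proof -
  obtain \<R> where real: "fm_realizes s Y \<R> R" and L: "fm_L \<R> = fm_min_dim s R Y"
    by (rule fm_min_dim_attained[OF Y])
  have fm: "is_fm_realization s \<R>" and val: "\<And>m X M. m \<ge> 1 \<Longrightarrow> \<forall>k. X k \<in> carrier_mat (s * m) (s * m) \<Longrightarrow>
      nc_eval (s * m) X R = Some M \<Longrightarrow> fm_val s Y \<R> m X M"
    using real by (auto simp: fm_realizes_iff)
  have c: "Y k \<in> carrier_mat s s" "Y' k \<in> carrier_mat s s" for k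
    using Y Y' by (auto simp: nc_dom_def)
  obtain M0 where "nc_eval s Y' R = Some M0" using Y' by (auto simp: nc_dom_def)
  then have "fm_val s Y \<R> 1 Y' M0" using c by (intro val) auto
  from fm_recentre[where Y = Y and Y' = Y', OF fm c this] obtain \<R>' where "is_fm_realization s \<R>'" "fm_L \<R>' = fm_L \<R>"
    "\<And>m X M. \<forall>k. X k \<in> carrier_mat (s * m) (s * m) \<Longrightarrow> fm_val s Y \<R> m X M \<Longrightarrow> fm_val s Y' \<R>' m X M"
    by auto
  then have "fm_realizes s Y' \<R>' R" using val by (auto simp: fm_realizes_iff)
  from fm_min_dim_le[OF this] L \<open>fm_L \<R>' = fm_L \<R>\<close> show ?thesis by simp
qed

lemma fm_min_dim_recentre:
  "Y \<in> nc_dom s R \<Longrightarrow> Y' \<in> nc_dom s R \<Longrightarrow> fm_min_dim s R Y = fm_min_dim s R Y'"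
  by (intro antisym fm_min_dim_recentre_le)

lemma fm_min_dim_ampl:
  fixes R :: "('d::finite, 'a::field) nc_rat"
  assumes Y: "Y \<in> nc_dom s R" and s: "s \<ge> 1" and n: "n \<ge> 1"
  shows "fm_min_dim (s * n) R (ampl n Y) = n * fm_min_dim s R Y"
proof (rule antisym)
  obtain \<R> where real: "fm_realizes s Y \<R> R" and L: "fm_L \<R> = fm_min_dim s R Y"
    by (rule fm_min_dim_attained[OF Y])
  have fm: "is_fm_realization s \<R>" using real by (simp add: fm_realizes_iff)
  have min: "\<And>\<R>'. fm_realizes s Y \<R>' R \<Longrightarrow> fm_L \<R> \<le> fm_L \<R>'"
    using fm_min_dim_le L by metis
  note real_n = fm_realizes_fm_ampl[OF real n]
  have L_n: "fm_L (fm_ampl s n \<R>) = n * fm_min_dim s R Y" by (simp add: fm_ampl_def L)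
  show "fm_min_dim (s * n) R (ampl n Y) \<le> n * fm_min_dim s R Y"
    using fm_min_dim_le[OF real_n] L_n by simp
  have dom: "ampl n Y \<in> nc_dom (s * n) R" by (rule ampl_in_nc_dom[OF Y n])
  obtain \<R>' where real': "fm_realizes (s * n) (ampl n Y) \<R>' R"
    and L': "fm_L \<R>' = fm_min_dim (s * n) R (ampl n Y)"
    by (rule fm_min_dim_attained[OF dom])
  \<comment> \<open>The competitor \<open>\<R>'\<close> is arbitrary and need not be an ampliation;
    only the ampliated minimal realization has to be controllable and observable.\<close>
  have "fm_L (fm_ampl s n \<R>) \<le> fm_L \<R>'"
    using s n by (intro controllable_observable_minimal[OF _ dom real_n real']
        controllable_fm_ampl[OF fm] observable_fm_ampl[OF fm]
        minimal_controllable[OF real min] minimal_observable[OF real min]) auto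
  then show "n * fm_min_dim s R Y \<le> fm_min_dim (s * n) R (ampl n Y)"
    by (simp add: L_n L')
qed

theorem theorem2p21:
  fixes R :: "('d::finite, 'a::field) nc_rat"
    and s :: nat
    and Y :: "'d \<Rightarrow> 'a mat"
  assumes "nondegenerate R"
    and "s \<ge> 1"
    and "Y \<in> nc_dom s R"
  shows "(\<forall>Y' \<in> nc_dom s R. fm_min_dim s R Y = fm_min_dim s R Y') \<and>
         (\<forall>n\<ge>1. ampl n Y \<in> nc_dom (s * n) R \<and>
            fm_min_dim (s * n) R (ampl n Y) = n * fm_min_dim s R Y) \<and>
         (\<forall>s'\<ge>1. \<forall>Y' \<in> nc_dom s' R. s' * fm_min_dim s R Y = s * fm_min_dim s' R Y')"
proof (intro conjI allI impI ballI)
  fix Y' assume "Y' \<in> nc_dom s R"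
  with assms(3) show "fm_min_dim s R Y = fm_min_dim s R Y'" by (rule fm_min_dim_recentre)
next
  fix n :: nat assume "n \<ge> 1"
  with assms show "ampl n Y \<in> nc_dom (s * n) R"
    "fm_min_dim (s * n) R (ampl n Y) = n * fm_min_dim s R Y"
    by (auto intro: ampl_in_nc_dom fm_min_dim_ampl)
next
  fix s' :: nat and Y' assume s': "s' \<ge> 1" and Y': "Y' \<in> nc_dom s' R"
  have "s' * fm_min_dim s R Y = fm_min_dim (s * s') R (ampl s' Y)"
    using fm_min_dim_ampl[OF assms(3,2) s'] by simp
  \<comment> \<open>Both ampliations have the common size s * s' and lie in the domain, so one is a
    change of centre of the other.\<close>
  also have "\<dots> = fm_min_dim (s * s') R (ampl s Y')"
    using ampl_in_nc_dom[OF assms(3) s'] ampl_in_nc_dom[OF Y' assms(2)]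
    by (intro fm_min_dim_recentre) (simp_all add: mult.commute)
  also have "\<dots> = s * fm_min_dim s' R Y'"
    using fm_min_dim_ampl[OF Y' s' assms(2)] by (simp add: mult.commute)
  finally show "s' * fm_min_dim s R Y = s * fm_min_dim s' R Y'" .
qed

end
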